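(* Let $F>0$, let $H_L,H_R>0$ and set $\nu:=\sqrt{H_L/H_R}$. When $H_L<H_R$ (that is, $\nu<1$), there exists only one kind of non-characteristic traveling-wave profile connecting $H_L$ to $H_R$: (i) increasing smooth profiles, which exist if and only if $H_L<H_R<H_s$, that is, if and only if $$\nu<1,\qquad \frac{\nu+1}{\nu^2}<F.$$ When $H_R<H_L$ (that is, $\nu>1$), there exist four kinds of non-characteristic traveling-wave profiles connecting $H_L$ to $H_R$: (ii) nonmonotone discontinuous profiles, consisting of a smooth portion increasing from $H_L$ to $H_*$, connected by an entropy-admissible Lax shock to a portion constant equal to $H_R$, which exist if and only if $H_R<H_s<H_L<H_*$, that is, if and only if $$\nu>1,\qquad \frac{(\nu+1)\sqrt{2(\nu^2+1)}}{2\nu}<F<\nu(\nu+1);$$ (iii) Riemann profiles, consisting of a portion constant equal to $H_L$, connected by an entropy-admissible Lax shock to a portion constant equal to $H_R$, which exist if and only if $H_R<H_s<H_*=H_L$, that is, if and only if $$\nu>1,\qquad F=\frac{(\nu+1)\sqrt{2(\nu^2+1)}}{2\nu};$$ (iv) decreasing discontinuous profiles, consisting of a smooth portion decreasing from $H_L$ to $H_*$, connected by an entropy-admissible Lax shock to a portion constant equal to $H_R$, which exist if and only if $H_R<H_s<H_*<H_L$, that is, if and only if $$\nu>1,\qquad \frac{\nu+1}{\nu^2}<F<\frac{(\nu+1)\sqrt{2(\nu^2+1)}}{2\nu};$$ (v) smooth decreasing profiles, which exist if and only if $H_s<H_R<H_L$, that is, if and only if $$\nu>1,\qquad F<\fr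ac{\nu+1}{\nu^2}.$$
   Context: The inviscid Saint-Venant equations with Froude number $F>0$ are $$\partial_t h+\partial_x q=0,\qquad \partial_t q+\partial_x\Big(\frac{q^2}{h}+\frac{h^2}{2F^2}\Big)=h-\frac{|q|q}{h^2},$$ with fluid height $h>0$ and flow $q$. A traveling-wave profile connecting $H_L$ to $H_R$ is a pair $W=(H,Q)$, together with a speed $c$, such that $(h,q)(t,x)=(H,Q)(x-ct)$ is a weak solution, with $H>0$, $Q\ge 0$ (waves with nonnegative fluid velocity), with $(H,Q)$ piecewise smooth, all discontinuities satisfying the Rankine–Hugoniot conditions and the (Lax) entropy condition, and $(H,Q)(z)\to(H_L,H_L^{3/2})$ as $z\to-\infty$, $(H,Q)(z)\to(H_R,H_R^{3/2})$ as $z\to+\infty$ (endstates are necessarily equilibria $Q=H^{3/2}$). "Non-characteristic" means that $\frac{H}{F^2}-\big(c-\frac{Q}{H}\big)^2$ does not vanish on the profile (including one-sided limits at a discontinuity) nor at the endstates. Profiles are considered up to translation; a discontinuity, if present, is placed at $0$. The shape words (increasing, decreasing, nonmonotone) and the portions described refer to the height $H$. Necessarily $cH-Q\equiv q_0$ with $$c=\frac{H_L+\sqrt{H_LH_R}+H_R}{\sqrt{H_L}+\sqrt{H_R}},\qquad q_0=\frac{H_LH_R}{\sqrt{H_L}+\sqrt{H_R}}.$$ Notation: $$H_s:=(q_0F)^{2/3},\qquad H_*:=\sqrt{2\frac{H_s^3}{H_R}+\frac{H_R^2}{4}}-\frac{H_R}{2}.$$ *)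

theory Defs
  imports "HOL-Analysis.Analysis"
begin

section \<open>Weak solutions of the inviscid Saint-Venant equations\<close>

text \<open>
  A test function on the whole \<open>(t,x)\<close>-plane: continuously differentiable with compact support.
  The functions \<open>\<phi>t\<close> and \<open>\<phi>x\<close> are its partial derivatives.
\<close>

definition test_function ::
    "(real \<times> real \<Rightarrow> real) \<Rightarrow> (real \<times> real \<Rightarrow> real) \<Rightarrow> (real \<times> real \<Rightarrow> real) \<Rightarrow> bool" where
  "test_function \<phi> \<phi>t \<phi>x \<longleftrightarrow>
     (\<forall>p. (\<phi> has_derivative (\<lambda>(s, y). \<phi>t p * s + \<phi>x p * y)) (at p)) \<and>
     continuous_on UNIV \<phi>t \<and> continuous_on UNIV \<phi>x \<and>
     compact (closure {p. \<phi> p \<noteq> 0})"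

definition momentum_flux :: "real \<Rightarrow> real \<Rightarrow> real \<Rightarrow> real" where
  "momentum_flux F h q = q\<^sup>2 / h + h\<^sup>2 / (2 * F\<^sup>2)"

text \<open>
  Both balance laws in the sense of distributions.  Writing the integrals with
  \<^const>\<open>has_bochner_integral\<close> makes the integrability of the integrands part of the definition.
\<close>

definition weak_solution ::
    "real \<Rightarrow> (real \<Rightarrow> real \<Rightarrow> real) \<Rightarrow> (real \<Rightarrow> real \<Rightarrow> real) \<Rightarrow> bool" where
  "weak_solution F h q \<longleftrightarrow>
     (\<forall>\<phi> \<phi>t \<phi>x. test_function \<phi> \<phi>t \<phi>x \<longrightarrow>
        has_bochner_integral lborel
          (\<lambda>(t, x). h t x * \<phi>t (t, x) + q t x * \<phi>x (t, x)) 0 \<and>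
        has_bochner_integral lborel
          (\<lambda>(t, x). q t x * \<phi>t (t, x) + momentum_flux F (h t x) (q t x) * \<phi>x (t, x)
                   + (h t x - \<bar>q t x\<bar> * q t x / (h t x)\<^sup>2) * \<phi> (t, x)) 0)"


section \<open>Piecewise smooth functions\<close>

text \<open>Only meant for open \<open>S\<close>, since \<^const>\<open>deriv\<close> is the two-sided derivative.\<close>

definition smooth_on :: "real set \<Rightarrow> (real \<Rightarrow> real) \<Rightarrow> bool" where
  "smooth_on S f \<longleftrightarrow> (\<forall>n. \<forall>x\<in>S. (deriv ^^ n) f field_differentiable (at x))"

text \<open>
  Smooth away from a locally finite set of break points, where the function and all its
  derivatives have finite one-sided limits.  The value at a break point is unconstrained.
\<close>

definition piecewise_smooth :: "(real \<Rightarrow> real) \<Rightarrow> bool" where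
  "piecewise_smooth f \<longleftrightarrow>
     (\<exists>S. (\<forall>a b. finite (S \<inter> {a..b})) \<and> smooth_on (- S) f \<and>
          (\<forall>s\<in>S. \<forall>n. (\<exists>l. ((deriv ^^ n) f \<longlongrightarrow> l) (at_left s)) \<and>
                      (\<exists>l. ((deriv ^^ n) f \<longlongrightarrow> l) (at_right s))))"


section \<open>Rankine-Hugoniot and Lax conditions\<close>

text \<open>The state \<open>(h1, q1)\<close> is to the left and \<open>(h2, q2)\<close> to the right of the discontinuity.\<close>

definition rankine_hugoniot ::
    "real \<Rightarrow> real \<Rightarrow> real \<Rightarrow> real \<Rightarrow> real \<Rightarrow> real \<Rightarrow> bool" where
  "rankine_hugoniot F c h1 q1 h2 q2 \<longleftrightarrow>
     c * (h2 - h1) = q2 - q1 \<and>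
     c * (q2 - q1) = momentum_flux F h2 q2 - momentum_flux F h1 q1"

text \<open>
  The characteristic speeds, i.e. the eigenvalues of the Jacobian of the flux
  \<open>(q, q\<^sup>2/h + h\<^sup>2/(2F\<^sup>2))\<close>.
\<close>

definition char_speed1 :: "real \<Rightarrow> real \<Rightarrow> real \<Rightarrow> real" where
  "char_speed1 F h q = q / h - sqrt h / F"

definition char_speed2 :: "real \<Rightarrow> real \<Rightarrow> real \<Rightarrow> real" where
  "char_speed2 F h q = q / h + sqrt h / F"

text \<open>The two disjuncts are the Lax conditions for a 1-shock and for a 2-shock.\<close>

definition lax_condition ::
    "real \<Rightarrow> real \<Rightarrow> real \<Rightarrow> real \<Rightarrow> real \<Rightarrow> real \<Rightarrow> bool" where
  "lax_condition F c h1 q1 h2 q2 \<longleftrightarrow>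
     (char_speed1 F h2 q2 < c \<and> c < char_speed1 F h1 q1 \<and> c < char_speed2 F h2 q2) \<or>
     (char_speed2 F h2 q2 < c \<and> c < char_speed2 F h1 q1 \<and> char_speed1 F h1 q1 < c)"

definition lax_shock_at ::
    "real \<Rightarrow> real \<Rightarrow> (real \<Rightarrow> real) \<Rightarrow> (real \<Rightarrow> real) \<Rightarrow> real \<Rightarrow> bool" where
  "lax_shock_at F c H Q d \<longleftrightarrow>
     (\<exists>h1 q1 h2 q2.
        (H \<longlongrightarrow> h1) (at_left d) \<and> (Q \<longlongrightarrow> q1) (at_left d) \<and>
        (H \<longlongrightarrow> h2) (at_right d) \<and> (Q \<longlongrightarrow> q2) (at_right d) \<and>
        rankine_hugoniot F c h1 q1 h2 q2 \<and> lax_condition F c h1 q1 h2 q2)"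


section \<open>Traveling-wave profiles\<close>

definition one_sided_state ::
    "(real \<Rightarrow> real) \<Rightarrow> (real \<Rightarrow> real) \<Rightarrow> real \<Rightarrow> real \<Rightarrow> real \<Rightarrow> bool" where
  "one_sided_state H Q z h q \<longleftrightarrow>
     (H \<longlongrightarrow> h) (at_left z) \<and> (Q \<longlongrightarrow> q) (at_left z) \<or>
     (H \<longlongrightarrow> h) (at_right z) \<and> (Q \<longlongrightarrow> q) (at_right z)"

text \<open>
  Positivity of the height is also required of the one-sided limits at a discontinuity, since the
  jump conditions involve division by these.
\<close>

definition traveling_wave_profile ::
    "real \<Rightarrow> real \<Rightarrow> real \<Rightarrow> real \<Rightarrow> (real \<Rightarrow> real) \<Rightarrow> (real \<Rightarrow> real) \<Rightarrow> bool" where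
  "traveling_wave_profile F HL HR c H Q \<longleftrightarrow>
     (\<forall>z. 0 < H z \<and> 0 \<le> Q z) \<and>
     (\<forall>z h q. one_sided_state H Q z h q \<longrightarrow> 0 < h) \<and>
     piecewise_smooth H \<and> piecewise_smooth Q \<and>
     weak_solution F (\<lambda>t x. H (x - c * t)) (\<lambda>t x. Q (x - c * t)) \<and>
     (\<forall>d. \<not> (isCont H d \<and> isCont Q d) \<longrightarrow> lax_shock_at F c H Q d) \<and>
     (H \<longlongrightarrow> HL) at_bot \<and> (Q \<longlongrightarrow> HL powr (3/2)) at_bot \<and>
     (H \<longlongrightarrow> HR) at_top \<and> (Q \<longlongrightarrow> HR powr (3/2)) at_top"

text \<open>
  At a point of continuity the one-sided state is the value of the profile, so the first conjunct
  covers the whole profile.  The irrelevant value assigned at a jump is not tested.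
\<close>

definition noncharacteristic ::
    "real \<Rightarrow> real \<Rightarrow> real \<Rightarrow> real \<Rightarrow> (real \<Rightarrow> real) \<Rightarrow> (real \<Rightarrow> real) \<Rightarrow> bool" where
  "noncharacteristic F HL HR c H Q \<longleftrightarrow>
     (\<forall>z h q. one_sided_state H Q z h q \<longrightarrow> h / F\<^sup>2 - (c - q / h)\<^sup>2 \<noteq> 0) \<and>
     HL / F\<^sup>2 - (c - HL powr (3/2) / HL)\<^sup>2 \<noteq> 0 \<and>
     HR / F\<^sup>2 - (c - HR powr (3/2) / HR)\<^sup>2 \<noteq> 0"

definition nc_profile ::
    "real \<Rightarrow> real \<Rightarrow> real \<Rightarrow> real \<Rightarrow> (real \<Rightarrow> real) \<Rightarrow> (real \<Rightarrow> real) \<Rightarrow> bool" where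
  "nc_profile F HL HR c H Q \<longleftrightarrow>
     traveling_wave_profile F HL HR c H Q \<and> noncharacteristic F HL HR c H Q"


section \<open>The distinguished heights\<close>

text \<open>The constant value of \<open>c H - Q\<close> on a profile connecting \<open>HL\<close> to \<open>HR\<close>.\<close>

definition q0 :: "real \<Rightarrow> real \<Rightarrow> real" where
  "q0 HL HR = HL * HR / (sqrt HL + sqrt HR)"

definition Hs :: "real \<Rightarrow> real \<Rightarrow> real \<Rightarrow> real" where
  "Hs F HL HR = (q0 HL HR * F) powr (2/3)"

definition Hstar :: "real \<Rightarrow> real \<Rightarrow> real \<Rightarrow> real" where
  "Hstar F HL HR = sqrt (2 * Hs F HL HR ^ 3 / HR + HR\<^sup>2 / 4) - HR / 2"


section \<open>The kinds of profiles\<close>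

text \<open>
  Increasing and decreasing are meant strictly on smooth portions.  Discontinuities are placed at
  \<open>0\<close>, and conditions on the overall shape of \<open>H\<close> ignore the irrelevant value at the jump.  The
  limits of \<open>H\<close> at infinity are part of \<^const>\<open>nc_profile\<close>.
\<close>

definition increasing_smooth_profile where
  "increasing_smooth_profile F HL HR c H Q \<longleftrightarrow>
     nc_profile F HL HR c H Q \<and> smooth_on UNIV H \<and> smooth_on UNIV Q \<and> strict_mono H"

definition decreasing_smooth_profile where
  "decreasing_smooth_profile F HL HR c H Q \<longleftrightarrow>
     nc_profile F HL HR c H Q \<and> smooth_on UNIV H \<and> smooth_on UNIV Q \<and> strict_antimono_on UNIV H"

definition nonmonotone_discontinuous_profile where
  "nonmonotone_discontinuous_profile F HL HR c H Q \<longleftrightarrow>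
     nc_profile F HL HR c H Q \<and>
     smooth_on {..<0} H \<and> smooth_on {..<0} Q \<and>
     strict_mono_on {..<0} H \<and> (H \<longlongrightarrow> Hstar F HL HR) (at_left 0) \<and>
     lax_shock_at F c H Q 0 \<and>
     (\<forall>z>0. H z = HR) \<and>
     \<not> mono_on (- {0}) H \<and> \<not> antimono_on (- {0}) H"

definition riemann_profile where
  "riemann_profile F HL HR c H Q \<longleftrightarrow>
     nc_profile F HL HR c H Q \<and>
     (\<forall>z<0. H z = HL) \<and> lax_shock_at F c H Q 0 \<and> (\<forall>z>0. H z = HR)"

definition decreasing_discontinuous_profile where
  "decreasing_discontinuous_profile F HL HR c H Q \<longleftrightarrow>
     nc_profile F HL HR c H Q \<and>
     smooth_on {..<0} H \<and> smooth_on {..<0} Q \<and>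
     strict_antimono_on {..<0} H \<and> (H \<longlongrightarrow> Hstar F HL HR) (at_left 0) \<and>
     lax_shock_at F c H Q 0 \<and>
     (\<forall>z>0. H z = HR) \<and>
     antimono_on (- {0}) H"

text \<open>Membership in a kind up to translation of the profile.\<close>

definition up_to_translation ::
    "((real \<Rightarrow> real) \<Rightarrow> (real \<Rightarrow> real) \<Rightarrow> bool) \<Rightarrow> (real \<Rightarrow> real) \<Rightarrow> (real \<Rightarrow> real) \<Rightarrow> bool" where
  "up_to_translation K H Q \<longleftrightarrow> (\<exists>a. K (\<lambda>z. H (z + a)) (\<lambda>z. Q (z + a)))"

end

theory Submission
  imports Defs "HOL-Computational_Algebra.Polynomial"
begin

text \<open>
  The mass equation says that \<open>c H - Q\<close> is constant along a profile, and the two equilibrium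
  endstates determine both the speed \<open>c\<close> and this constant \<open>q\<close>.  Substituting \<open>Q = c H - q\<close>, the
  momentum equation becomes one autonomous scalar equation away from the jumps,
  \<open>H' = F\<^sup>2 (H - HL) (H - HR) (H - H0) / (H\<^sup>3 - Hs\<^sup>3)\<close>.  The third equilibrium \<open>H0\<close> has negative
  flow, so the requirement \<open>Q \<ge> 0\<close> confines \<open>H\<close> to \<open>H > H0\<close>, where only the equilibria \<open>HL\<close> and \<open>HR\<close>
  remain.  The sonic height \<open>Hs\<close> is where the profile is characteristic; a noncharacteristic profile
  therefore stays on one side of \<open>Hs\<close> between two consecutive jumps
  (\<open>profile_piecewise_orbit\<close>, \<open>orbit_facts\<close>).

  The Lax condition makes every jump go from above \<open>Hs\<close> down to below \<open>Hs\<close>.  A second jump would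
  have to start above \<open>Hs\<close> again, so there is at most one (\<open>at_most_one_jump\<close>).

  Without a jump, \<open>H\<close> is an orbit joining \<open>HL\<close> to \<open>HR\<close>; by uniqueness for the scalar equation it
  stays strictly between them, so the sign of \<open>H'\<close> is governed by the side of \<open>Hs\<close>, and an orbit that
  increases lies below \<open>Hs\<close> while one that decreases lies above (\<open>smooth_orbit\<close>).

  With a jump, \<open>HR < Hs < HL\<close>.  To its right \<open>HR\<close> is a repelling equilibrium, so converging to
  it is possible only by being equal to it; the Rankine-Hugoniot condition then forces the left
  state of the jump to be \<open>H*\<close>.  To the left of the jump \<open>H\<close> leaves the equilibrium \<open>HL\<close> and arrives at
  \<open>H*\<close>, staying above \<open>Hs\<close>, so it increases, is constant or decreases according to whether \<open>H*\<close> is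
  above, equal to or below \<open>HL\<close> (\<open>jump_orbit\<close>).

  Conversely, the time that an orbit takes to reach a height is an explicit antiderivative of the
  reciprocal of the right-hand side.  It diverges logarithmically at the endstates, and inverting
  it gives the required orbits (\<open>travel_time\<close>, \<open>increasing_orbit\<close>).  Gluing them to constants
  produces weak solutions because the momentum flux in the moving frame is continuous across the
  jump (\<open>weak_solution_of_orbit\<close>).  The conditions in terms of \<open>\<nu>\<close> follow on comparing the cubes of
  the heights with \<open>Hs\<^sup>3 = (q F)\<^sup>2\<close> (\<open>thresholds\<close>).
\<close>

section \<open>From the weak formulation to differential equations\<close>

text \<open>
  The square makes the truncated parabola continuously differentiable at \<open>1\<close> and \<open>-1\<close>.
\<close>

definition bump :: "real \<Rightarrow> real" where
  "bump x = (max 0 (1 - x\<^sup>2))\<^sup>2"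

definition bump_deriv :: "real \<Rightarrow> real" where
  "bump_deriv x = - 4 * x * max 0 (1 - x\<^sup>2)"

lemma DERIV_square_pos_part:
  fixes y :: real
  shows "((\<lambda>y. (max 0 y)\<^sup>2) has_real_derivative 2 * max 0 y) (at y)"
proof (cases y "0 :: real" rule: linorder_cases)
  case less
  have "((\<lambda>y. 0) has_real_derivative 2 * max 0 y) (at y)"
    using less by simp
  then show ?thesis
    by (rule has_field_derivative_transform_within_open[where S = "{..<0}"]) (use less in auto)
next
  case greater
  have "((\<lambda>y. y\<^sup>2) has_real_derivative 2 * max 0 y) (at y)"
    using greater by (auto intro!: derivative_eq_intros)
  then show ?thesis
    by (rule has_field_derivative_transform_within_open[where S = "{0<..}"]) (use greater in auto)
next
  case equal
  have "((\<lambda>h. max 0 h) \<longlongrightarrow> (0::real)) (at 0)"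
    by (auto intro!: tendsto_eq_intros)
  then have "((\<lambda>h. (max 0 h)\<^sup>2 / h) \<longlongrightarrow> (0::real)) (at 0)"
    by (rule Lim_transform_eventually) (auto simp: max_def power2_eq_square)
  then show ?thesis
    unfolding equal by (simp add: DERIV_def)
qed

lemma DERIV_bump: "(bump has_real_derivative bump_deriv x) (at x)"
proof -
  have "((\<lambda>x. (max 0 (1 - x\<^sup>2))\<^sup>2) has_real_derivative 2 * max 0 (1 - x\<^sup>2) * (- 2 * x)) (at x)"
    by (rule DERIV_chain2[OF DERIV_square_pos_part]) (auto intro!: derivative_eq_intros)
  then show ?thesis
    by (simp add: bump_def[abs_def] bump_deriv_def mult_ac)
qed

lemmas DERIV_bump_chain [derivative_intros] = DERIV_bump[THEN DERIV_chain2]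

lemma continuous_on_bump [continuous_intros]:
  "continuous_on S f \<Longrightarrow> continuous_on S (\<lambda>x. bump (f x))"
  unfolding bump_def by (intro continuous_intros)

lemma continuous_on_bump_deriv [continuous_intros]:
  "continuous_on S f \<Longrightarrow> continuous_on S (\<lambda>x. bump_deriv (f x))"
  unfolding bump_deriv_def by (intro continuous_intros)

lemma bump_nonneg: "0 \<le> bump x"
  by (simp add: bump_def)

lemma bump_pos: "\<bar>x\<bar> < 1 \<Longrightarrow> 0 < bump x"
  using abs_square_less_1[of x] by (simp add: bump_def max_def)

lemma bump_eq_0: "1 \<le> \<bar>x\<bar> \<Longrightarrow> bump x = 0" "1 \<le> \<bar>x\<bar> \<Longrightarrow> bump_deriv x = 0"
  using abs_le_square_iff[of 1 x] by (auto simp: bump_def bump_deriv_def max_def)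

text \<open>
  Multiplying a bump in time by a bump that travels with the wave gives test functions that separate
  variables in the moving frame.
\<close>

lemma test_function_travelling_bump:
  fixes c x0 r :: real
  assumes r: "r > 0"
  shows "test_function
           (\<lambda>(t, x). bump t * bump ((x - c * t - x0) / r))
           (\<lambda>(t, x). bump_deriv t * bump ((x - c * t - x0) / r)
                      - c * (bump t * (bump_deriv ((x - c * t - x0) / r) / r)))
           (\<lambda>(t, x). bump t * (bump_deriv ((x - c * t - x0) / r) / r))"
    (is "test_function ?\<phi> ?\<phi>t ?\<phi>x")
proof -
  have D: "(?\<phi> has_derivative (\<lambda>(s, y). ?\<phi>t p * s + ?\<phi>x p * y)) (at p)" for p
  proof -
    obtain t x where p: "p = (t, x)" by force
    have 1: "((\<lambda>p. bump (fst p)) has_derivative (\<lambda>h. bump_deriv (fst p) * fst h)) (at p)"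
      by (rule DERIV_bump[THEN DERIV_compose_FDERIV, THEN has_derivative_eq_rhs])
        (auto intro!: derivative_eq_intros)
    have 2: "((\<lambda>p. bump ((snd p - c * fst p - x0) / r)) has_derivative
        (\<lambda>h. bump_deriv ((snd p - c * fst p - x0) / r) * ((snd h - c * fst h) / r))) (at p)"
      by (rule DERIV_bump[THEN DERIV_compose_FDERIV, THEN has_derivative_eq_rhs])
        (use r in \<open>auto intro!: derivative_eq_intros simp: fun_eq_iff\<close>)
    show ?thesis
      using has_derivative_mult[OF 1 2] unfolding case_prod_beta
      by (rule has_derivative_eq_rhs)
        (use r in \<open>simp add: fun_eq_iff field_simps\<close>)
  qed
  have "{p. ?\<phi> p \<noteq> 0} \<subseteq> {- 1..1} \<times> {x0 - \<bar>c\<bar> - r..x0 + \<bar>c\<bar> + r}"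
  proof safe
    fix t x assume nz: "bump t * bump ((x - c * t - x0) / r) \<noteq> 0"
    then have t: "\<bar>t\<bar> < 1" and x: "\<bar>(x - c * t - x0) / r\<bar> < 1"
      using bump_eq_0(1) by (force simp: not_le[symmetric])+
    from x have "\<bar>x - c * t - x0\<bar> < r"
      using r by (simp add: abs_divide)
    moreover have "\<bar>c * t\<bar> \<le> \<bar>c\<bar>"
      using t by (simp add: abs_mult mult_left_le)
    ultimately show "x \<in> {x0 - \<bar>c\<bar> - r..x0 + \<bar>c\<bar> + r}" by auto
    show "t \<in> {-1..1}" using t by auto
  qed
  then have "bounded {p. ?\<phi> p \<noteq> 0}"
    by (rule bounded_subset[rotated]) (intro bounded_Times bounded_closed_interval)
  then have "compact (closure {p. ?\<phi> p \<noteq> 0})"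
    by (simp add: compact_closure)
  moreover have "continuous_on UNIV ?\<phi>t" "continuous_on UNIV ?\<phi>x"
    unfolding case_prod_beta using r by (auto intro!: continuous_intros)
  ultimately show ?thesis
    using D unfolding test_function_def by blast
qed

text \<open>
  By Fubini and the substitution \<open>z = x - c t\<close>, testing with a product \<open>a(t) b(x - c t)\<close> gives
  \<open>(\<integral>a') (\<integral>u b) + (\<integral>a) (\<integral>((v - c u) b' + w b)) = 0\<close>.  Here \<open>\<integral>a' = 0\<close> and \<open>\<integral>a > 0\<close>, which leaves a weak
  formulation in the single variable \<open>z\<close>.  Continuity is asked for only on the support of \<open>b\<close>.
\<close>

lemma weak_travelling_tested:
  fixes u v w :: "real \<Rightarrow> real"
  assumes r: "r > 0"
    and cont: "continuous_on {x0 - r..x0 + r} u" "continuous_on {x0 - r..x0 + r} v"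
      "continuous_on {x0 - r..x0 + r} w"
    and weak: "\<And>\<phi> \<phi>t \<phi>x. test_function \<phi> \<phi>t \<phi>x \<Longrightarrow>
        has_bochner_integral lborel
          (\<lambda>(t, x). u (x - c * t) * \<phi>t (t, x) + v (x - c * t) * \<phi>x (t, x)
                   + w (x - c * t) * \<phi> (t, x)) 0"
  shows "((\<lambda>z. (v z - c * u z) * (bump_deriv ((z - x0) / r) / r) + w z * bump ((z - x0) / r))
            has_integral 0) {x0 - r..x0 + r}"
proof -
  let ?b = "\<lambda>z. bump ((z - x0) / r)" and ?b' = "\<lambda>z. bump_deriv ((z - x0) / r) / r"
  let ?I = "{x0 - r..x0 + r}"
  define A where "A = (\<lambda>z. u z * ?b z)"
  define B where "B = (\<lambda>z. (v z - c * u z) * ?b' z + w z * ?b z)"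
  have b0: "?b z = 0 \<and> ?b' z = 0" if "z \<notin> ?I" for z
  proof -
    have "1 \<le> \<bar>(z - x0) / r\<bar>"
      using that r by (auto simp: abs_divide)
    then show ?thesis by (simp add: bump_eq_0)
  qed
  have A: "A = (\<lambda>z. indicator ?I z *\<^sub>R A z)" and B: "B = (\<lambda>z. indicator ?I z *\<^sub>R B z)"
    using b0 by (fastforce simp: A_def B_def fun_eq_iff indicator_def)+
  have contAB: "continuous_on ?I A" "continuous_on ?I B"
    unfolding A_def B_def using r by (auto intro!: continuous_intros cont)
  have intA: "integrable lborel A" and intB: "integrable lborel B"
    using borel_integrable_compact[OF _ contAB(1)] borel_integrable_compact[OF _ contAB(2)] A B by auto
  have intb: "integrable lborel bump" "integrable lborel bump_deriv"
  proof -
    have 1: "bump = (\<lambda>z. indicator {-1..1} z *\<^sub>R bump z)"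
            "bump_deriv = (\<lambda>z. indicator {-1..1} z *\<^sub>R bump_deriv z)"
      using bump_eq_0 by (force simp: fun_eq_iff indicator_def)+
    show "integrable lborel bump" "integrable lborel bump_deriv"
      by (subst 1, rule borel_integrable_compact; auto intro!: continuous_intros)+
  qed
  define \<Psi> where "\<Psi> = (\<lambda>t x. bump_deriv t * A (x - c * t) + bump t * B (x - c * t))"
  have bi: "has_bochner_integral lborel (case_prod \<Psi>) 0"
    using weak[OF test_function_travelling_bump[OF r, of c x0]]
    by (rule has_bochner_integral_cong[THEN iffD1, rotated 3])
      (auto simp: \<Psi>_def A_def B_def algebra_simps diff_divide_distrib add_divide_distrib)
  then have intPsi: "integrable (lborel \<Otimes>\<^sub>M lborel) (case_prod \<Psi>)"
    and zero: "integral\<^sup>L (lborel \<Otimes>\<^sub>M lborel) (case_prod \<Psi>) = 0"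
    by (auto simp: has_bochner_integral_iff lborel_prod)
  have inner: "(\<integral>x. \<Psi> t x \<partial>lborel) = bump_deriv t * integral\<^sup>L lborel A + bump t * integral\<^sup>L lborel B" for t
  proof -
    have shift: "has_bochner_integral lborel (\<lambda>x. f (x - c * t)) (integral\<^sup>L lborel f)"
      if "integrable lborel f" for f :: "real \<Rightarrow> real"
      using lborel_has_bochner_integral_real_affine_iff[of 1 f "integral\<^sup>L lborel f" "- c * t"] that
      by (simp add: has_bochner_integral_iff)
    show ?thesis
      unfolding \<Psi>_def using shift[OF intA] shift[OF intB]
      by (intro has_bochner_integral_integral_eq has_bochner_integral_add has_bochner_integral_mult_right) auto
  qed
  have "0 = (\<integral>t. (\<integral>x. \<Psi> t x \<partial>lborel) \<partial>lborel)"
    using lborel_pair.integral_fst[OF intPsi] zero by simp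
  also have "\<dots> = integral\<^sup>L lborel bump_deriv * integral\<^sup>L lborel A
                   + integral\<^sup>L lborel bump * integral\<^sup>L lborel B"
    unfolding inner using intb by simp
  also have "integral\<^sup>L lborel bump_deriv = 0"
  proof -
    have "(bump_deriv has_integral (bump 1 - bump (-1))) {-1..1}"
      by (rule fundamental_theorem_of_calculus)
        (auto simp: has_real_derivative_iff_has_vector_derivative[symmetric]
              intro!: has_field_derivative_at_within DERIV_bump)
    then have "(bump_deriv has_integral 0) {-1..1}" by (simp add: bump_eq_0)
    then have "(bump_deriv has_integral 0) UNIV"
      by (rule has_integral_on_superset) (auto intro!: bump_eq_0)
    with has_integral_integral_lborel[OF intb(2)] show ?thesis
      by (rule has_integral_unique)
  qed
  finally have prod0: "integral\<^sup>L lborel bump * integral\<^sup>L lborel B = 0" by simp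
  moreover have "integral\<^sup>L lborel bump \<noteq> 0"
  proof
    assume "integral\<^sup>L lborel bump = 0"
    then have "(bump has_integral 0) UNIV"
      using has_integral_integral_lborel[OF intb(1)] by simp
    then have "((\<lambda>x. if x \<in> cbox (-1) 1 then bump x else 0) has_integral 0) UNIV"
      by (rule has_integral_eq[rotated]) (auto intro!: bump_eq_0(1)[symmetric] bump_eq_0(1))
    then have "(bump has_integral 0) (cbox (-1) 1)"
      by (subst (asm) has_integral_restrict_UNIV)
    from has_integral_0_cbox_imp_0[OF _ _ this, of 0] have "bump 0 = 0"
      using continuous_on_bump[OF continuous_on_id, of "{-1..1}"] bump_nonneg by simp
    then show False
      using bump_pos[of 0] by simp
  qed
  ultimately have "integral\<^sup>L lborel B = 0" by simp
  then have "(B has_integral 0) UNIV"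
    using has_integral_integral_lborel[OF intB] by simp
  then have "((\<lambda>x. if x \<in> ?I then B x else 0) has_integral 0) UNIV"
    by (rule has_integral_eq[rotated]) (use b0 in \<open>auto simp: B_def\<close>)
  then show ?thesis
    by (subst (asm) has_integral_restrict_UNIV) (simp add: B_def)
qed

text \<open>
  The fundamental lemma of the calculus of variations: if \<open>p' - w\<close> were nonzero at \<open>x0\<close>, it would
  have constant sign on a small interval, contradicting \<open>\<integral>(p' - w) b = 0\<close> for a bump \<open>b\<close> supported
  there.
\<close>

lemma weak_travelling_imp_ode:
  fixes u v w p' :: "real \<Rightarrow> real"
  assumes R: "R > 0"
    and cont: "continuous_on {x0 - R<..<x0 + R} u" "continuous_on {x0 - R<..<x0 + R} v"
      "continuous_on {x0 - R<..<x0 + R} w" "continuous_on {x0 - R<..<x0 + R} p'"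
    and deriv: "\<And>z. z \<in> {x0 - R<..<x0 + R} \<Longrightarrow>
                  ((\<lambda>z. v z - c * u z) has_real_derivative p' z) (at z)"
    and weak: "\<And>\<phi> \<phi>t \<phi>x. test_function \<phi> \<phi>t \<phi>x \<Longrightarrow>
        has_bochner_integral lborel
          (\<lambda>(t, x). u (x - c * t) * \<phi>t (t, x) + v (x - c * t) * \<phi>x (t, x)
                   + w (x - c * t) * \<phi> (t, x)) 0"
  shows "p' x0 = w x0"
proof (rule ccontr)
  assume ne: "p' x0 \<noteq> w x0"
  \<comment> \<open>The sign reduces both cases to a function that is positive at the point.\<close>
  define \<sigma> where "\<sigma> = sgn (w x0 - p' x0)"
  define D where "D = (\<lambda>z. \<sigma> * (w z - p' z))"
  have D0: "D x0 > 0"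
    using ne by (simp add: D_def \<sigma>_def sgn_if)
  have "isCont D x0"
    unfolding D_def using R cont
    by (auto intro!: continuous_intros simp: continuous_on_eq_continuous_at)
  then have "\<forall>\<^sub>F z in at x0. 0 < D z"
    unfolding isCont_def by (rule order_tendstoD) (rule D0)
  then obtain d where d: "d > 0" "\<And>z. z \<noteq> x0 \<Longrightarrow> dist z x0 < d \<Longrightarrow> 0 < D z"
    unfolding eventually_at by auto
  define r where "r = min d R / 2"
  have r: "r > 0" "r < d" "r < R" using d R by (auto simp: r_def)
  have Dpos: "0 < D z" if "z \<in> {x0 - r..x0 + r}" for z
    using d(2)[of z] D0 that r by (cases "z = x0") (auto simp: dist_real_def)
  have sub: "{x0 - r..x0 + r} \<subseteq> {x0 - R<..<x0 + R}" using r by auto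
  let ?b = "\<lambda>z. bump ((z - x0) / r)" and ?b' = "\<lambda>z. bump_deriv ((z - x0) / r) / r"
  let ?I = "{x0 - r..x0 + r}"
  have 1: "((\<lambda>z. (v z - c * u z) * ?b' z + w z * ?b z) has_integral 0) ?I"
    by (rule weak_travelling_tested[OF r(1) _ _ _ weak])
      (auto intro: continuous_on_subset[OF _ sub] cont)
  have "((\<lambda>z. (v z - c * u z) * ?b' z + p' z * ?b z) has_integral
          ((v (x0 + r) - c * u (x0 + r)) * ?b (x0 + r) - (v (x0 - r) - c * u (x0 - r)) * ?b (x0 - r))) ?I"
  proof (rule fundamental_theorem_of_calculus)
    fix z assume "z \<in> ?I"
    then have z: "z \<in> {x0 - R<..<x0 + R}" using sub by auto
    have "((\<lambda>z. (v z - c * u z) * ?b z) has_real_derivative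
            (v z - c * u z) * ?b' z + p' z * ?b z) (at z)"
      by (rule derivative_eq_intros deriv[OF z] refl | use r in simp)+
    then show "((\<lambda>z. (v z - c * u z) * ?b z) has_vector_derivative
            (v z - c * u z) * ?b' z + p' z * ?b z) (at z within ?I)"
      by (simp add: has_real_derivative_iff_has_vector_derivative has_vector_derivative_at_within)
  qed (use r in auto)
  then have 2: "((\<lambda>z. (v z - c * u z) * ?b' z + p' z * ?b z) has_integral 0) ?I"
    using r by (simp add: bump_eq_0)
  have "((\<lambda>z. D z * ?b z) has_integral 0) (cbox (x0 - r) (x0 + r))"
    using has_integral_mult_right[OF has_integral_diff[OF 1 2], of \<sigma>]
    by (simp add: D_def algebra_simps)
  from has_integral_0_cbox_imp_0[OF _ _ this, of x0]
  have "D x0 * ?b x0 = 0"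
  proof -
    have "continuous_on ?I (\<lambda>z. D z * ?b z)"
      unfolding D_def using r
      by (auto intro!: continuous_intros intro: continuous_on_subset[OF _ sub] cont)
    moreover have "0 \<le> D z * ?b z" if "z \<in> {x0 - r<..<x0 + r}" for z
      using Dpos[of z] that bump_nonneg by (auto intro!: mult_nonneg_nonneg simp: less_imp_le)
    ultimately show ?thesis
      using has_integral_0_cbox_imp_0[of "x0 - r" "x0 + r" "\<lambda>z. D z * ?b z" x0]
        \<open>((\<lambda>z. D z * ?b z) has_integral 0) (cbox (x0 - r) (x0 + r))\<close> r(1)
      by (auto simp: box_real)
  qed
  then show False
    using D0 bump_pos[of 0] by simp
qed

section \<open>From differential equations to the weak formulation\<close>

text \<open>
  On the open complement of the support the function is locally constant, so its partial derivatives
  vanish there as well.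
\<close>

lemma test_function_zero_outside_box:
  assumes "test_function \<phi> \<phi>t \<phi>x"
  obtains M where "M > 0"
    and "\<And>t x. \<not> (\<bar>t\<bar> < M \<and> \<bar>x\<bar> < M) \<Longrightarrow> \<phi> (t, x) = 0 \<and> \<phi>t (t, x) = 0 \<and> \<phi>x (t, x) = 0"
proof -
  let ?K = "closure {p. \<phi> p \<noteq> 0}"
  have D: "\<And>p. (\<phi> has_derivative (\<lambda>(s, y). \<phi>t p * s + \<phi>x p * y)) (at p)"
    and "compact ?K"
    using assms by (auto simp: test_function_def)
  then have "bounded ?K" by (simp add: compact_imp_bounded)
  then obtain M where M: "M > 0" "\<And>p. p \<in> ?K \<Longrightarrow> norm p < M"
    unfolding bounded_pos_less by blast
  have zero: "\<phi> p = 0 \<and> \<phi>t p = 0 \<and> \<phi>x p = 0" if p: "p \<notin> ?K" for p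
  proof -
    have "((\<lambda>_. 0) has_derivative (\<lambda>(s, y). \<phi>t p * s + \<phi>x p * y)) (at p)"
      by (rule has_derivative_transform_within_open[OF D[of p], of "- ?K"])
        (use p closure_subset[of "{p. \<phi> p \<noteq> 0}"] in auto)
    then have "(\<lambda>(s, y). \<phi>t p * s + \<phi>x p * y) = (\<lambda>_. 0)"
      by (rule has_derivative_unique) simp
    from fun_cong[OF this, of "(1, 0)"] fun_cong[OF this, of "(0, 1)"]
    have "\<phi>t p = 0" "\<phi>x p = 0" by auto
    moreover have "\<phi> p = 0"
      using p closure_subset[of "{p. \<phi> p \<noteq> 0}"] by auto
    ultimately show ?thesis by simp
  qed
  show thesis
  proof (rule that[OF M(1)])
    fix t x :: real
    assume out: "\<not> (\<bar>t\<bar> < M \<and> \<bar>x\<bar> < M)"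
    have "\<bar>t\<bar> \<le> norm (t, x)" "\<bar>x\<bar> \<le> norm (t, x)"
      using norm_fst_le[of "(t, x)"] norm_snd_le[of "(t, x)"] by (auto simp: norm_Pair)
    then have "(t, x) \<notin> ?K" using M(2)[of "(t, x)"] out by force
    then show "\<phi> (t, x) = 0 \<and> \<phi>t (t, x) = 0 \<and> \<phi>x (t, x) = 0" by (rule zero)
  qed
qed

lemma test_function_partial_derivatives:
  assumes "test_function \<phi> \<phi>t \<phi>x"
  shows "((\<lambda>x. \<phi> (t, x)) has_real_derivative \<phi>x (t, x)) (at x)"
    and "((\<lambda>t. \<phi> (t, z + c * t)) has_real_derivative
            \<phi>t (t, z + c * t) + c * \<phi>x (t, z + c * t)) (at t)"
proof -
  have D: "\<And>p. (\<phi> has_derivative (\<lambda>(s, y). \<phi>t p * s + \<phi>x p * y)) (at p)"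
    using assms by (auto simp: test_function_def)
  have "((\<lambda>x. (t, x)) has_derivative (\<lambda>h. (0, h))) (at x)"
    by (auto intro!: derivative_eq_intros)
  from has_derivative_compose[OF this D]
  show "((\<lambda>x. \<phi> (t, x)) has_real_derivative \<phi>x (t, x)) (at x)"
    by (simp add: has_field_derivative_def)
  have "((\<lambda>t. (t, z + c * t)) has_derivative (\<lambda>h. (h, c * h))) (at t)"
    by (auto intro!: derivative_eq_intros)
  from has_derivative_compose[OF this D]
  show "((\<lambda>t. \<phi> (t, z + c * t)) has_real_derivative
            \<phi>t (t, z + c * t) + c * \<phi>x (t, z + c * t)) (at t)"
    unfolding has_field_derivative_def
    by (rule has_derivative_eq_rhs) (simp add: fun_eq_iff algebra_simps)
qed

lemma test_function_continuous:
  assumes "test_function \<phi> \<phi>t \<phi>x"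
  shows "continuous_on UNIV \<phi>" "continuous_on UNIV \<phi>t" "continuous_on UNIV \<phi>x"
proof -
  show "continuous_on UNIV \<phi>"
    by (rule has_derivative_continuous_on[where f' = "\<lambda>p (s, y). \<phi>t p * s + \<phi>x p * y"])
      (use assms in \<open>auto simp: test_function_def\<close>)
qed (use assms in \<open>auto simp: test_function_def\<close>)

lemma integrable_bounded_times_compactly_supported:
  fixes g k :: "real \<times> real \<Rightarrow> real"
  assumes g: "g \<in> borel_measurable borel" "\<And>p. \<bar>g p\<bar> \<le> B"
    and k: "continuous_on UNIV k"
    and supp: "\<And>t x. \<not> (\<bar>t\<bar> < M \<and> \<bar>x\<bar> < M) \<Longrightarrow> k (t, x) = 0"
  shows "integrable lborel (\<lambda>p. g p * k p)"
proof -
  let ?K = "{-M..M} \<times> {-M..M}"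
  have "integrable lborel (\<lambda>p. indicator ?K p *\<^sub>R k p)"
    by (rule borel_integrable_compact)
      (auto intro!: compact_Times continuous_on_subset[OF k])
  also have "(\<lambda>p. indicator ?K p *\<^sub>R k p) = k"
  proof
    fix p
    show "indicator ?K p *\<^sub>R k p = k p"
    proof (cases "p \<in> ?K")
      case False
      then have "\<not> (\<bar>fst p\<bar> < M \<and> \<bar>snd p\<bar> < M)" by (cases p) auto
      then show ?thesis using supp[of "fst p" "snd p"] False by simp
    qed simp
  qed
  finally have "integrable lborel k" .
  then have "integrable lborel (\<lambda>p. B * k p)" by simp
  then show ?thesis
  proof (rule Bochner_Integration.integrable_bound)
    show "(\<lambda>p. g p * k p) \<in> borel_measurable lborel"
      using g(1) borel_measurable_continuous_onI[OF k] by simp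
    show "AE p in lborel. norm (g p * k p) \<le> norm (B * k p)"
    proof (intro AE_I2)
      fix p
      have "\<bar>g p\<bar> \<le> \<bar>B\<bar>" using g(2)[of p] by linarith
      then show "norm (g p * k p) \<le> norm (B * k p)"
        by (simp add: abs_mult mult_right_mono)
    qed
  qed
qed

lemma has_integral_0_of_compact_support:
  fixes f f' :: "real \<Rightarrow> real"
  assumes "finite S" and "\<And>x. x \<notin> S \<Longrightarrow> (f has_real_derivative f' x) (at x)"
    and "continuous_on UNIV f"
    and "\<And>x. M \<le> \<bar>x\<bar> \<Longrightarrow> f x = 0 \<and> f' x = 0"
  shows "(f' has_integral 0) UNIV"
proof -
  let ?N = "\<bar>M\<bar>"
  have "(f' has_integral (f ?N - f (- ?N))) {- ?N..?N}"
    by (rule fundamental_theorem_of_calculus_interior_strong[OF assms(1)])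
      (use assms in \<open>auto simp: has_real_derivative_iff_has_vector_derivative[symmetric]
                     intro: continuous_on_subset\<close>)
  then have "(f' has_integral 0) {- ?N..?N}"
    using assms(4)[of ?N] assms(4)[of "- ?N"] by simp
  then show ?thesis
    by (rule has_integral_on_superset) (use assms(4) in auto)
qed

lemma lborel_integral_0I:
  fixes f :: "real \<Rightarrow> real"
  assumes "(f has_integral 0) UNIV"
  shows "integral\<^sup>L lborel f = 0"
proof (cases "integrable lborel f")
  case True
  from has_integral_unique[OF has_integral_integral_lborel[OF True] assms] show ?thesis .
qed (simp add: not_integrable_integral_eq)

lemma measurable_shear:
  fixes u :: "real \<Rightarrow> real"
  assumes "u \<in> borel_measurable borel"
  shows "(\<lambda>p. u (snd p - c * fst p)) \<in> borel_measurable borel"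
proof -
  have "(\<lambda>p::real \<times> real. snd p - c * fst p) \<in> borel_measurable borel"
    by (intro borel_measurable_continuous_onI continuous_intros)
  from measurable_compose[OF this assms] show ?thesis .
qed

text \<open>
  In the moving frame the integrand is \<open>u(z)\<close> times the time derivative of \<open>\<phi>\<close> along the line
  \<open>x = z + c t\<close>, so integrating in time first gives zero for every profile \<open>u\<close>.
\<close>

lemma weak_transport:
  fixes u :: "real \<Rightarrow> real"
  assumes \<phi>: "test_function \<phi> \<phi>t \<phi>x"
    and u: "u \<in> borel_measurable borel" "\<And>z. \<bar>u z\<bar> \<le> B"
  shows "has_bochner_integral lborel
           (\<lambda>(t, x). u (x - c * t) * (\<phi>t (t, x) + c * \<phi>x (t, x))) 0"
proof -
  obtain M where M: "M > 0"
    "\<And>t x. \<not> (\<bar>t\<bar> < M \<and> \<bar>x\<bar> < M) \<Longrightarrow> \<phi> (t, x) = 0 \<and> \<phi>t (t, x) = 0 \<and> \<phi>x (t, x) = 0"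
    using test_function_zero_outside_box[OF \<phi>] by blast
  note cont = test_function_continuous[OF \<phi>]
  define k where "k = (\<lambda>p. \<phi>t p + c * \<phi>x p)"
  have kcont: "continuous_on UNIV k"
    unfolding k_def by (intro continuous_intros cont)
  have k0: "k (t, x) = 0" if "\<not> (\<bar>t\<bar> < M \<and> \<bar>x\<bar> < M)" for t x
    using M(2)[OF that] by (simp add: k_def)
  define f where "f = (\<lambda>t x. u (x - c * t) * k (t, x))"
  have intf: "integrable lborel (case_prod f)"
    using integrable_bounded_times_compactly_supported[of "\<lambda>p. u (snd p - c * fst p)" B k M]
      measurable_shear[OF u(1)] u(2) kcont k0 by (simp add: f_def case_prod_unfold)
  \<comment> \<open>The integrand in the moving frame; the sheared support still lies in a box.\<close>
  define g where "g = (\<lambda>t z. u z * k (t, z + c * t))"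
  have intg: "integrable lborel (case_prod g)"
  proof -
    define M' where "M' = M + \<bar>c\<bar> * M"
    have "k (t, x + c * t) = 0" if "\<not> (\<bar>t\<bar> < M' \<and> \<bar>x\<bar> < M')" for t x
    proof (rule k0, rule notI)
      assume *: "\<bar>t\<bar> < M \<and> \<bar>x + c * t\<bar> < M"
      then have "\<bar>c * t\<bar> \<le> \<bar>c\<bar> * M" by (auto simp: abs_mult intro!: mult_left_mono)
      moreover have "0 \<le> \<bar>c\<bar> * M" using M(1) by simp
      ultimately show False
        using * that M(1) unfolding M'_def by linarith
    qed
    moreover have "continuous_on UNIV (\<lambda>p. k (fst p, snd p + c * fst p))"
      by (intro continuous_on_compose2[OF kcont] continuous_intros) auto
    moreover have "(\<lambda>p::real \<times> real. u (snd p)) \<in> borel_measurable borel"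
      using measurable_shear[OF u(1), of 0] by simp
    ultimately show ?thesis
      using integrable_bounded_times_compactly_supported[of "\<lambda>p. u (snd p)" B
          "\<lambda>p. k (fst p, snd p + c * fst p)" M'] u(2)
      by (simp add: g_def case_prod_unfold)
  qed
  have "integral\<^sup>L lborel (case_prod f) = (\<integral>t. (\<integral>x. f t x \<partial>lborel) \<partial>lborel)"
    using lborel_pair.integral_fst[of f] intf by (simp add: lborel_prod)
  also have "\<dots> = (\<integral>t. (\<integral>z. g t z \<partial>lborel) \<partial>lborel)"
  proof (rule Bochner_Integration.integral_cong[OF refl])
    fix t
    show "(\<integral>x. f t x \<partial>lborel) = (\<integral>z. g t z \<partial>lborel)"
      using lborel_integral_real_affine[of 1 "f t" "c * t"]
      by (simp add: f_def g_def add.commute)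
  qed
  also have "\<dots> = (\<integral>z. (\<integral>t. g t z \<partial>lborel) \<partial>lborel)"
    using lborel_pair.Fubini_integral[of g] intg by (simp add: lborel_prod)
  also have "\<dots> = 0"
  proof -
    have "((\<lambda>t. k (t, z + c * t)) has_integral 0) UNIV" for z
    proof (rule has_integral_0_of_compact_support[of "{}" "\<lambda>t. \<phi> (t, z + c * t)" _ M])
      show "continuous_on UNIV (\<lambda>t. \<phi> (t, z + c * t))"
        by (intro continuous_on_compose2[OF cont(1)] continuous_intros) auto
    qed (use M(2) k0 test_function_partial_derivatives(2)[OF \<phi>] in \<open>auto simp: k_def\<close>)
    then show ?thesis
      by (simp add: g_def lborel_integral_0I)
  qed
  finally show ?thesis
    using intf by (simp add: has_bochner_integral_iff f_def k_def)
qed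

text \<open>
  For each fixed time the integrand is the space derivative of \<open>G \<phi>\<close>.  Continuity of \<open>G\<close> is what
  excludes contributions from the points of \<open>S\<close>.
\<close>

lemma weak_balance:
  fixes G g :: "real \<Rightarrow> real"
  assumes \<phi>: "test_function \<phi> \<phi>t \<phi>x"
    and G: "continuous_on UNIV G" "\<And>z. \<bar>G z\<bar> \<le> B"
    and g: "g \<in> borel_measurable borel" "\<And>z. \<bar>g z\<bar> \<le> B"
    and S: "finite S" and deriv: "\<And>z. z \<notin> S \<Longrightarrow> (G has_real_derivative g z) (at z)"
  shows "has_bochner_integral lborel
           (\<lambda>(t, x). G (x - c * t) * \<phi>x (t, x) + g (x - c * t) * \<phi> (t, x)) 0"
proof -
  obtain M where M: "M > 0"
    "\<And>t x. \<not> (\<bar>t\<bar> < M \<and> \<bar>x\<bar> < M) \<Longrightarrow> \<phi> (t, x) = 0 \<and> \<phi>t (t, x) = 0 \<and> \<phi>x (t, x) = 0"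
    using test_function_zero_outside_box[OF \<phi>] by blast
  note cont = test_function_continuous[OF \<phi>]
  define f where "f = (\<lambda>t x. G (x - c * t) * \<phi>x (t, x) + g (x - c * t) * \<phi> (t, x))"
  have Gm: "G \<in> borel_measurable borel"
    using G(1) by (rule borel_measurable_continuous_onI)
  have intf: "integrable lborel (case_prod f)"
    using integrable_bounded_times_compactly_supported[of "\<lambda>p. G (snd p - c * fst p)" B \<phi>x M]
      integrable_bounded_times_compactly_supported[of "\<lambda>p. g (snd p - c * fst p)" B \<phi> M]
      measurable_shear[OF Gm] measurable_shear[OF g(1)] G(2) g(2) cont M(2)
    by (simp add: f_def case_prod_unfold)
  have inner: "(\<integral>x. f t x \<partial>lborel) = 0" for t
  proof -
    have "(f t has_integral 0) UNIV"
    proof (rule has_integral_0_of_compact_support[of "(\<lambda>s. s + c * t) ` S"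
          "\<lambda>x. G (x - c * t) * \<phi> (t, x)" _ M])
      show "finite ((\<lambda>s. s + c * t) ` S)" using S by simp
      show "continuous_on UNIV (\<lambda>x. G (x - c * t) * \<phi> (t, x))"
        by (intro continuous_intros continuous_on_compose2[OF cont(1)] continuous_on_compose2[OF G(1)])
          auto
      show "G (x - c * t) * \<phi> (t, x) = 0 \<and> f t x = 0" if "M \<le> \<bar>x\<bar>" for x
        using M(2)[of t x] that by (simp add: f_def)
      fix x assume "x \<notin> (\<lambda>s. s + c * t) ` S"
      then have "x - c * t \<notin> S" by force
      moreover have "((\<lambda>x. x - c * t) has_real_derivative 1) (at x)"
        by (auto intro!: derivative_eq_intros)
      ultimately have "((\<lambda>x. G (x - c * t)) has_real_derivative g (x - c * t)) (at x)"
        using DERIV_chain2[where f = G and g = "\<lambda>x. x - c * t" and x = x and Db = 1] deriv by fastforce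
      then show "((\<lambda>x. G (x - c * t) * \<phi> (t, x)) has_real_derivative f t x) (at x)"
        by (rule DERIV_cong[OF DERIV_mult[OF _ test_function_partial_derivatives(1)[OF \<phi>]]])
          (simp add: f_def)
    qed
    then show ?thesis by (rule lborel_integral_0I)
  qed
  have "integral\<^sup>L lborel (case_prod f) = (\<integral>t. (\<integral>x. f t x \<partial>lborel) \<partial>lborel)"
    using lborel_pair.integral_fst[of f] intf by (simp add: lborel_prod)
  also have "\<dots> = 0" by (simp add: inner)
  finally show ?thesis
    using intf by (simp add: has_bochner_integral_iff f_def)
qed

section \<open>Algebra of the profile equation\<close>

definition wave_speed :: "real \<Rightarrow> real \<Rightarrow> real" where
  "wave_speed HL HR = (HL + sqrt HL * sqrt HR + HR) / (sqrt HL + sqrt HR)"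

text \<open>
  Together with \<open>HL\<close> and \<open>HR\<close>, this is the third root of the cubic \<open>h\<^sup>3 = (c h - q)\<^sup>2\<close> that describes
  the equilibria on the line \<open>Q = c H - q\<close>.
\<close>

definition low_root :: "real \<Rightarrow> real \<Rightarrow> real" where
  "low_root HL HR = HL * HR / (sqrt HL + sqrt HR)\<^sup>2"

text \<open>
  The right-hand side of the profile equation \<open>H' = slope F HL HR H\<close>.
\<close>

definition slope :: "real \<Rightarrow> real \<Rightarrow> real \<Rightarrow> real \<Rightarrow> real" where
  "slope F HL HR h =
     F\<^sup>2 * ((h - HL) * (h - HR) * (h - low_root HL HR)) / (h ^ 3 - Hs F HL HR ^ 3)"

lemma cube_less_iff: "0 \<le> x \<Longrightarrow> 0 \<le> y \<Longrightarrow> x ^ 3 < y ^ 3 \<longleftrightarrow> x < (y::real)"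
  by (metis power_less_imp_less_base power_strict_mono zero_less_numeral)

locale endstates =
  fixes F HL HR :: real
  assumes F_pos: "F > 0" and HL_pos: "HL > 0" and HR_pos: "HR > 0" and HL_ne_HR: "HL \<noteq> HR"
begin

abbreviation c :: real where "c \<equiv> wave_speed HL HR"
abbreviation q :: real where "q \<equiv> q0 HL HR"
abbreviation H0 :: real where "H0 \<equiv> low_root HL HR"
abbreviation HS :: real where "HS \<equiv> Hs F HL HR"
abbreviation H1 :: real where "H1 \<equiv> Hstar F HL HR"

text \<open>
  With \<open>a = \<surd>HL\<close>, \<open>b = \<surd>HR\<close> and \<open>d = a b / (a + b)\<close>, the speed, the constant and the third root are
  polynomials in \<open>a\<close>, \<open>b\<close>, \<open>d\<close>, and identities between them follow from \<open>d (a + b) = a b\<close> alone.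
\<close>

lemma parametrization:
  obtains a b d where "a > 0" "b > 0" "d > 0" "HL = a\<^sup>2" "HR = b\<^sup>2" "sqrt HL = a" "sqrt HR = b"
    "d * (a + b) = a * b" "d < a" "d < b" "c = a + b - d" "q = d\<^sup>2 * (a + b)" "H0 = d\<^sup>2"
proof -
  define a b d where "a = sqrt HL" and "b = sqrt HR" and "d = a * b / (a + b)"
  have ab: "a > 0" "b > 0" "HL = a\<^sup>2" "HR = b\<^sup>2"
    using HL_pos HR_pos by (auto simp: a_def b_def)
  then have d: "d * (a + b) = a * b" "d > 0" "d < a" "d < b"
    by (auto simp: d_def field_simps power2_eq_square add_pos_pos)
  have "c = a + b - d"
    using ab by (simp add: wave_speed_def a_def[symmetric] b_def[symmetric] d_def field_simps power2_eq_square)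
  moreover have "q = d\<^sup>2 * (a + b)"
  proof -
    have "a + b \<noteq> 0" using ab by simp
    then have "a\<^sup>2 * b\<^sup>2 / (a + b) = (a * b / (a + b))\<^sup>2 * (a + b)"
      by (simp add: divide_simps power2_eq_square)
    then show ?thesis
      unfolding q0_def a_def[symmetric] b_def[symmetric] d_def unfolding ab(3,4) .
  qed
  moreover have "H0 = d\<^sup>2"
    using ab by (simp add: low_root_def a_def[symmetric] b_def[symmetric] d_def field_simps power2_eq_square)
  ultimately show thesis
    by (intro that[OF ab(1,2) d(2) ab(3,4) a_def[symmetric] b_def[symmetric] d(1,3,4)])
qed

lemma q_pos: "q > 0"
  using HL_pos HR_pos by (simp add: q0_def add_pos_pos)

lemma c_pos: "c > 0"
  using HL_pos HR_pos by (simp add: wave_speed_def add_pos_pos)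

lemma H0_bounds: "0 < H0" "H0 < HL" "H0 < HR"
proof -
  obtain a b d where *: "a > 0" "b > 0" "d > 0" "HL = a\<^sup>2" "HR = b\<^sup>2" "d < a" "d < b" "H0 = d\<^sup>2"
    by (rule parametrization)
  show "0 < H0" "H0 < HL" "H0 < HR"
    unfolding *(8) using * by (simp_all add: power2_eq_square mult_strict_mono)
qed

lemma equilibrium_cubic: "h ^ 3 - (c * h - q)\<^sup>2 = (h - HL) * (h - HR) * (h - H0)"
proof -
  obtain a b d where *: "HL = a\<^sup>2" "HR = b\<^sup>2" "d * (a + b) = a * b"
    "c = a + b - d" "q = d\<^sup>2 * (a + b)" "H0 = d\<^sup>2"
    by (rule parametrization)
  define s where "s = a + b"
  have "(h - HL) * (h - HR) = h\<^sup>2 - ((a + b)\<^sup>2 - 2 * (a * b)) * h + (a * b)\<^sup>2"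
    unfolding *(1,2) by (simp add: power2_eq_square algebra_simps)
  then have 1: "(h - HL) * (h - HR) = h\<^sup>2 - (s\<^sup>2 - 2 * (d * s)) * h + (d * s)\<^sup>2"
    by (simp add: *(3) s_def)
  have 2: "c = s - d" "q = d\<^sup>2 * s"
    using *(4,5) by (simp_all add: s_def)
  show ?thesis
    unfolding 1 2 *(6) by (simp add: power2_eq_square power3_eq_cube algebra_simps)
qed

lemma equilibrium_endstates: "c * HL - q = HL powr (3/2)" "c * HR - q = HR powr (3/2)"
proof -
  obtain a b d where *: "a > 0" "b > 0" "HL = a\<^sup>2" "HR = b\<^sup>2" "d * (a + b) = a * b"
    "c = a + b - d" "q = d\<^sup>2 * (a + b)"
    by (rule parametrization)
  have pow: "x\<^sup>2 powr (3/2) = x ^ 3" if "x > 0" for x :: real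
    using that by (simp add: powr_powr flip: powr_numeral)
  have "q = d * (d * (a + b))"
    unfolding *(7) by (simp add: power2_eq_square)
  then have q: "q = d * (a * b)"
    unfolding *(5) .
  have "c * HL - q = a ^ 3 + a * (a * b - d * (a + b))"
    unfolding q *(6) unfolding *(3) by (simp add: power2_eq_square power3_eq_cube algebra_simps)
  then show "c * HL - q = HL powr (3/2)"
    unfolding *(5) *(3) pow[OF *(1)] by simp
  have "c * HR - q = b ^ 3 + b * (a * b - d * (a + b))"
    unfolding q *(6) unfolding *(4) by (simp add: power2_eq_square power3_eq_cube algebra_simps)
  then show "c * HR - q = HR powr (3/2)"
    unfolding *(5) *(4) pow[OF *(2)] by simp
qed

text \<open>
  The flow \<open>c h - q\<close> is increasing in \<open>h\<close> and equals \<open>- d\<^sup>3 < 0\<close> at the low root \<open>d\<^sup>2\<close>.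
\<close>

lemma nonneg_flow_imp_above_low_root:
  assumes "0 \<le> c * h - q" shows "H0 < h"
proof -
  obtain a b d where *: "a > 0" "b > 0" "d > 0" "HL = a\<^sup>2" "HR = b\<^sup>2" "d * (a + b) = a * b"
    "d < a" "c = a + b - d" "q = d\<^sup>2 * (a + b)" "H0 = d\<^sup>2"
    by (rule parametrization)
  have "d\<^sup>2 * (a + b - d) < d\<^sup>2 * (a + b)"
    using * by simp
  also have "\<dots> \<le> h * (a + b - d)"
    using assms unfolding *(8,9) by (simp add: mult.commute)
  finally show ?thesis using *(2,7) unfolding *(10) by simp
qed

lemma nonneg_flow:
  assumes "min HL HR \<le> h" shows "0 \<le> c * h - q"
proof -
  have "0 \<le> c * min HL HR - q"
    using equilibrium_endstates powr_ge_zero[of HL "3/2"] powr_ge_zero[of HR "3/2"]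
    unfolding min_def by (cases "HL \<le> HR") (simp_all only: if_True if_False)
  also have "\<dots> \<le> c * h - q"
    using assms c_pos by simp
  finally show ?thesis .
qed

lemma HS_pos: "HS > 0"
  using q_pos F_pos by (simp add: Hs_def)

lemma HS_cubed: "HS ^ 3 = (q * F)\<^sup>2"
  using q_pos F_pos by (simp add: Hs_def powr_powr flip: powr_numeral)

lemma cube_HS_iff:
  assumes "h > 0"
  shows "h ^ 3 < HS ^ 3 \<longleftrightarrow> h < HS" "HS ^ 3 < h ^ 3 \<longleftrightarrow> HS < h" "h ^ 3 = HS ^ 3 \<longleftrightarrow> h = HS"
  using assms HS_pos cube_less_iff[of h HS] cube_less_iff[of HS h] by (auto simp: less_imp_le)

text \<open>
  In the moving frame the fluid moves at speed \<open>q / h\<close> to the left, and \<open>\<surd>h / F\<close> is the speed of gravity waves.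
\<close>

lemma sonic_iff:
  assumes h: "h > 0"
  shows "sqrt h / F < q / h \<longleftrightarrow> h < HS" "q / h < sqrt h / F \<longleftrightarrow> HS < h"
proof -
  have sq: "(h * sqrt h)\<^sup>2 = h ^ 3"
    using h by (simp add: power_mult_distrib power2_eq_square power3_eq_cube)
  have pos: "0 \<le> h * sqrt h" "0 \<le> q * F"
    using h q_pos F_pos by auto
  have "sqrt h / F < q / h \<longleftrightarrow> h * sqrt h < q * F"
    using h F_pos by (simp add: field_simps)
  also have "\<dots> \<longleftrightarrow> (h * sqrt h)\<^sup>2 < (q * F)\<^sup>2"
    using pos power_strict_mono[of "h * sqrt h" "q * F" 2] power_less_imp_less_base[of "h * sqrt h" 2 "q * F"]
    by auto
  finally show "sqrt h / F < q / h \<longleftrightarrow> h < HS"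
    unfolding sq HS_cubed[symmetric] cube_HS_iff(1)[OF h] .
  have "q / h < sqrt h / F \<longleftrightarrow> q * F < h * sqrt h"
    using h F_pos by (simp add: field_simps)
  also have "\<dots> \<longleftrightarrow> (q * F)\<^sup>2 < (h * sqrt h)\<^sup>2"
    using pos power_strict_mono[of "q * F" "h * sqrt h" 2] power_less_imp_less_base[of "q * F" 2 "h * sqrt h"]
    by auto
  finally show "q / h < sqrt h / F \<longleftrightarrow> HS < h"
    unfolding sq HS_cubed[symmetric] cube_HS_iff(2)[OF h] .
qed

lemma relative_speed: "h > 0 \<Longrightarrow> (c * h - q) / h = c - q / h"
  by (simp add: field_simps)

text \<open>
  Since \<open>q > 0\<close>, the slow characteristic always lags behind the wave.  That rules out 1-shocks, and a
  2-shock compares the two speeds of \<open>sonic_iff\<close> on either side.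
\<close>

lemma lax_condition_iff:
  assumes "h1 > 0" "h2 > 0"
  shows "lax_condition F c h1 (c * h1 - q) h2 (c * h2 - q) \<longleftrightarrow> h2 < HS \<and> HS < h1"
proof -
  have "0 < q / h1" "0 < sqrt h1 / F" "0 < q / h2" "0 < sqrt h2 / F"
    using assms q_pos F_pos by auto
  then show ?thesis
    unfolding lax_condition_def char_speed1_def char_speed2_def
      relative_speed[OF assms(1)] relative_speed[OF assms(2)]
      sonic_iff[OF assms(1), symmetric] sonic_iff[OF assms(2), symmetric]
    by linarith
qed

lemma noncharacteristic_iff:
  assumes "h > 0"
  shows "h / F\<^sup>2 - (c - (c * h - q) / h)\<^sup>2 \<noteq> 0 \<longleftrightarrow> h \<noteq> HS"
proof -
  have "h / F\<^sup>2 - (q / h)\<^sup>2 = (h ^ 3 - HS ^ 3) / (F\<^sup>2 * h\<^sup>2)"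
    unfolding HS_cubed using assms F_pos
    by (simp add: field_simps power2_eq_square power3_eq_cube)
  then show ?thesis
    unfolding relative_speed[OF assms] using assms F_pos cube_HS_iff(3)[OF assms] by auto
qed

lemma momentum_flux_relative:
  assumes "h > 0"
  shows "momentum_flux F h (c * h - q) - c * (c * h - q) = q\<^sup>2 / h + h\<^sup>2 / (2 * F\<^sup>2) - q * c"
  unfolding momentum_flux_def using assms F_pos
  by (simp add: field_simps power2_eq_square)

text \<open>
  The jump of the momentum flux in the moving frame contains the factor \<open>h1 - h2\<close>; dividing it out
  leaves a relation that is symmetric in the two states.
\<close>

lemma rankine_hugoniot_iff:
  assumes "h1 > 0" "h2 > 0" "h1 \<noteq> h2"
  shows "rankine_hugoniot F c h1 (c * h1 - q) h2 (c * h2 - q) \<longleftrightarrow> h1 * h2 * (h1 + h2) = 2 * HS ^ 3"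
proof -
  have "rankine_hugoniot F c h1 (c * h1 - q) h2 (c * h2 - q) \<longleftrightarrow>
          q\<^sup>2 / h1 + h1\<^sup>2 / (2 * F\<^sup>2) = q\<^sup>2 / h2 + h2\<^sup>2 / (2 * F\<^sup>2)"
    using momentum_flux_relative[OF assms(1)] momentum_flux_relative[OF assms(2)]
    unfolding rankine_hugoniot_def by (auto simp: algebra_simps)
  also have "\<dots> \<longleftrightarrow> (h1 - h2) * (h1 * h2 * (h1 + h2)) = (h1 - h2) * (2 * HS ^ 3)"
  proof -
    have "(q\<^sup>2 / h1 + h1\<^sup>2 / (2 * F\<^sup>2)) - (q\<^sup>2 / h2 + h2\<^sup>2 / (2 * F\<^sup>2)) =
          ((h1 - h2) * (h1 * h2 * (h1 + h2)) - (h1 - h2) * (2 * HS ^ 3)) / (2 * F\<^sup>2 * h1 * h2)"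
      unfolding HS_cubed using assms F_pos
      by (simp add: divide_simps) (simp add: power2_eq_square algebra_simps)
    moreover have "2 * F\<^sup>2 * h1 * h2 \<noteq> 0" using assms F_pos by simp
    ultimately show ?thesis by (metis divide_eq_0_iff right_minus_eq)
  qed
  finally show ?thesis using assms(3) by simp
qed

lemma Hstar_pos: "H1 > 0"
proof -
  have "sqrt ((HR / 2)\<^sup>2) < sqrt (2 * HS ^ 3 / HR + HR\<^sup>2 / 4)"
    using HS_pos HR_pos by (simp add: power_divide)
  then show ?thesis
    using HR_pos by (simp add: Hstar_def)
qed

lemma Hstar_eq: "H1 * HR * (H1 + HR) = 2 * HS ^ 3"
proof -
  have "0 \<le> 2 * HS ^ 3 / HR + HR\<^sup>2 / 4"
    using HS_pos HR_pos by simp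
  then have "(H1 + HR / 2)\<^sup>2 = 2 * HS ^ 3 / HR + HR\<^sup>2 / 4"
    by (simp add: Hstar_def)
  then show ?thesis
    using HR_pos by (simp add: field_simps power2_eq_square)
qed

text \<open>
  \<open>H*\<close> is the state conjugate to \<open>HR\<close>, and the left-hand side of the jump relation increases with the
  height.
\<close>

lemma Hstar_less_iff:
  assumes "x > 0"
  shows "x < H1 \<longleftrightarrow> x * HR * (x + HR) < 2 * HS ^ 3"
    and "H1 < x \<longleftrightarrow> 2 * HS ^ 3 < x * HR * (x + HR)"
    and "H1 = x \<longleftrightarrow> x * HR * (x + HR) = 2 * HS ^ 3"
proof -
  have mono: "y * HR * (y + HR) < z * HR * (z + HR)" if "0 < y" "y < z" for y z
    by (rule mult_strict_mono) (use that HR_pos in auto)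
  show "x < H1 \<longleftrightarrow> x * HR * (x + HR) < 2 * HS ^ 3"
    "H1 < x \<longleftrightarrow> 2 * HS ^ 3 < x * HR * (x + HR)"
    "H1 = x \<longleftrightarrow> x * HR * (x + HR) = 2 * HS ^ 3"
    using mono[of x H1] mono[of H1 x] assms Hstar_pos Hstar_eq
    by (cases x H1 rule: linorder_cases; force)+
qed

lemma Hs_less_Hstar_iff: "HS < H1 \<longleftrightarrow> HR < HS"
proof -
  have "HS < H1 \<longleftrightarrow> HS * (HR * (HS + HR)) < HS * (HS * (HS + HS))"
    unfolding Hstar_less_iff(1)[OF HS_pos] by (simp add: power3_eq_cube algebra_simps)
  also have "\<dots> \<longleftrightarrow> HR * (HS + HR) < HS * (HS + HS)"
    using HS_pos by simp
  also have "\<dots> \<longleftrightarrow> HR < HS"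
  proof (cases "HR < HS")
    case True
    then show ?thesis using HR_pos HS_pos by (auto intro!: mult_strict_mono)
  next
    case False
    then have "HS * (HS + HS) \<le> HR * (HS + HR)"
      using HS_pos by (intro mult_mono) auto
    then show ?thesis using False by simp
  qed
  finally show ?thesis .
qed

text \<open>
  The left-hand equation is the momentum balance after differentiating the flux in the moving frame;
  multiplying by \<open>F\<^sup>2 h\<^sup>2\<close> turns its right-hand side into the equilibrium cubic.
\<close>

lemma slope_iff:
  assumes "h > 0" "h \<noteq> HS"
  shows "(h / F\<^sup>2 - q\<^sup>2 / h\<^sup>2) * y = h - (c * h - q)\<^sup>2 / h\<^sup>2 \<longleftrightarrow> y = slope F HL HR h"
proof -
  have ne: "h ^ 3 - HS ^ 3 \<noteq> 0" using cube_HS_iff(3)[OF assms(1)] assms(2) by simp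
  define X where "X = c * h - q"
  have "(h / F\<^sup>2 - q\<^sup>2 / h\<^sup>2) * y - (h - X\<^sup>2 / h\<^sup>2) =
        ((h ^ 3 - HS ^ 3) * y - F\<^sup>2 * (h ^ 3 - X\<^sup>2)) / (F\<^sup>2 * h\<^sup>2)"
    unfolding HS_cubed using assms(1) F_pos
    by (simp add: divide_simps) (simp add: power2_eq_square power3_eq_cube algebra_simps)
  moreover have "F\<^sup>2 * h\<^sup>2 \<noteq> 0" using assms F_pos by simp
  ultimately have "(h / F\<^sup>2 - q\<^sup>2 / h\<^sup>2) * y = h - (c * h - q)\<^sup>2 / h\<^sup>2 \<longleftrightarrow>
        (h ^ 3 - HS ^ 3) * y = F\<^sup>2 * (h ^ 3 - (c * h - q)\<^sup>2)"
    unfolding X_def by (metis divide_eq_0_iff right_minus_eq)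
  also have "\<dots> \<longleftrightarrow> y = slope F HL HR h"
    unfolding equilibrium_cubic slope_def using ne by (simp add: field_simps)
  finally show ?thesis .
qed

lemma DERIV_momentum_flux:
  assumes "h > 0"
  shows "((\<lambda>h. q\<^sup>2 / h + h\<^sup>2 / (2 * F\<^sup>2) - q * c) has_real_derivative h / F\<^sup>2 - q\<^sup>2 / h\<^sup>2) (at h)"
  using assms F_pos
  by (auto intro!: derivative_eq_intros simp: power2_eq_square)

lemma continuous_slope: "h > 0 \<Longrightarrow> h \<noteq> HS \<Longrightarrow> isCont (slope F HL HR) h"
  unfolding slope_def using cube_HS_iff(3)[of h] by (intro continuous_intros) auto

end

section \<open>Calculus of piecewise smooth functions\<close>

lemma eventually_notin_locally_finite:
  fixes S :: "real set"
  assumes "\<And>a b. finite (S \<inter> {a..b})"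
  shows "\<forall>\<^sub>F y in at z. y \<notin> S"
proof -
  let ?A = "S \<inter> {z - 1..z + 1} - {z}"
  have "open ({z - 1<..<z + 1} - ?A)"
    using assms by (intro open_Diff finite_imp_closed) auto
  then have "\<forall>\<^sub>F y in nhds z. y \<in> {z - 1<..<z + 1} - ?A"
    by (rule eventually_nhds_in_open) auto
  then show ?thesis
    unfolding eventually_at_filter by eventually_elim auto
qed

lemma open_complement_locally_finite:
  fixes S :: "real set"
  assumes "\<And>a b. finite (S \<inter> {a..b})"
  shows "open (- S)"
  unfolding open_subopen[of "- S"]
proof (intro ballI)
  fix z assume "z \<in> - S"
  have "\<forall>\<^sub>F y in nhds z. y \<noteq> z \<longrightarrow> y \<notin> S"
    using eventually_notin_locally_finite[OF assms, of z]
    unfolding eventually_at_filter by simp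
  then have "\<forall>\<^sub>F y in nhds z. y \<in> - S"
    by (rule eventually_mono) (use \<open>z \<in> - S\<close> in auto)
  then show "\<exists>T. open T \<and> z \<in> T \<and> T \<subseteq> - S"
    unfolding eventually_nhds by blast
qed

text \<open>
  Replacing the values on \<open>S\<close> by the limits makes \<open>k\<close> continuous, with derivative zero off a finite
  set in each bounded interval.
\<close>

lemma constant_across_breakpoints:
  fixes k :: "real \<Rightarrow> real"
  assumes S: "\<And>a b. finite (S \<inter> {a..b})"
    and D: "\<And>z. z \<notin> S \<Longrightarrow> (k has_real_derivative 0) (at z)"
    and lim: "\<And>z. z \<in> S \<Longrightarrow> \<exists>l. (k \<longlongrightarrow> l) (at z)"
  obtains C where "\<And>z. z \<notin> S \<Longrightarrow> k z = C" "\<And>z. (k \<longlongrightarrow> C) (at z)"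
proof -
  define g where "g z = (if z \<in> S then Lim (at z) k else k z)" for z
  have klim: "(k \<longlongrightarrow> g z) (at z)" for z
  proof (cases "z \<in> S")
    case True
    obtain l where "(k \<longlongrightarrow> l) (at z)"
      using lim[OF True] by blast
    then show ?thesis
      using tendsto_Lim[of "at z" k l] True by (simp add: g_def)
  next
    case False
    then show ?thesis
      using DERIV_isCont[OF D[OF False]] by (simp add: g_def isCont_def)
  qed
  have ev: "\<forall>\<^sub>F y in at z. k y = g y" for z
    using eventually_notin_locally_finite[OF S, of z] by eventually_elim (simp add: g_def)
  have glim: "isCont g z" for z
    unfolding isCont_def by (rule Lim_transform_eventually[OF klim ev])
  have gD: "(g has_real_derivative 0) (at z)" if "z \<notin> S" for z
    using D[OF that]
    by (rule has_field_derivative_transform_within_open[OF _ open_complement_locally_finite[OF S]])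
      (use that in \<open>auto simp: g_def\<close>)
  have const: "g x = g 0" for x
  proof -
    let ?N = "\<bar>x\<bar> + 1" and ?I = "{- (\<bar>x\<bar> + 1)<..<\<bar>x\<bar> + 1}"
    show ?thesis
    proof (rule has_derivative_zero_unique_strong_connected[of ?I "S \<inter> {- ?N..?N}" g 0])
      show "continuous_on ?I g"
        using glim by (simp add: continuous_at_imp_continuous_on)
      show "(g has_derivative (\<lambda>h. 0)) (at z within ?I)" if "z \<in> ?I - S \<inter> {- ?N..?N}" for z
      proof -
        have "(g has_real_derivative 0) (at z)" using gD[of z] that by auto
        then have "(g has_derivative (\<lambda>h. 0)) (at z)"
          unfolding has_field_derivative_def by (rule has_derivative_eq_rhs) auto
        then show ?thesis by (rule has_derivative_at_withinI)
      qed
      show "finite (S \<inter> {- ?N..?N})" by (rule S)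
    qed auto
  qed
  show thesis
  proof (rule that[of "g 0"])
    fix z
    show "z \<notin> S \<Longrightarrow> k z = g 0" using const[of z] by (simp add: g_def)
    show "(k \<longlongrightarrow> g 0) (at z)" using klim[of z] const[of z] by simp
  qed
qed

text \<open>
  l'Hospital's rule for the difference quotient.  It extends the profile equation to break points at
  which the profile happens to be continuous.
\<close>

lemma DERIV_of_limit_of_derivative:
  fixes f :: "real \<Rightarrow> real"
  assumes "isCont f s" and "\<forall>\<^sub>F z in at s. (f has_real_derivative g z) (at z)"
    and "(g \<longlongrightarrow> l) (at s)"
  shows "(f has_real_derivative l) (at s)"
proof -
  have "((\<lambda>z. (f z - f s) / (z - s)) \<longlongrightarrow> l) (at s)"
  proof (rule lhopital[where f' = g and g' = "\<lambda>_. 1"])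
    show "((\<lambda>z. f z - f s) \<longlongrightarrow> 0) (at s)"
      using assms(1) by (simp add: isCont_def LIM_zero_iff)
    show "((\<lambda>z. z - s) \<longlongrightarrow> 0) (at s)"
      by (auto intro!: tendsto_eq_intros)
    show "\<forall>\<^sub>F z in at s. z - s \<noteq> 0"
      by (simp add: eventually_at_filter)
    show "\<forall>\<^sub>F z in at s. ((\<lambda>z. f z - f s) has_real_derivative g z) (at z)"
      using assms(2) by eventually_elim (auto intro!: derivative_eq_intros)
    show "\<forall>\<^sub>F z in at s. ((\<lambda>z. z - s) has_real_derivative 1) (at z)"
      by (auto intro!: derivative_eq_intros always_eventually)
    show "((\<lambda>z. g z / 1) \<longlongrightarrow> l) (at s)" using assms(3) by simp
  qed auto
  then show ?thesis
    by (simp add: has_field_derivative_iff)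
qed

text \<open>
  With an antiderivative \<open>M\<close> of \<open>m\<close>, the product \<open>w exp (- M)\<close> is constant.  This stands in for the
  uniqueness theorem for the profile equation.
\<close>

lemma linear_ode_zero_or_never:
  fixes w m :: "real \<Rightarrow> real"
  assumes I: "is_interval I"
    and D: "\<And>z. z \<in> I \<Longrightarrow> (w has_real_derivative m z * w z) (at z)"
    and m: "continuous_on I m"
    and z0: "z0 \<in> I" "w z0 = 0" and z: "z \<in> I"
  shows "w z = 0"
proof -
  define a b where "a = min z0 z" and "b = max z0 z"
  have sub: "{a..b} \<subseteq> I"
  proof
    fix x assume x: "x \<in> {a..b}"
    have "a \<in> I" "b \<in> I"
      using z0(1) z by (simp_all add: a_def b_def min_def max_def)
    then show "x \<in> I"
      using mem_is_interval_1_I[OF I, of a b x] x by simp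
  qed
  obtain M where M: "\<And>x. x \<in> {a..b} \<Longrightarrow> (M has_vector_derivative m x) (at x within {a..b})"
    using antiderivative_continuous[OF continuous_on_subset[OF m sub]] by blast
  have "\<exists>C. \<forall>x\<in>{a..b}. w x * exp (- M x) = C"
  proof (rule has_field_derivative_zero_constant)
    fix x assume x: "x \<in> {a..b}"
    have "(w has_real_derivative m x * w x) (at x within {a..b})"
      by (rule has_field_derivative_at_within[OF D]) (use x sub in blast)
    moreover have "(M has_real_derivative m x) (at x within {a..b})"
      using M[OF x] by (simp add: has_real_derivative_iff_has_vector_derivative)
    ultimately show "((\<lambda>x. w x * exp (- M x)) has_real_derivative 0) (at x within {a..b})"
      by (auto intro!: derivative_eq_intros)
  qed auto
  then obtain C where C: "\<And>x. x \<in> {a..b} \<Longrightarrow> w x * exp (- M x) = C" by blast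
  have "w z * exp (- M z) = w z0 * exp (- M z0)"
    using C[of z] C[of z0] by (simp add: a_def b_def)
  then show ?thesis using z0(2) by simp
qed


section \<open>Smoothness\<close>

lemma higher_deriv_cong_open:
  fixes f g :: "real \<Rightarrow> real"
  assumes "open S" and "\<And>x. x \<in> S \<Longrightarrow> f x = g x" and "x \<in> S"
  shows "(deriv ^^ n) f x = (deriv ^^ n) g x"
  using assms(3)
proof (induction n arbitrary: x)
  case 0
  then show ?case using assms(2) by simp
next
  case (Suc n)
  have "\<forall>\<^sub>F y in nhds x. (deriv ^^ n) f y = (deriv ^^ n) g y"
    using eventually_nhds_in_open[OF assms(1) Suc.prems] by eventually_elim (rule Suc.IH)
  then show ?case by (simp add: deriv_cong_ev)
qed

lemma smooth_on_cong_open: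
  fixes f g :: "real \<Rightarrow> real"
  assumes "open S" and eq: "\<And>x. x \<in> S \<Longrightarrow> f x = g x" and "smooth_on S g"
  shows "smooth_on S f"
  unfolding smooth_on_def
proof (intro allI ballI)
  fix n x assume x: "x \<in> S"
  have "(deriv ^^ n) g field_differentiable at x"
    using assms(3) x by (simp add: smooth_on_def)
  then obtain d where "((deriv ^^ n) g has_field_derivative d) (at x)"
    by (auto simp: field_differentiable_def)
  then have "((deriv ^^ n) f has_field_derivative d) (at x)"
    by (rule has_field_derivative_transform_within_open[OF _ assms(1) x])
      (use higher_deriv_cong_open[of S f g, OF assms(1) eq] in simp)
  then show "(deriv ^^ n) f field_differentiable at x"
    by (auto simp: field_differentiable_def)
qed

lemma smooth_on_subset: "smooth_on T f \<Longrightarrow> S \<subseteq> T \<Longrightarrow> smooth_on S f"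
  by (auto simp: smooth_on_def)

lemma smooth_on_derivatives:
  assumes "smooth_on T f" "z \<in> T"
  shows "(f has_real_derivative deriv f z) (at z)" "isCont (deriv f) z" "isCont f z"
proof -
  have "(deriv ^^ 0) f field_differentiable at z" "(deriv ^^ 1) f field_differentiable at z"
    using assms unfolding smooth_on_def by blast+
  then have "f field_differentiable at z" "deriv f field_differentiable at z" by simp_all
  then show "(f has_real_derivative deriv f z) (at z)" "isCont (deriv f) z" "isCont f z"
    by (simp_all add: field_differentiable_derivI field_differentiable_imp_continuous_at)
qed

text \<open>
  Along a solution of \<open>f' = P(f) / D(f)\<close>, the functions \<open>N(f) / D(f)\<^bsup>k+1\<^esup>\<close> with \<open>N\<close> a polynomial
  are closed under differentiation; hence every iterated derivative exists and has this form.
\<close>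

lemma smooth_on_poly_of_rational_ode:
  fixes f :: "real \<Rightarrow> real"
  assumes S: "open S"
    and ode: "\<And>z. z \<in> S \<Longrightarrow> poly D (f z) \<noteq> 0"
      "\<And>z. z \<in> S \<Longrightarrow> (f has_real_derivative poly P (f z) / poly D (f z)) (at z)"
  shows "smooth_on S (\<lambda>z. poly N (f z))"
proof -
  \<comment> \<open>The exponent is kept at least one, so that the power rule needs no case distinction.\<close>
  have step: "((\<lambda>z. poly N (f z) / poly D (f z) ^ Suc k) has_real_derivative
       poly (pderiv N * P * D - smult (of_nat (Suc k)) (N * pderiv D * P)) (f z) / poly D (f z) ^ Suc (Suc (Suc k))) (at z)"
    if z: "z \<in> S" for N k z
  proof -
    let ?d = "poly D (f z)"
    have pf: "((\<lambda>z. poly N (f z)) has_real_derivative poly (pderiv N) (f z) * (poly P (f z) / ?d)) (at z)" for N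
      by (rule DERIV_chain2[OF poly_DERIV ode(2)[OF z]])
    have "((\<lambda>z. poly D (f z) ^ Suc k) has_real_derivative
            real (Suc k) * ?d ^ k * (poly (pderiv D) (f z) * (poly P (f z) / ?d))) (at z)"
      using DERIV_power[OF pf[of D], of "Suc k"] by (simp add: mult_ac)
    from DERIV_divide[OF pf[of N] this] show ?thesis
      by (rule DERIV_cong) (use ode(1)[OF z] in \<open>auto simp: field_simps\<close>)
  qed
  have "\<exists>N' k. \<forall>z\<in>S. (deriv ^^ n) (\<lambda>z. poly N (f z)) z = poly N' (f z) / poly D (f z) ^ Suc k" for n
  proof (induction n)
    case 0
    have "\<forall>z\<in>S. poly N (f z) = poly (N * D) (f z) / poly D (f z) ^ Suc 0"
      using ode(1) by simp
    then show ?case by (metis funpow_0)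
  next
    case (Suc n)
    then obtain N' k where IH: "\<And>z. z \<in> S \<Longrightarrow> (deriv ^^ n) (\<lambda>z. poly N (f z)) z = poly N' (f z) / poly D (f z) ^ Suc k"
      by blast
    have "(deriv ^^ Suc n) (\<lambda>z. poly N (f z)) z =
        poly (pderiv N' * P * D - smult (of_nat (Suc k)) (N' * pderiv D * P)) (f z) / poly D (f z) ^ Suc (Suc (Suc k))"
      if z: "z \<in> S" for z
    proof -
      have "((deriv ^^ n) (\<lambda>z. poly N (f z)) has_real_derivative
        poly (pderiv N' * P * D - smult (of_nat (Suc k)) (N' * pderiv D * P)) (f z) / poly D (f z) ^ Suc (Suc (Suc k))) (at z)"
        by (rule has_field_derivative_transform_within_open[OF step[OF z] S z]) (simp add: IH)
      then show ?thesis by (simp add: DERIV_imp_deriv)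
    qed
    then show ?case by blast
  qed
  then show ?thesis
    unfolding smooth_on_def
  proof (intro allI ballI)
    fix n z assume z: "z \<in> S"
    obtain N' k where eq: "\<And>z. z \<in> S \<Longrightarrow> (deriv ^^ n) (\<lambda>z. poly N (f z)) z = poly N' (f z) / poly D (f z) ^ Suc k"
      using \<open>\<And>n. \<exists>N' k. \<forall>z\<in>S. (deriv ^^ n) (\<lambda>z. poly N (f z)) z = poly N' (f z) / poly D (f z) ^ Suc k\<close>
      by blast
    have "((deriv ^^ n) (\<lambda>z. poly N (f z)) has_real_derivative
        poly (pderiv N' * P * D - smult (of_nat (Suc k)) (N' * pderiv D * P)) (f z) / poly D (f z) ^ Suc (Suc (Suc k))) (at z)"
      by (rule has_field_derivative_transform_within_open[OF step[OF z] S z]) (simp add: eq)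
    then show "(deriv ^^ n) (\<lambda>z. poly N (f z)) field_differentiable at z"
      by (auto simp: field_differentiable_def)
  qed
qed

lemma piecewise_smooth_if_smooth: "smooth_on UNIV f \<Longrightarrow> piecewise_smooth f"
  unfolding piecewise_smooth_def by (intro exI[of _ "{}"]) auto

lemma piecewise_smooth_glue:
  fixes f g h :: "real \<Rightarrow> real"
  assumes f: "smooth_on {..<e} f" "e > 0" and g: "smooth_on {-e<..} g"
    and h: "\<And>z. z < 0 \<Longrightarrow> h z = f z" "\<And>z. z > 0 \<Longrightarrow> h z = g z"
  shows "piecewise_smooth h"
proof -
  have eqf: "(deriv ^^ n) h z = (deriv ^^ n) f z" if "z < 0" for n z
    using higher_deriv_cong_open[of "{..<0}" h f z n] h(1) that by simp
  have eqg: "(deriv ^^ n) h z = (deriv ^^ n) g z" if "z > 0" for n z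
    using higher_deriv_cong_open[of "{0<..}" h g z n] h(2) that by simp
  have "smooth_on {..<0} h"
    by (rule smooth_on_cong_open[OF _ _ smooth_on_subset[OF f(1)]]) (use h f(2) in auto)
  moreover have "smooth_on {0<..} h"
    by (rule smooth_on_cong_open[OF _ _ smooth_on_subset[OF g]]) (use h f(2) in auto)
  ultimately have "smooth_on (- {0}) h"
    by (force simp: smooth_on_def neq_iff)
  moreover have "((deriv ^^ n) h \<longlongrightarrow> (deriv ^^ n) f 0) (at_left 0)" for n
  proof -
    have "isCont ((deriv ^^ n) f) 0"
      using f by (auto simp: smooth_on_def intro: field_differentiable_imp_continuous_at)
    then have "((deriv ^^ n) f \<longlongrightarrow> (deriv ^^ n) f 0) (at_left 0)"
      unfolding isCont_def by (rule filterlim_mono) (auto simp: at_within_le_at)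
    then show ?thesis
      by (rule Lim_transform_eventually) (auto simp: eventually_at_filter eqf)
  qed
  moreover have "((deriv ^^ n) h \<longlongrightarrow> (deriv ^^ n) g 0) (at_right 0)" for n
  proof -
    have "isCont ((deriv ^^ n) g) 0"
      using f(2) g by (auto simp: smooth_on_def intro: field_differentiable_imp_continuous_at)
    then have "((deriv ^^ n) g \<longlongrightarrow> (deriv ^^ n) g 0) (at_right 0)"
      unfolding isCont_def by (rule filterlim_mono) (auto simp: at_within_le_at)
    then show ?thesis
      by (rule Lim_transform_eventually) (auto simp: eventually_at_filter eqg)
  qed
  ultimately show ?thesis
    unfolding piecewise_smooth_def by (intro exI[of _ "{0}"]) auto
qed

lemma higher_deriv_translate:
  fixes f :: "real \<Rightarrow> real"
  shows "(deriv ^^ n) (\<lambda>z. f (z + a)) = (\<lambda>z. (deriv ^^ n) f (z + a))"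
proof (induction n)
  case (Suc n)
  then show ?case
    by (simp add: deriv_def DERIV_shift)
qed simp

lemma smooth_on_translate:
  "smooth_on S f \<Longrightarrow> smooth_on {z. z + a \<in> S} (\<lambda>z. f (z + a))"
  unfolding smooth_on_def higher_deriv_translate field_differentiable_def
  using DERIV_shift by blast

lemma filterlim_one_sided_translate:
  fixes f :: "real \<Rightarrow> 'a"
  shows "filterlim (\<lambda>z. f (z + a)) G (at_left z) \<longleftrightarrow> filterlim f G (at_left (z + a))"
    and "filterlim (\<lambda>z. f (z + a)) G (at_right z) \<longleftrightarrow> filterlim f G (at_right (z + a))"
proof -
  have "filtermap (\<lambda>x. x + a) (at_left z) = at_left (z + a)"
    using filtermap_nhds_shift[of "- a" z]
    by (simp add: filter_eq_iff eventually_filtermap eventually_at_filter flip: filtermap_nhds_shift[of "- a" z, simplified])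
  then show "filterlim (\<lambda>z. f (z + a)) G (at_left z) \<longleftrightarrow> filterlim f G (at_left (z + a))"
    unfolding filterlim_def filtermap_filtermap[symmetric, of f "\<lambda>z. z + a", simplified] by simp
  have "filtermap (\<lambda>x. x + a) (at_right z) = at_right (z + a)"
    using filtermap_at_right_shift[of "- a" z] by simp
  then show "filterlim (\<lambda>z. f (z + a)) G (at_right z) \<longleftrightarrow> filterlim f G (at_right (z + a))"
    unfolding filterlim_def filtermap_filtermap[symmetric, of f "\<lambda>z. z + a", simplified] by simp
qed

lemma piecewise_smooth_translate:
  assumes "piecewise_smooth f" shows "piecewise_smooth (\<lambda>z. f (z + a))"
proof -
  obtain S where S: "\<And>a b. finite (S \<inter> {a..b})" "smooth_on (- S) f"
    "\<And>s n. s \<in> S \<Longrightarrow> (\<exists>l. ((deriv ^^ n) f \<longlongrightarrow> l) (at_left s)) \<and> (\<exists>l. ((deriv ^^ n) f \<longlongrightarrow> l) (at_right s))"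
    using assms unfolding piecewise_smooth_def by blast
  let ?T = "{z. z + a \<in> S}"
  have "finite (?T \<inter> {x..y})" for x y
  proof -
    have "?T \<inter> {x..y} \<subseteq> (\<lambda>s. s - a) ` (S \<inter> {x + a..y + a})"
    proof
      fix u assume "u \<in> ?T \<inter> {x..y}"
      then show "u \<in> (\<lambda>s. s - a) ` (S \<inter> {x + a..y + a})"
        by (intro image_eqI[of _ _ "u + a"]) auto
    qed
    then show ?thesis by (rule finite_subset) (intro finite_imageI S(1))
  qed
  moreover have "smooth_on (- ?T) (\<lambda>z. f (z + a))"
    using smooth_on_translate[OF S(2), of a] by (rule smooth_on_subset) auto
  moreover have "(\<exists>l. ((deriv ^^ n) f \<longlongrightarrow> l) (at_left (s + a))) \<and> (\<exists>l. ((deriv ^^ n) f \<longlongrightarrow> l) (at_right (s + a)))"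
    if "s \<in> ?T" for s n
    using S(3)[of "s + a" n] that by simp
  ultimately show ?thesis
    unfolding piecewise_smooth_def higher_deriv_translate filterlim_one_sided_translate
    by (intro exI[of _ ?T] conjI allI ballI; blast)
qed

section \<open>Structure of profiles\<close>

text \<open>
  A locally finite set contains no half-line, so the constant value is taken arbitrarily far out.
\<close>

lemma limit_of_constant_off_locally_finite:
  fixes k :: "real \<Rightarrow> real"
  assumes S: "\<And>a b. finite (S \<inter> {a..b})" and C: "\<And>z. z \<notin> S \<Longrightarrow> k z = C"
  shows "(k \<longlongrightarrow> L) at_bot \<Longrightarrow> L = C" and "(k \<longlongrightarrow> L) at_top \<Longrightarrow> L = C"
proof -
  have ex: "\<exists>z\<in>{a..a + 1}. z \<notin> S" for a :: real
  proof (rule ccontr)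
    assume "\<not> (\<exists>z\<in>{a..a + 1}. z \<notin> S)"
    then have "{a..a + 1} \<subseteq> S \<inter> {a..a + 1}" by blast
    then have "finite {a..a + 1}" using S by (rule finite_subset)
    then show False by (simp add: infinite_Icc)
  qed
  have no: "\<not> (\<forall>\<^sub>F z in at_bot. k z \<noteq> C)" "\<not> (\<forall>\<^sub>F z in at_top. k z \<noteq> C)"
  proof safe
    assume "\<forall>\<^sub>F z in at_bot. k z \<noteq> C"
    then obtain N where N: "\<And>z. z \<le> N \<Longrightarrow> k z \<noteq> C"
      by (auto simp: eventually_at_bot_linorder)
    obtain z where "z \<in> {N - 1..N - 1 + 1}" "z \<notin> S" using ex by blast
    then show False using N[of z] C[of z] by simp
  next
    assume "\<forall>\<^sub>F z in at_top. k z \<noteq> C"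
    then obtain N where N: "\<And>z. z \<ge> N \<Longrightarrow> k z \<noteq> C"
      by (auto simp: eventually_at_top_linorder)
    obtain z where "z \<in> {N..N + 1}" "z \<notin> S" using ex by blast
    then show False using N[of z] C[of z] by simp
  qed
  show "L = C" if "(k \<longlongrightarrow> L) at_bot"
    using no(1) tendsto_imp_eventually_ne[OF that] by blast
  show "L = C" if "(k \<longlongrightarrow> L) at_top"
    using no(2) tendsto_imp_eventually_ne[OF that] by blast
qed

lemma stays_below:
  fixes f :: "real \<Rightarrow> real"
  assumes I: "is_interval I" and cont: "continuous_on I f" and ne: "\<And>z. z \<in> I \<Longrightarrow> f z \<noteq> v"
    and x: "x \<in> I" and y: "y \<in> I"
  shows "f x < v \<longleftrightarrow> f y < v"
proof -
  have "is_interval (f ` I)"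
    using connected_continuous_image[OF cont] I by (simp add: is_interval_connected_1)
  then have hit: "v \<in> f ` I" if "u \<in> f ` I" "w \<in> f ` I" "u \<le> v" "v \<le> w" for u w
    using that by (rule mem_is_interval_1_I)
  have *: "\<not> (f u < v \<and> v < f w)" if "u \<in> I" "w \<in> I" for u w
  proof
    assume "f u < v \<and> v < f w"
    then have "v \<in> f ` I"
      using that hit[of "f u" "f w"] by simp
    then show False using ne by blast
  qed
  show ?thesis using *[OF x y] *[OF y x] ne[OF x] ne[OF y] by linarith
qed

context endstates
begin

lemma profile_breakpoints:
  assumes P: "traveling_wave_profile F HL HR s H Q"
  obtains S where "\<And>a b. finite (S \<inter> {a..b})" "smooth_on (- S) H" "smooth_on (- S) Q"
proof -
  obtain S1 S2 where S: "\<And>a b. finite (S1 \<inter> {a..b})" "smooth_on (- S1) H"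
    "\<And>a b. finite (S2 \<inter> {a..b})" "smooth_on (- S2) Q"
    using P unfolding traveling_wave_profile_def piecewise_smooth_def by blast
  have "finite ((S1 \<union> S2) \<inter> {a..b})" for a b
    using S(1)[of a b] S(3)[of a b] by (simp add: Int_Un_distrib2)
  moreover have "smooth_on (- (S1 \<union> S2)) H" "smooth_on (- (S1 \<union> S2)) Q"
    using S(2,4) by (auto intro: smooth_on_subset)
  ultimately show thesis by (rule that)
qed

text \<open>
  Off the break points the mass equation gives \<open>(s H - Q)' = 0\<close>, and the first Rankine-Hugoniot
  condition carries the constant across the jumps.  Its limits at both infinities give two equations
  for the speed and the constant, solvable uniquely because \<open>HL \<noteq> HR\<close>.
\<close>

lemma profile_flow:
  assumes P: "traveling_wave_profile F HL HR s H Q"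
  shows "s = c" and "isCont H z \<Longrightarrow> isCont Q z \<Longrightarrow> Q z = c * H z - q"
proof -
  obtain S where S: "\<And>a b. finite (S \<inter> {a..b})" and sm: "smooth_on (- S) H" "smooth_on (- S) Q"
    using profile_breakpoints[OF P] by blast
  have weak: "has_bochner_integral lborel
      (\<lambda>(t, x). H (x - s * t) * \<phi>t (t, x) + Q (x - s * t) * \<phi>x (t, x) + 0 * \<phi> (t, x)) 0"
    if "test_function \<phi> \<phi>t \<phi>x" for \<phi> \<phi>t \<phi>x
    using P that unfolding traveling_wave_profile_def weak_solution_def by simp
  define k where "k z = s * H z - Q z" for z
  have D: "(k has_real_derivative 0) (at z)" if z: "z \<notin> S" for z
  proof -
    obtain R where R: "R > 0" "ball z R \<subseteq> - S"
      using open_complement_locally_finite[OF S] z unfolding open_contains_ball by blast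
    then have sub: "{z - R<..<z + R} \<subseteq> - S"
      by (simp add: ball_eq_greaterThanLessThan)
    have "deriv Q z - s * deriv H z = 0"
    proof (rule weak_travelling_imp_ode[where u = H and v = Q and w = "\<lambda>_. 0"
          and p' = "\<lambda>y. deriv Q y - s * deriv H y", OF R(1) _ _ _ _ _ weak])
      show "continuous_on {z - R<..<z + R} H" "continuous_on {z - R<..<z + R} Q"
        "continuous_on {z - R<..<z + R} (\<lambda>y. deriv Q y - s * deriv H y)"
        using sub smooth_on_derivatives(2,3)[OF sm(1)] smooth_on_derivatives(2,3)[OF sm(2)]
        by (intro continuous_at_imp_continuous_on ballI continuous_intros; blast)+
      fix y assume "y \<in> {z - R<..<z + R}"
      then have "y \<in> - S" using sub by blast
      then show "((\<lambda>y. Q y - s * H y) has_real_derivative deriv Q y - s * deriv H y) (at y)"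
        by (intro derivative_intros DERIV_cmult smooth_on_derivatives(1)[OF sm(1)]
            smooth_on_derivatives(1)[OF sm(2)])
    qed auto
    moreover have "(k has_real_derivative s * deriv H z - deriv Q z) (at z)"
      unfolding k_def using z
      by (intro derivative_intros DERIV_cmult smooth_on_derivatives(1)[OF sm(1)]
            smooth_on_derivatives(1)[OF sm(2)]) auto
    ultimately show ?thesis by simp
  qed
  have lim: "\<exists>l. (k \<longlongrightarrow> l) (at z)" for z
  proof (cases "isCont H z \<and> isCont Q z")
    case True
    then have "isCont k z" unfolding k_def by (intro continuous_intros) auto
    then show ?thesis unfolding isCont_def by blast
  next
    case False
    then have "lax_shock_at F s H Q z"
      using P unfolding traveling_wave_profile_def by blast
    then obtain h1 q1 h2 q2 where
      "(H \<longlongrightarrow> h1) (at_left z)" "(Q \<longlongrightarrow> q1) (at_left z)"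
      "(H \<longlongrightarrow> h2) (at_right z)" "(Q \<longlongrightarrow> q2) (at_right z)"
      and rh: "s * (h2 - h1) = q2 - q1"
      unfolding lax_shock_at_def rankine_hugoniot_def by blast
    then have "(k \<longlongrightarrow> s * h1 - q1) (at_left z)" "(k \<longlongrightarrow> s * h2 - q2) (at_right z)"
      unfolding k_def by (auto intro!: tendsto_intros)
    moreover have "s * h2 - q2 = s * h1 - q1" using rh by (simp add: algebra_simps)
    ultimately have "(k \<longlongrightarrow> s * h1 - q1) (at z)"
      by (simp add: filterlim_split_at)
    then show ?thesis by blast
  qed
  obtain C where C: "\<And>z. z \<notin> S \<Longrightarrow> k z = C" "\<And>z. (k \<longlongrightarrow> C) (at z)"
    using constant_across_breakpoints[OF S D lim] by blast
  have ends: "(H \<longlongrightarrow> HL) at_bot" "(Q \<longlongrightarrow> HL powr (3/2)) at_bot"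
    "(H \<longlongrightarrow> HR) at_top" "(Q \<longlongrightarrow> HR powr (3/2)) at_top"
    using P unfolding traveling_wave_profile_def by blast+
  have "(k \<longlongrightarrow> s * HL - HL powr (3/2)) at_bot" "(k \<longlongrightarrow> s * HR - HR powr (3/2)) at_top"
    unfolding k_def by (intro tendsto_intros ends)+
  then have eq: "s * HL - HL powr (3/2) = C" "s * HR - HR powr (3/2) = C"
    using limit_of_constant_off_locally_finite[where k = k, OF S C(1)] by blast+
  then have "(s - c) * (HL - HR) = 0"
    using equilibrium_endstates by (simp add: algebra_simps)
  then show s: "s = c" using HL_ne_HR by simp
  have Cq: "C = q" using eq(1) equilibrium_endstates(1) by (simp add: s)
  show "Q z = c * H z - q" if "isCont H z" "isCont Q z"
  proof -
    have "isCont k z" unfolding k_def by (intro continuous_intros that)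
    then have "k z = C" using C(2) unfolding isCont_def by (metis LIM_unique)
    then show ?thesis by (simp add: k_def s Cq)
  qed
qed

definition jumps :: "(real \<Rightarrow> real) \<Rightarrow> (real \<Rightarrow> real) \<Rightarrow> real set" where
  "jumps H Q = {z. \<not> (isCont H z \<and> isCont Q z)}"

text \<open>
  What remains of a profile after eliminating the flow; the shape of the height is found from this alone.  The
  values at the jumps themselves are left free.
\<close>

definition piecewise_orbit :: "(real \<Rightarrow> real) \<Rightarrow> real set \<Rightarrow> bool" where
  "piecewise_orbit H J \<longleftrightarrow>
     (\<forall>a b. finite (J \<inter> {a..b})) \<and>
     (\<forall>z. z \<notin> J \<longrightarrow> H0 < H z \<and> H z \<noteq> HS \<and> (H has_real_derivative slope F HL HR (H z)) (at z)) \<and>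
     (\<forall>z\<in>J. \<exists>h1 h2. (H \<longlongrightarrow> h1) (at_left z) \<and> (H \<longlongrightarrow> h2) (at_right z) \<and>
         h2 < HS \<and> HS < h1 \<and> h1 * h2 * (h1 + h2) = 2 * HS ^ 3) \<and>
     (H \<longlongrightarrow> HL) at_bot \<and> (H \<longlongrightarrow> HR) at_top \<and> HL \<noteq> HS \<and> HR \<noteq> HS"

text \<open>
  With \<open>Q\<close> eliminated, the momentum balance becomes the profile equation off the break points.  At a
  break point without a jump, noncharacteristicity makes the right-hand side continuous, so that the
  equation persists.
\<close>

lemma profile_piecewise_orbit:
  assumes N: "nc_profile F HL HR s H Q"
  shows "piecewise_orbit H (jumps H Q)"
proof -
  have P: "traveling_wave_profile F HL HR s H Q" and nc: "noncharacteristic F HL HR s H Q"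
    using N by (auto simp: nc_profile_def)
  note s = profile_flow(1)[OF P]
  note flow = profile_flow(2)[OF P]
  obtain S where S: "\<And>a b. finite (S \<inter> {a..b})" and sm: "smooth_on (- S) H" "smooth_on (- S) Q"
    using profile_breakpoints[OF P] by blast
  have Hpos: "0 < H z" and Qpos: "0 \<le> Q z" for z
    using P unfolding traveling_wave_profile_def by blast+
  have contS: "isCont H z" "isCont Q z" if "z \<notin> S" for z
    using smooth_on_derivatives(3)[OF sm(1)] smooth_on_derivatives(3)[OF sm(2)] that by blast+
  then have JS: "jumps H Q \<subseteq> S" by (auto simp: jumps_def)
  have sub: "jumps H Q \<inter> {a..b} \<subseteq> S \<inter> {a..b}" for a b using JS by blast
  have fin: "finite (jumps H Q \<inter> {a..b})" for a b
    by (rule finite_subset[OF sub S])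
  have weak: "has_bochner_integral lborel
      (\<lambda>(t, x). Q (x - c * t) * \<phi>t (t, x) + momentum_flux F (H (x - c * t)) (Q (x - c * t)) * \<phi>x (t, x)
         + (H (x - c * t) - \<bar>Q (x - c * t)\<bar> * Q (x - c * t) / (H (x - c * t))\<^sup>2) * \<phi> (t, x)) 0"
    if "test_function \<phi> \<phi>t \<phi>x" for \<phi> \<phi>t \<phi>x
    using P that unfolding traveling_wave_profile_def weak_solution_def s by blast
  have nonsonic: "H z \<noteq> HS" if "isCont H z" "isCont Q z" for z
  proof -
    have "one_sided_state H Q z (H z) (Q z)"
      using that unfolding one_sided_state_def isCont_def filterlim_at_split by blast
    then have "H z / F\<^sup>2 - (c - Q z / H z)\<^sup>2 \<noteq> 0"
      using nc unfolding noncharacteristic_def s by blast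
    then show ?thesis
      unfolding flow[OF that] noncharacteristic_iff[OF Hpos] .
  qed
  have above: "H0 < H z" if "isCont H z" "isCont Q z" for z
    using nonneg_flow_imp_above_low_root[of "H z"] Qpos[of z] flow[OF that] by simp
  have ode_S: "(H has_real_derivative slope F HL HR (H z)) (at z)" if z: "z \<notin> S" for z
  proof -
    obtain R where R: "R > 0" "ball z R \<subseteq> - S"
      using open_complement_locally_finite[OF S] z unfolding open_contains_ball by blast
    then have sub: "{z - R<..<z + R} \<subseteq> - S"
      by (simp add: ball_eq_greaterThanLessThan)
    have Qy: "Q y = c * H y - q" if "y \<in> {z - R<..<z + R}" for y
      using flow contS that sub by blast
    have HD: "(H has_real_derivative deriv H y) (at y)" "isCont (deriv H) y" "isCont H y" "isCont Q y"
      if "y \<in> {z - R<..<z + R}" for y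
      using smooth_on_derivatives[OF sm(1)] smooth_on_derivatives[OF sm(2)] that sub by blast+
    have contI: "continuous_on {z - R<..<z + R} H" "continuous_on {z - R<..<z + R} Q"
      "continuous_on {z - R<..<z + R} (deriv H)"
      using HD by (auto intro: continuous_at_imp_continuous_on)
    have "(H z / F\<^sup>2 - q\<^sup>2 / (H z)\<^sup>2) * deriv H z = H z - \<bar>Q z\<bar> * Q z / (H z)\<^sup>2"
    proof (rule weak_travelling_imp_ode[where u = Q and v = "\<lambda>y. momentum_flux F (H y) (Q y)"
          and w = "\<lambda>y. H y - \<bar>Q y\<bar> * Q y / (H y)\<^sup>2"
          and p' = "\<lambda>y. (H y / F\<^sup>2 - q\<^sup>2 / (H y)\<^sup>2) * deriv H y", OF R(1) _ _ _ _ _ weak])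
      show "continuous_on {z - R<..<z + R} (\<lambda>y. momentum_flux F (H y) (Q y))"
        "continuous_on {z - R<..<z + R} (\<lambda>y. H y - \<bar>Q y\<bar> * Q y / (H y)\<^sup>2)"
        "continuous_on {z - R<..<z + R} (\<lambda>y. (H y / F\<^sup>2 - q\<^sup>2 / (H y)\<^sup>2) * deriv H y)"
        unfolding momentum_flux_def using contI Hpos F_pos
        by (auto intro!: continuous_intros simp: less_imp_neq[THEN not_sym])
      fix y assume y: "y \<in> {z - R<..<z + R}"
      have "((\<lambda>y. q\<^sup>2 / H y + (H y)\<^sup>2 / (2 * F\<^sup>2) - q * c) has_real_derivative
              (H y / F\<^sup>2 - q\<^sup>2 / (H y)\<^sup>2) * deriv H y) (at y)"
        by (rule DERIV_chain2[OF DERIV_momentum_flux[OF Hpos] HD(1)[OF y]])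
      then show "((\<lambda>y. momentum_flux F (H y) (Q y) - c * Q y) has_real_derivative
              (H y / F\<^sup>2 - q\<^sup>2 / (H y)\<^sup>2) * deriv H y) (at y)"
        by (rule has_field_derivative_transform_within_open[where S = "{z - R<..<z + R}"])
          (use y Qy momentum_flux_relative[OF Hpos] in auto)
    qed (use contI in auto)
    then have "(H z / F\<^sup>2 - q\<^sup>2 / (H z)\<^sup>2) * deriv H z = H z - (c * H z - q)\<^sup>2 / (H z)\<^sup>2"
      using Qpos[of z] Qy[of z] R(1) by (simp add: power2_eq_square)
    then have "deriv H z = slope F HL HR (H z)"
      using slope_iff[OF Hpos nonsonic[OF contS[OF z]]] by simp
    then show ?thesis using HD(1)[of z] R(1) by simp
  qed
  have ode: "(H has_real_derivative slope F HL HR (H z)) (at z)" if "isCont H z" "isCont Q z" for z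
  proof (rule DERIV_of_limit_of_derivative[OF that(1)])
    show "\<forall>\<^sub>F y in at z. (H has_real_derivative slope F HL HR (H y)) (at y)"
      using eventually_notin_locally_finite[OF S, of z] by eventually_elim (rule ode_S)
    show "((\<lambda>y. slope F HL HR (H y)) \<longlongrightarrow> slope F HL HR (H z)) (at z)"
      using isCont_tendsto_compose[OF continuous_slope[OF Hpos nonsonic[OF that]]] that(1)
      unfolding isCont_def by blast
  qed
  have jump: "\<exists>h1 h2. (H \<longlongrightarrow> h1) (at_left z) \<and> (H \<longlongrightarrow> h2) (at_right z) \<and>
         h2 < HS \<and> HS < h1 \<and> h1 * h2 * (h1 + h2) = 2 * HS ^ 3" if "z \<in> jumps H Q" for z
  proof -
    have "lax_shock_at F c H Q z"
      using P that unfolding traveling_wave_profile_def jumps_def s by blast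
    then obtain h1 q1 h2 q2 where lims:
      "(H \<longlongrightarrow> h1) (at_left z)" "(Q \<longlongrightarrow> q1) (at_left z)"
      "(H \<longlongrightarrow> h2) (at_right z)" "(Q \<longlongrightarrow> q2) (at_right z)"
      and rh: "rankine_hugoniot F c h1 q1 h2 q2" and lax: "lax_condition F c h1 q1 h2 q2"
      unfolding lax_shock_at_def by blast
    have pos: "h1 > 0" "h2 > 0"
      using P lims unfolding traveling_wave_profile_def one_sided_state_def by blast+
    have ev: "\<forall>\<^sub>F y in at z. c * H y - q = Q y"
      using eventually_notin_locally_finite[OF S, of z]
      by eventually_elim (use flow contS in auto)
    then have "\<forall>\<^sub>F y in at_left z. c * H y - q = Q y" "\<forall>\<^sub>F y in at_right z. c * H y - q = Q y"
      by (auto simp: eventually_at_split)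
    then have "(Q \<longlongrightarrow> c * h1 - q) (at_left z)" "(Q \<longlongrightarrow> c * h2 - q) (at_right z)"
      by (auto intro!: Lim_transform_eventually[where f = "\<lambda>y. c * H y - q"] tendsto_intros lims)
    then have q12: "q1 = c * h1 - q" "q2 = c * h2 - q"
      using lims(2,4) by (auto intro: tendsto_unique[rotated])
    have "h2 < HS \<and> HS < h1"
      using lax lax_condition_iff[OF pos] unfolding q12 by blast
    moreover from this have "h1 * h2 * (h1 + h2) = 2 * HS ^ 3"
      using rh rankine_hugoniot_iff[OF pos] unfolding q12 by force
    ultimately show ?thesis using lims by blast
  qed
  have "HL \<noteq> HS" "HR \<noteq> HS"
    using nc noncharacteristic_iff[OF HL_pos] noncharacteristic_iff[OF HR_pos]
    unfolding noncharacteristic_def s equilibrium_endstates by blast+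
  moreover have "(H \<longlongrightarrow> HL) at_bot" "(H \<longlongrightarrow> HR) at_top"
    using P unfolding traveling_wave_profile_def by blast+
  ultimately show ?thesis
    unfolding piecewise_orbit_def
    using fin above nonsonic ode jump by (auto simp: jumps_def)
qed

lemma sonic_denominator_sign: "H0 < h \<Longrightarrow> h \<noteq> HS \<Longrightarrow> h ^ 3 - HS ^ 3 > 0 \<longleftrightarrow> HS < h"
  "H0 < h \<Longrightarrow> h \<noteq> HS \<Longrightarrow> h ^ 3 - HS ^ 3 < 0 \<longleftrightarrow> h < HS"
  using cube_HS_iff[of h] H0_bounds by auto

lemma slope_sign_iff:
  assumes "H0 < h" "h \<noteq> HS"
  shows "0 < slope F HL HR h \<longleftrightarrow> 0 < (h - HL) * (h - HR) * (h - HS)"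
    and "slope F HL HR h < 0 \<longleftrightarrow> (h - HL) * (h - HR) * (h - HS) < 0"
proof -
  define X where "X = (h - HL) * (h - HR)"
  define Y where "Y = h ^ 3 - HS ^ 3"
  define K where "K = F\<^sup>2 * (h - H0)"
  have K: "K > 0" using assms F_pos by (simp add: K_def)
  have slope: "slope F HL HR h = K * (X / Y)"
    by (simp add: slope_def X_def Y_def K_def)
  have Y: "(0 < Y \<longleftrightarrow> 0 < h - HS) \<and> (Y < 0 \<longleftrightarrow> h - HS < 0)"
    using sonic_denominator_sign[OF assms] by (simp add: Y_def)
  have sgn: "0 < K * (X / Y) \<longleftrightarrow> 0 < X / Y" "K * (X / Y) < 0 \<longleftrightarrow> X / Y < 0"
    using K by (auto simp only: zero_less_mult_iff mult_less_0_iff)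
  show "0 < slope F HL HR h \<longleftrightarrow> 0 < (h - HL) * (h - HR) * (h - HS)"
    unfolding slope sgn X_def[symmetric] using Y
    by (auto simp: zero_less_mult_iff zero_less_divide_iff)
  show "slope F HL HR h < 0 \<longleftrightarrow> (h - HL) * (h - HR) * (h - HS) < 0"
    unfolding slope sgn X_def[symmetric] using Y
    by (auto simp: mult_less_0_iff divide_less_0_iff)
qed

lemma smooth_on_orbit:
  assumes T: "open T"
    and ode: "\<And>z. z \<in> T \<Longrightarrow> 0 < H z \<and> H z \<noteq> HS \<and> (H has_real_derivative slope F HL HR (H z)) (at z)"
  shows "smooth_on T H" and "smooth_on T (\<lambda>z. c * H z - q)"
proof -
  define P where "P = smult (F\<^sup>2) ([:- HL, 1:] * [:- HR, 1:] * [:- H0, 1:])"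
  define D where "D = [:- (HS ^ 3), 0, 0, 1:]"
  have eq: "slope F HL HR h = poly P h / poly D h" for h
    by (simp add: slope_def P_def D_def power3_eq_cube algebra_simps)
  have ne: "poly D (H z) \<noteq> 0" if "z \<in> T" for z
    using cube_HS_iff(3)[of "H z"] ode[OF that] by (simp add: D_def power3_eq_cube)
  note sm = smooth_on_poly_of_rational_ode[OF T, of D H P, OF ne, folded eq]
  show "smooth_on T H"
    using sm[of "[:0, 1:]"] ode by simp
  show "smooth_on T (\<lambda>z. c * H z - q)"
    using sm[of "[:- q, c:]"] ode by (simp add: mult.commute)
qed

text \<open>
  The distance to an equilibrium \<open>e\<close> solves a linear equation, because the right-hand side contains the
  factor \<open>h - e\<close>.
\<close>

lemma endstate_reached_or_never:
  assumes I: "is_interval I"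
    and ode: "\<And>z. z \<in> I \<Longrightarrow> H0 < H z \<and> H z \<noteq> HS \<and> (H has_real_derivative slope F HL HR (H z)) (at z)"
    and e: "e = HL \<or> e = HR" and z: "z0 \<in> I" "H z0 = e" "z \<in> I"
  shows "H z = e"
proof -
  define e' where "e' = (if e = HL then HR else HL)"
  define m where "m z = F\<^sup>2 * ((H z - e') * (H z - H0)) / (H z ^ 3 - HS ^ 3)" for z
  have "slope F HL HR (H z) = m z * (H z - e)" for z
    using e HL_ne_HR by (auto simp: slope_def m_def e'_def)
  then have "((\<lambda>z. H z - e) has_real_derivative m z * (H z - e)) (at z)" if "z \<in> I" for z
    using ode[OF that] by (auto intro!: derivative_eq_intros)
  moreover have "continuous_on I m"
  proof -
    have "continuous_on I H"
      using ode by (auto intro!: continuous_at_imp_continuous_on DERIV_isCont)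
    moreover have "H z ^ 3 - HS ^ 3 \<noteq> 0" if "z \<in> I" for z
      using ode[OF that] cube_HS_iff(3)[of "H z"] H0_bounds by auto
    ultimately show ?thesis unfolding m_def by (auto intro!: continuous_intros)
  qed
  ultimately have "H z - e = 0"
    using linear_ode_zero_or_never[OF I, of "\<lambda>z. H z - e" m z0 z] z by simp
  then show ?thesis by simp
qed

lemma orbit_facts:
  assumes P: "piecewise_orbit H J" and I: "is_interval I" "I \<inter> J = {}"
  shows "\<And>z. z \<in> I \<Longrightarrow> H0 < H z \<and> H z \<noteq> HS \<and> (H has_real_derivative slope F HL HR (H z)) (at z)"
    and "continuous_on I H"
    and "\<And>x y. x \<in> I \<Longrightarrow> y \<in> I \<Longrightarrow> H x < HS \<longleftrightarrow> H y < HS"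
proof -
  show ode: "H0 < H z \<and> H z \<noteq> HS \<and> (H has_real_derivative slope F HL HR (H z)) (at z)" if "z \<in> I" for z
    using P that I(2) unfolding piecewise_orbit_def by blast
  show cont: "continuous_on I H"
    using ode by (auto intro!: continuous_at_imp_continuous_on DERIV_isCont)
  show "H x < HS \<longleftrightarrow> H y < HS" if "x \<in> I" "y \<in> I" for x y
    using stays_below[OF I(1) cont _ that, of HS] ode by blast
qed

text \<open>
  Just after a jump \<open>H\<close> is below \<open>Hs\<close>, and just before the next jump it is above.  In between it is
  continuous and never equal to \<open>Hs\<close>.
\<close>

lemma at_most_one_jump:
  assumes P: "piecewise_orbit H J" and d: "d1 \<in> J" "d2 \<in> J"
  shows "d1 = d2"
proof -
  have "\<not> d1 < d2" if d: "d1 \<in> J" "d2 \<in> J" for d1 d2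
  proof
    assume less: "d1 < d2"
    define K where "K = J \<inter> {d1<..d2}"
    have "finite (J \<inter> {d1..d2})"
      using P unfolding piecewise_orbit_def by blast
    then have K: "finite K" "d2 \<in> K"
      using d less by (auto simp: K_def intro: finite_subset[of _ "J \<inter> {d1..d2}"])
    \<comment> \<open>The first jump after \<open>d1\<close>.\<close>
    define d where "d = Min K"
    have "d \<in> K" using K unfolding d_def by (intro Min_in) auto
    then have d: "d \<in> J" "d1 < d" "d \<le> d2" by (auto simp: K_def)
    have "{d1<..<d} \<inter> J = {}"
    proof (rule ccontr)
      assume "{d1<..<d} \<inter> J \<noteq> {}"
      then obtain x where x: "d1 < x" "x < d" "x \<in> J" by auto
      then have "x \<in> K" using d(3) by (simp add: K_def)
      then have "d \<le> x" unfolding d_def using K(1) by simp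
      then show False using x by simp
    qed
    note same = orbit_facts(3)[OF P _ this]
    obtain h2 where h2: "(H \<longlongrightarrow> h2) (at_right d1)" "h2 < HS"
      using P \<open>d1 \<in> J\<close> unfolding piecewise_orbit_def by blast
    obtain h1 where h1: "(H \<longlongrightarrow> h1) (at_left d)" "HS < h1"
      using P d(1) unfolding piecewise_orbit_def by blast
    have "\<forall>\<^sub>F x in at_right d1. H x < HS \<and> x \<in> {d1<..<d}"
      using order_tendstoD(2)[OF h2] eventually_at_right_real[OF d(2)] by eventually_elim auto
    then obtain x where "H x < HS" "x \<in> {d1<..<d}"
      using eventually_happens[of _ "at_right d1"] by (auto simp: trivial_limit_at_right_real)
    moreover have "\<forall>\<^sub>F x in at_left d. HS < H x \<and> x \<in> {d1<..<d}"
      using order_tendstoD(1)[OF h1] eventually_at_left_real[OF d(2)] by eventually_elim auto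
    then obtain y where "HS < H y" "y \<in> {d1<..<d}"
      using eventually_happens[of _ "at_left d"] by (auto simp: trivial_limit_at_left_real)
    ultimately show False
      using same[of x y] by (auto simp: is_interval_oo)
  qed
  from this[OF d] this[OF d(2,1)] show ?thesis by simp
qed

text \<open>
  Below \<open>Hs\<close>, the right-hand side is positive between the endstates; above \<open>Hs\<close>, it is negative.  The
  order of the limits selects the side, and the whole range, together with its limits, lies on that
  side.
\<close>

lemma smooth_orbit:
  assumes P: "piecewise_orbit H {}"
  shows "HL < HR \<Longrightarrow> HR < HS \<and> strict_mono H"
    and "HR < HL \<Longrightarrow> HS < HR \<and> strict_antimono_on UNIV H"
proof -
  note O = orbit_facts[OF P is_interval_univ, simplified]
  have ode: "H0 < H z" "H z \<noteq> HS" "(H has_real_derivative slope F HL HR (H z)) (at z)" for z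
    using O(1) by blast+
  have lims: "(H \<longlongrightarrow> HL) at_bot" "(H \<longlongrightarrow> HR) at_top" and ne: "HR \<noteq> HS" "HL \<noteq> HS"
    using P unfolding piecewise_orbit_def by blast+
  have never: "H z \<noteq> HL" "H z \<noteq> HR" for z
  proof -
    have False if "e = HL \<or> e = HR" "H z = e" for e
    proof -
      have "H y = e" for y
        using endstate_reached_or_never[OF is_interval_univ, of H e z y] O(1) that by blast
      then have "H = (\<lambda>_. e)" by blast
      then have "e = HL" "e = HR"
        using lims by (simp_all add: tendsto_const_iff)
      then show False using HL_ne_HR by simp
    qed
    then show "H z \<noteq> HL" "H z \<noteq> HR" by blast+
  qed
  have side: "H x < e \<longleftrightarrow> H y < e" if "e = HL \<or> e = HR" for e x y
    using stays_below[OF is_interval_univ O(2), of e x y] never that by auto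
  have all_le: "HL \<le> v \<and> HR \<le> v" if "\<And>z. H z \<le> v" for v
    using tendsto_upperbound[OF lims(1), of v] tendsto_upperbound[OF lims(2), of v] that by simp
  have all_ge: "v \<le> HL \<and> v \<le> HR" if "\<And>z. v \<le> H z" for v
    using tendsto_lowerbound[OF lims(1), of v] tendsto_lowerbound[OF lims(2), of v] that by simp
  have between: "min HL HR < H z \<and> H z < max HL HR" for z
  proof -
    have "\<not> H z < min HL HR"
    proof
      assume "H z < min HL HR"
      then have "H y < min HL HR" for y
        using side[of HL z y] side[of HR z y] by (simp add: min_def split: if_splits)
      then have "HL \<le> min HL HR \<and> HR \<le> min HL HR" by (intro all_le) (simp add: less_imp_le)
      then show False using HL_ne_HR by (simp add: min_def split: if_splits)
    qed
    moreover have "\<not> max HL HR < H z"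
    proof
      assume *: "max HL HR < H z"
      have "max HL HR < H y" for y
        using * side[of HL z y] side[of HR z y] never[of y] never[of z]
        by (simp add: max_def not_less split: if_splits)
      then have "max HL HR \<le> HL \<and> max HL HR \<le> HR" by (intro all_ge) (simp add: less_imp_le)
      then show False using HL_ne_HR by (simp add: max_def split: if_splits)
    qed
    ultimately show ?thesis using never[of z] by (auto simp: min_def max_def)
  qed
  have inc: "strict_mono H" if "\<And>z. 0 < slope F HL HR (H z)"
    by (rule strict_monoI, rule DERIV_pos_imp_increasing) (use ode(3) that in blast)+
  have dec: "strict_antimono_on UNIV H" if "\<And>z. slope F HL HR (H z) < 0"
    by (rule monotone_onI, rule DERIV_neg_imp_decreasing) (use ode(3) that in blast)+
  have mono_lims: "HL \<le> H 0 \<and> H 0 \<le> HR" if "strict_mono H"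
  proof -
    have "\<forall>\<^sub>F z in at_bot. H z \<le> H 0" "\<forall>\<^sub>F z in at_top. H 0 \<le> H z"
      using that unfolding eventually_at_bot_linorder eventually_at_top_linorder
      by (meson strict_mono_less_eq)+
    then show ?thesis
      using tendsto_upperbound[OF lims(1)] tendsto_lowerbound[OF lims(2)] by simp
  qed
  have anti_lims: "HR \<le> H 0 \<and> H 0 \<le> HL" if "strict_antimono_on UNIV H"
  proof -
    have *: "H y \<le> H x" if "x \<le> y" for x y
      using monotone_onD[OF \<open>strict_antimono_on UNIV H\<close>, of x y] that by (cases "x = y") auto
    have "\<forall>\<^sub>F z in at_bot. H 0 \<le> H z" "\<forall>\<^sub>F z in at_top. H z \<le> H 0"
      unfolding eventually_at_bot_linorder eventually_at_top_linorder using * by blast+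
    then show ?thesis
      using tendsto_lowerbound[OF lims(1)] tendsto_upperbound[OF lims(2)] by simp
  qed
  have prod: "(H z - HL) * (H z - HR) < 0" for z
    using between[of z] by (auto simp: mult_less_0_iff min_def max_def split: if_splits)
  have sub: "HR < HS \<and> strict_mono H" if "H 0 < HS"
  proof -
    have below: "H z < HS" for z using O(3)[of 0 z] that by simp
    have "0 < slope F HL HR (H z)" for z
      unfolding slope_sign_iff(1)[OF ode(1,2)] using prod[of z] below[of z] by (simp add: mult_neg_neg)
    moreover have "HR \<le> HS" using all_le[of HS] below by (simp add: less_imp_le)
    ultimately show ?thesis using inc ne by simp
  qed
  have super: "HS < HR \<and> strict_antimono_on UNIV H" if "\<not> H 0 < HS"
  proof -
    have above: "HS < H z" for z using O(3)[of 0 z] that ode(2)[of z] by simp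
    have "slope F HL HR (H z) < 0" for z
      unfolding slope_sign_iff(2)[OF ode(1,2)] using prod[of z] above[of z] by (simp add: mult_neg_pos)
    moreover have "HS \<le> HR" using all_ge[of HS] above by (simp add: less_imp_le)
    ultimately show ?thesis using dec ne by simp
  qed
  show "HR < HS \<and> strict_mono H" if "HL < HR"
    using sub super anti_lims that by fastforce
  show "HS < HR \<and> strict_antimono_on UNIV H" if "HR < HL"
    using sub super mono_lims that by fastforce
qed

text \<open>
  Below \<open>Hs\<close>, the equation reads \<open>(H - HR)' = m (H - HR)\<close> with \<open>m \<ge> 0\<close>, so \<open>(H - HR)\<^sup>2\<close> is nondecreasing
  and can tend to zero only if it vanishes.  To the left of the jump, \<open>H > Hs\<close> leaves exactly the
  three possible positions relative to the equilibrium \<open>HL\<close>, on each of which the sign of the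
  right-hand side is known.
\<close>

lemma jump_orbit:
  assumes P: "piecewise_orbit H {d}"
  shows "HR < HS" "HS < HL" "HS < H1" "\<And>z. d < z \<Longrightarrow> H z = HR" "(H \<longlongrightarrow> H1) (at_left d)"
    "\<And>z. z < d \<Longrightarrow> HS < H z"
    and "(\<forall>z<d. H z = HL) \<and> H1 = HL \<or>
         strict_mono_on {..<d} H \<and> HL < H1 \<or>
         strict_antimono_on {..<d} H \<and> H1 < HL \<and> (\<forall>z<d. H1 < H z)"
proof -
  have lims: "(H \<longlongrightarrow> HL) at_bot" "(H \<longlongrightarrow> HR) at_top" and ne: "HR \<noteq> HS" "HL \<noteq> HS"
    using P unfolding piecewise_orbit_def by blast+
  obtain h1 h2 where h: "(H \<longlongrightarrow> h1) (at_left d)" "(H \<longlongrightarrow> h2) (at_right d)"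
    "h2 < HS" "HS < h1" "h1 * h2 * (h1 + h2) = 2 * HS ^ 3"
    using P unfolding piecewise_orbit_def by blast
  have disj: "{..<d} \<inter> {d} = {}" "{d<..} \<inter> {d} = {}" by auto
  have ints: "is_interval {..<d}" "is_interval {d<..}" by (auto simp: is_interval_1)
  note L = orbit_facts[OF P ints(1) disj(1)] and R = orbit_facts[OF P ints(2) disj(2)]
  have below: "H z < HS" if "d < z" for z
  proof -
    have "\<forall>\<^sub>F x in at_right d. H x < HS \<and> x \<in> {d<..<d + 1}"
      using order_tendstoD(2)[OF h(2,3)] eventually_at_right_real[of d "d + 1", simplified] by eventually_elim auto
    then obtain x where "H x < HS" "x \<in> {d<..<d + 1}"
      using eventually_happens[of _ "at_right d"] by (auto simp: trivial_limit_at_right_real)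
    then show ?thesis using R(3)[of x z] that by simp
  qed
  show above: "HS < H z" if "z < d" for z
  proof -
    have "\<forall>\<^sub>F x in at_left d. HS < H x \<and> x \<in> {d - 1<..<d}"
      using order_tendstoD(1)[OF h(1,4)] eventually_at_left_real[of "d - 1" d, simplified] by eventually_elim auto
    then obtain x where "HS < H x" "x \<in> {d - 1<..<d}"
      using eventually_happens[of _ "at_left d"] by (auto simp: trivial_limit_at_left_real)
    then show ?thesis using L(3)[of x z] L(1)[of z] that by simp
  qed
  have "\<forall>\<^sub>F z in at_top. H z \<le> HS"
    using eventually_gt_at_top[of d] by eventually_elim (use below in \<open>simp add: less_imp_le\<close>)
  then have "HR \<le> HS" using tendsto_upperbound[OF lims(2)] by simp
  then show HR: "HR < HS" using ne by simp
  have "\<forall>\<^sub>F z in at_bot. HS \<le> H z"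
    using eventually_gt_at_bot[of d] by eventually_elim (use above in \<open>simp add: less_imp_le\<close>)
  then have "HS \<le> HL" using tendsto_lowerbound[OF lims(1)] by simp
  then show HL: "HS < HL" using ne by simp
  show right: "H z = HR" if z: "d < z" for z
  proof (rule ccontr)
    \<comment> \<open>A deviation from the repelling equilibrium cannot shrink.\<close>
    assume neq: "H z \<noteq> HR"
    define m where "m y = F\<^sup>2 * ((H y - HL) * (H y - H0)) / (H y ^ 3 - HS ^ 3)" for y
    have m: "0 \<le> m y" if "d < y" for y
    proof -
      have "H0 < H y" "H y ^ 3 - HS ^ 3 < 0" "H y - HL < 0"
        using R(1)[of y] sonic_denominator_sign(2)[of "H y"] below[OF that] that HL by auto
      then show ?thesis unfolding m_def
        by (intro divide_nonpos_neg mult_nonneg_nonpos mult_nonpos_nonneg) auto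
    qed
    have D: "((\<lambda>y. (H y - HR)\<^sup>2) has_real_derivative 2 * m y * (H y - HR)\<^sup>2) (at y)" if "d < y" for y
    proof -
      have "slope F HL HR (H y) = m y * (H y - HR)" by (simp add: slope_def m_def)
      then show ?thesis
        using R(1)[of y] that by (auto intro!: derivative_eq_intros simp: power2_eq_square)
    qed
    have "(H z - HR)\<^sup>2 \<le> (H y - HR)\<^sup>2" if "z \<le> y" for y
    proof (rule DERIV_nonneg_imp_nondecreasing[OF that])
      fix x assume "z \<le> x"
      then have "d < x" using z by simp
      with D[OF this] m[OF this]
      show "\<exists>y. ((\<lambda>y. (H y - HR)\<^sup>2) has_real_derivative y) (at x) \<and> 0 \<le> y"
        by (intro exI[of _ "2 * m x * (H x - HR)\<^sup>2"]) simp
    qed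
    then have "\<forall>\<^sub>F y in at_top. (H z - HR)\<^sup>2 \<le> (H y - HR)\<^sup>2"
      unfolding eventually_at_top_linorder by blast
    moreover have "((\<lambda>y. (H y - HR)\<^sup>2) \<longlongrightarrow> (HR - HR)\<^sup>2) at_top"
      by (intro tendsto_intros lims)
    ultimately have "(H z - HR)\<^sup>2 \<le> (HR - HR)\<^sup>2"
      by (intro tendsto_lowerbound[of "\<lambda>y. (H y - HR)\<^sup>2" _ at_top]) simp_all
    then show False using neq by simp
  qed
  have "((\<lambda>_. HR) \<longlongrightarrow> h2) (at_right d)"
    by (rule Lim_transform_eventually[OF h(2)]) (use right in \<open>auto simp: eventually_at_filter\<close>)
  then have h2: "h2 = HR"
    by (simp add: tendsto_const_iff)
  have h1: "h1 = H1"
    using Hstar_less_iff(3)[of h1] h(4,5) HS_pos unfolding h2 by simp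
  show left: "(H \<longlongrightarrow> H1) (at_left d)" and HSH1: "HS < H1"
    using h h1 by simp_all
  show "(\<forall>z<d. H z = HL) \<and> H1 = HL \<or>
         strict_mono_on {..<d} H \<and> HL < H1 \<or>
         strict_antimono_on {..<d} H \<and> H1 < HL \<and> (\<forall>z<d. H1 < H z)"
  proof (cases "\<exists>z<d. H z = HL")
    case True
    then obtain z0 where z0: "z0 \<in> {..<d}" "H z0 = HL" by auto
    have const: "H z = HL" if "z < d" for z
      using endstate_reached_or_never[of "{..<d}" H HL z0 z, OF ints(1) L(1)] z0 that by simp
    have "((\<lambda>_. HL) \<longlongrightarrow> H1) (at_left d)"
      by (rule Lim_transform_eventually[OF left]) (use const in \<open>auto simp: eventually_at_filter\<close>)
    then have "H1 = HL" by (simp add: tendsto_const_iff)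
    then show ?thesis using const by blast
  next
    case False
    have side: "H x < HL \<longleftrightarrow> H y < HL" if "x < d" "y < d" for x y
      using stays_below[OF ints(1) L(2), of HL x y] False that by blast
    have der: "(H has_real_derivative slope F HL HR (H z)) (at z)" if "z < d" for z
      using L(1)[of z] that by simp
    have near: "\<forall>\<^sub>F x in at_left d. z < x \<and> x < d" if "z < d" for z
      using eventually_at_left_real[OF that] by eventually_elim auto
    show ?thesis
    proof (cases "H (d - 1) < HL")
      case True
      have lt: "H z < HL" if "z < d" for z using side[of "d - 1" z] True that by simp
      have neg: "slope F HL HR (H z) < 0" if "z < d" for z
        using slope_sign_iff(2)[of "H z"] L(1)[of z] lt[OF that] above[OF that] HR that
        by (simp add: mult_neg_pos)
      have dec: "H y < H x" if "x < y" "y < d" for x y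
        by (rule DERIV_neg_imp_decreasing[OF that(1)], rule exI, rule conjI, rule der, use that in simp)
          (rule neg, use that in simp)
      have H1le: "H1 \<le> H z" if "z < d" for z
        by (rule tendsto_upperbound[OF left eventually_mono[OF near[OF that]]])
          (use dec in \<open>auto simp: less_imp_le\<close>)
      have "H1 < H z" if "z < d" for z
        using H1le[of "(z + d) / 2"] dec[of z "(z + d) / 2"] that by simp
      moreover from this[of "d - 1"] have "H1 < HL" using lt[of "d - 1"] by simp
      ultimately show ?thesis using dec by (auto intro!: monotone_onI)
    next
      case gt: False
      have gt: "HL < H z" if "z < d" for z
      proof -
        have "\<not> H z < HL" using side[of "d - 1" z] gt that by simp
        moreover have "H z \<noteq> HL" using False that by blast
        ultimately show ?thesis by simp
      qed
      have pos: "0 < slope F HL HR (H z)" if "z < d" for z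
        using slope_sign_iff(1)[of "H z"] L(1)[of z] gt[OF that] above[OF that] HR that
        by simp
      have inc: "H x < H y" if "x < y" "y < d" for x y
        by (rule DERIV_pos_imp_increasing[OF that(1)], rule exI, rule conjI, rule der, use that in simp)
          (rule pos, use that in simp)
      have H1ge: "H z \<le> H1" if "z < d" for z
        by (rule tendsto_lowerbound[OF left eventually_mono[OF near[OF that]]])
          (use inc in \<open>auto simp: less_imp_le\<close>)
      have "HL < H1" using H1ge[of "d - 1"] gt[of "d - 1"] by simp
      then show ?thesis using inc by (auto intro!: monotone_onI)
    qed
  qed
qed

end

section \<open>Orbits of autonomous scalar equations\<close>

text \<open>
  Separation of variables: an antiderivative \<open>\<Phi>\<close> of \<open>1 / g\<close> is the time at which a height is passed, and
  the orbit is its inverse, shifted to pass \<open>x0\<close> at time zero.  Divergence of \<open>\<Phi>\<close> at \<open>\<alpha>\<close> makes the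
  orbit exist for all negative times; divergence at \<open>\<beta>\<close> as well makes it global.  The interval of
  existence always reaches some \<open>e > 0\<close>, which later provides one-sided limits of all derivatives.
\<close>

lemma increasing_orbit:
  fixes \<Phi> g :: "real \<Rightarrow> real"
  assumes x0: "\<alpha> < x0" "x0 < \<beta>"
    and D: "\<And>h. \<alpha> < h \<Longrightarrow> h < \<beta> \<Longrightarrow> 0 < g h \<and> (\<Phi> has_real_derivative 1 / g h) (at h)"
    and bot: "filterlim \<Phi> at_bot (at_right \<alpha>)"
  obtains f e where "0 < e" "f 0 = x0" "(f \<longlongrightarrow> \<alpha>) at_bot"
    "\<And>z. z < e \<Longrightarrow> \<alpha> < f z \<and> f z < \<beta> \<and> (f has_real_derivative g (f z)) (at z)"
    "filterlim \<Phi> at_top (at_left \<beta>) \<Longrightarrow> (f \<longlongrightarrow> \<beta>) at_top \<and>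
       (\<forall>z. \<alpha> < f z \<and> f z < \<beta> \<and> (f has_real_derivative g (f z)) (at z))"
proof -
  let ?I = "{\<alpha><..<\<beta>}"
  define \<Psi> where "\<Psi> h = \<Phi> h - \<Phi> x0" for h
  have D': "(\<Psi> has_real_derivative 1 / g h) (at h)" "0 < g h" if "h \<in> ?I" for h
    using D[of h] that unfolding \<Psi>_def by (auto intro!: derivative_eq_intros)
  have mono: "\<Psi> x < \<Psi> y" if "x \<in> ?I" "y \<in> ?I" "x < y" for x y
    by (rule DERIV_pos_imp_increasing[OF that(3)], rule exI, rule conjI, rule D', use that in simp)
      (use D'(2) that in simp)
  have mono_iff: "\<Psi> x < \<Psi> y \<longleftrightarrow> x < y" if "x \<in> ?I" "y \<in> ?I" for x y
    using mono[of x y] mono[of y x] that by (cases x y rule: linorder_cases) auto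
  then have inj: "inj_on \<Psi> ?I"
    by (intro linorder_inj_onI') (metis less_irrefl)
  define f where "f = the_inv_into ?I \<Psi>"
  have f\<Psi>: "f (\<Psi> h) = h" if "h \<in> ?I" for h
    unfolding f_def by (rule the_inv_into_f_f[OF inj that])
  have low: "\<exists>h\<in>?I. \<Psi> h < y \<and> h < a" if "\<alpha> < a" for y a
  proof -
    have "\<forall>\<^sub>F h in at_right \<alpha>. \<Phi> h < y + \<Phi> x0 \<and> h \<in> {\<alpha><..<min a \<beta>}"
      using filterlim_at_bot_dense[THEN iffD1, OF bot, rule_format, of "y + \<Phi> x0"]
        eventually_at_right_real[of \<alpha> "min a \<beta>"] that x0 by (auto intro: eventually_conj)
    then obtain h where "\<Phi> h < y + \<Phi> x0" "h \<in> {\<alpha><..<min a \<beta>}"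
      using eventually_happens[of _ "at_right \<alpha>"] by (auto simp: trivial_limit_at_right_real)
    then show ?thesis by (intro bexI[of _ h]) (auto simp: \<Psi>_def)
  qed
  have range: "y \<in> \<Psi> ` ?I" if "h \<in> ?I" and yh: "y \<le> \<Psi> h" for y h
  proof -
    obtain h' where h': "h' \<in> ?I" "\<Psi> h' < y" "h' < h" using low[of h y] \<open>h \<in> ?I\<close> by auto
    have "continuous_on {h'..h} \<Psi>"
      using that h' by (intro continuous_at_imp_continuous_on ballI DERIV_isCont[OF D'(1)]) auto
    then obtain x where "h' \<le> x" "x \<le> h" "\<Psi> x = y"
      using IVT'[of \<Psi> h' y h] yh h' by auto
    then show ?thesis using that h' by (intro image_eqI[of _ _ x]) auto
  qed
  have inv: "f y \<in> ?I \<and> \<Psi> (f y) = y \<and> (f has_real_derivative g (f y)) (at y)" if y: "y \<in> \<Psi> ` ?I" for y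
  proof -
    obtain h where h: "h \<in> ?I" "y = \<Psi> h" using y by blast
    define a b where "a = (\<alpha> + h) / 2" and "b = (h + \<beta>) / 2"
    have ab: "a \<in> ?I" "b \<in> ?I" "a < h" "h < b" using h by (auto simp: a_def b_def)
    have sub: "{a..b} \<subseteq> ?I" using ab by auto
    have "isCont f (\<Psi> h)"
      by (rule isCont_inverse_function2[OF ab(3,4)])
        (use sub f\<Psi> DERIV_isCont[OF D'(1)] in \<open>auto simp: subset_iff\<close>)
    moreover have "\<Psi> (f x) = x" if x: "\<Psi> a < x" "x < \<Psi> b" for x
      using range[OF ab(2), of x] x f\<Psi> by force
    moreover have "\<Psi> a < \<Psi> h" "\<Psi> h < \<Psi> b" using mono ab h by auto
    moreover have "(\<Psi> has_real_derivative 1 / g h) (at (f (\<Psi> h)))" "1 / g h \<noteq> 0"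
      using D'[OF h(1)] f\<Psi>[OF h(1)] by auto
    ultimately have "(f has_real_derivative inverse (1 / g h)) (at (\<Psi> h))"
      by (intro DERIV_inverse_function[where a = "\<Psi> a" and b = "\<Psi> b" and f = \<Psi>]) auto
    then show ?thesis using f\<Psi>[OF h(1)] h by simp
  qed
  define e where "e = \<Psi> ((x0 + \<beta>) / 2)"
  have mid: "(x0 + \<beta>) / 2 \<in> ?I" using x0 by auto
  have x0I: "x0 \<in> ?I" using x0 by auto
  have \<Psi>x0: "\<Psi> x0 = 0" by (simp add: \<Psi>_def)
  have e: "0 < e" using mono[OF x0I mid] x0 by (simp add: e_def \<Psi>x0)
  have limit: "(f \<longlongrightarrow> \<alpha>) at_bot"
  proof (rule order_tendstoI)
    fix a assume "a < \<alpha>"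
    have "\<forall>\<^sub>F z in at_bot. z < e" by (rule eventually_gt_at_bot)
    then show "\<forall>\<^sub>F z in at_bot. a < f z"
    proof eventually_elim
      case (elim z)
      then have "f z \<in> ?I" using inv[OF range[OF mid]] by (simp add: e_def)
      then show ?case using \<open>a < \<alpha>\<close> by simp
    qed
  next
    fix a assume "\<alpha> < a"
    then obtain h where h: "h \<in> ?I" "h < a" using low[of a 0] by blast
    have "\<forall>\<^sub>F z in at_bot. z < \<Psi> h" by (rule eventually_gt_at_bot)
    then show "\<forall>\<^sub>F z in at_bot. f z < a"
    proof eventually_elim
      case (elim z)
      then have "f z \<in> ?I" "\<Psi> (f z) < \<Psi> h" using inv[OF range[OF h(1), of z]] by auto
      then show ?case using mono_iff[of "f z" h] h by simp
    qed
  qed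
  show thesis
  proof (rule that[OF e _ limit])
    show "f 0 = x0" using f\<Psi>[OF x0I] \<Psi>x0 by simp
    show "\<alpha> < f z \<and> f z < \<beta> \<and> (f has_real_derivative g (f z)) (at z)" if "z < e" for z
      using inv[OF range[OF mid, of z]] that by (auto simp: e_def)
    assume top: "filterlim \<Phi> at_top (at_left \<beta>)"
    have high: "\<exists>h\<in>?I. y < \<Psi> h \<and> a < h" if "a < \<beta>" for y a
    proof -
      have "\<forall>\<^sub>F h in at_left \<beta>. y + \<Phi> x0 < \<Phi> h \<and> h \<in> {max a \<alpha><..<\<beta>}"
        using filterlim_at_top_dense[THEN iffD1, OF top, rule_format, of "y + \<Phi> x0"]
          eventually_at_left_real[of "max a \<alpha>" \<beta>] that x0 by (auto intro: eventually_conj)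
      then obtain h where "y + \<Phi> x0 < \<Phi> h" "h \<in> {max a \<alpha><..<\<beta>}"
        using eventually_happens[of _ "at_left \<beta>"] by (auto simp: trivial_limit_at_left_real)
      then show ?thesis by (intro bexI[of _ h]) (auto simp: \<Psi>_def)
    qed
    have all: "y \<in> \<Psi> ` ?I" for y
    proof -
      obtain h where "h \<in> ?I" "y < \<Psi> h" using high[of x0 y] x0 by blast
      then show ?thesis by (intro range[of h]) auto
    qed
    have "(f \<longlongrightarrow> \<beta>) at_top"
    proof (rule order_tendstoI)
      fix a assume "\<beta> < a"
      then have "f z < a" for z using inv[OF all, of z] by auto
      then show "\<forall>\<^sub>F z in at_top. f z < a" by simp
    next
      fix a assume "a < \<beta>"
      then obtain h where h: "h \<in> ?I" "a < h" using high[of a 0] by blast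
      have "\<forall>\<^sub>F z in at_top. \<Psi> h < z" by (rule eventually_gt_at_top)
      then show "\<forall>\<^sub>F z in at_top. a < f z"
      proof eventually_elim
        case (elim z)
        then have "f z \<in> ?I" "\<Psi> h < \<Psi> (f z)" using inv[OF all, of z] by auto
        then show ?case using mono_iff[of h "f z"] h by simp
      qed
    qed
    then show "(f \<longlongrightarrow> \<beta>) at_top \<and>
       (\<forall>z. \<alpha> < f z \<and> f z < \<beta> \<and> (f has_real_derivative g (f z)) (at z))"
      using inv[OF all] by auto
  qed
qed

text \<open>
  The reflection \<open>h \<mapsto> - h\<close> of the increasing case.
\<close>

lemma decreasing_orbit:
  fixes \<Phi> g :: "real \<Rightarrow> real"
  assumes x0: "\<alpha> < x0" "x0 < \<beta>"
    and D: "\<And>h. \<alpha> < h \<Longrightarrow> h < \<beta> \<Longrightarrow> g h < 0 \<and> (\<Phi> has_real_derivative 1 / g h) (at h)"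
    and bot: "filterlim \<Phi> at_bot (at_left \<beta>)"
  obtains f e where "0 < e" "f 0 = x0" "(f \<longlongrightarrow> \<beta>) at_bot"
    "\<And>z. z < e \<Longrightarrow> \<alpha> < f z \<and> f z < \<beta> \<and> (f has_real_derivative g (f z)) (at z)"
    "filterlim \<Phi> at_top (at_right \<alpha>) \<Longrightarrow> (f \<longlongrightarrow> \<alpha>) at_top \<and>
       (\<forall>z. \<alpha> < f z \<and> f z < \<beta> \<and> (f has_real_derivative g (f z)) (at z))"
proof -
  let ?\<Phi> = "\<lambda>h. \<Phi> (- h)" and ?g = "\<lambda>h. - g (- h)"
  have D': "0 < ?g h \<and> (?\<Phi> has_real_derivative 1 / ?g h) (at h)" if "- \<beta> < h" "h < - \<alpha>" for h
  proof -
    have neg: "g (- h) < 0" and d: "(\<Phi> has_real_derivative 1 / g (- h)) (at (- h))"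
      using D[of "- h"] that by auto
    have m: "(uminus has_real_derivative -1) (at h)"
      by (auto intro!: derivative_eq_intros)
    show ?thesis
      using DERIV_chain2[where f = \<Phi> and g = uminus and x = h, OF d m] neg by simp
  qed
  have bot': "filterlim ?\<Phi> at_bot (at_right (- \<beta>))"
    using bot by (simp add: filterlim_at_left_to_right)
  have x0': "- \<beta> < - x0" "- x0 < - \<alpha>" using x0 by auto
  obtain f e where f: "0 < e" "f 0 = - x0" "(f \<longlongrightarrow> - \<beta>) at_bot"
    "\<And>z. z < e \<Longrightarrow> - \<beta> < f z \<and> f z < - \<alpha> \<and> (f has_real_derivative ?g (f z)) (at z)"
    "filterlim ?\<Phi> at_top (at_left (- \<alpha>)) \<Longrightarrow> (f \<longlongrightarrow> - \<alpha>) at_top \<and>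
       (\<forall>z. - \<beta> < f z \<and> f z < - \<alpha> \<and> (f has_real_derivative ?g (f z)) (at z))"
    by (rule increasing_orbit[where g = ?g and \<Phi> = ?\<Phi>, OF x0' D' bot'], assumption, assumption)
      (rule that, assumption+)
  have neg: "\<alpha> < - f z \<and> - f z < \<beta> \<and> ((\<lambda>z. - f z) has_real_derivative g (- f z)) (at z)"
    if "- \<beta> < f z \<and> f z < - \<alpha> \<and> (f has_real_derivative ?g (f z)) (at z)" for z
    using that by (auto intro!: derivative_eq_intros)
  show thesis
  proof (rule that[of e "\<lambda>z. - f z"])
    show "0 < e" "- f 0 = x0" using f by auto
    show "((\<lambda>z. - f z) \<longlongrightarrow> \<beta>) at_bot" using tendsto_minus[OF f(3)] by simp
    show "\<alpha> < - f z \<and> - f z < \<beta> \<and> ((\<lambda>z. - f z) has_real_derivative g (- f z)) (at z)" if "z < e" for z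
      by (rule neg[OF f(4)[OF that]])
    assume "filterlim \<Phi> at_top (at_right \<alpha>)"
    then have "filterlim ?\<Phi> at_top (at_left (- \<alpha>))"
      by (simp add: filterlim_at_left_to_right)
    from f(5)[OF this] show "((\<lambda>z. - f z) \<longlongrightarrow> \<alpha>) at_top \<and>
       (\<forall>z. \<alpha> < - f z \<and> - f z < \<beta> \<and> ((\<lambda>z. - f z) has_real_derivative g (- f z)) (at z))"
      using neg tendsto_minus[of f "- \<alpha>" at_top] by auto
  qed
qed

lemma partial_fractions:
  fixes a b e h K :: real
  assumes "a \<noteq> b" "a \<noteq> e" "b \<noteq> e" "h \<noteq> a" "h \<noteq> b" "h \<noteq> e"
  shows "1 + (a ^ 3 - K) / ((a - b) * (a - e)) / (h - a)
           + (b ^ 3 - K) / ((b - a) * (b - e)) / (h - b)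
           + (e ^ 3 - K) / ((e - a) * (e - b)) / (h - e)
         = (h ^ 3 - K) / ((h - a) * (h - b) * (h - e))"
proof -
  define u v w where "u = a - b" and "v = a - e" and "w = b - e"
  have ne: "u \<noteq> 0" "v \<noteq> 0" "w \<noteq> 0" "h - a \<noteq> 0" "h - b \<noteq> 0" "h - e \<noteq> 0"
    using assms by (auto simp: u_def v_def w_def)
  have "b - a = - u" "e - a = - v" "e - b = - w" by (auto simp: u_def v_def w_def)
  note * = this u_def[symmetric] v_def[symmetric] w_def[symmetric]
  define x y z where "x = h - a" and "y = h - b" and "z = h - e"
  have ne': "x \<noteq> 0" "y \<noteq> 0" "z \<noteq> 0" using ne by (auto simp: x_def y_def z_def)
  have "u * v * w * (x * y * z) + (a ^ 3 - K) * w * y * z - (b ^ 3 - K) * v * x * z + (e ^ 3 - K) * u * x * y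
      = (h ^ 3 - K) * (u * v * w)"
    unfolding u_def v_def w_def x_def y_def z_def by algebra
  moreover have "1 + (a ^ 3 - K) / (u * v) / x + (b ^ 3 - K) / (- u * w) / y + (e ^ 3 - K) / ((- v) * (- w)) / z
     = (u * v * w * (x * y * z) + (a ^ 3 - K) * w * y * z - (b ^ 3 - K) * v * x * z + (e ^ 3 - K) * u * x * y)
         / (u * v * w * (x * y * z))"
    using ne(1-3) ne' by (simp add: field_simps)
  ultimately show ?thesis
    using ne(1-3) ne' unfolding * x_def[symmetric] y_def[symmetric] z_def[symmetric] by simp
qed

text \<open>
  Here the real logarithm is even: \<open>ln\<close> of a negative number is the logarithm of its modulus.
\<close>

lemma DERIV_ln_nonzero:
  fixes x :: real
  assumes "x \<noteq> 0" shows "(ln has_real_derivative 1 / x) (at x)"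
proof (cases "x > 0")
  case True
  then show ?thesis by (rule DERIV_ln_divide)
next
  case False
  have "((\<lambda>x. ln (- x)) has_real_derivative 1 / x) (at x)"
    using False assms by (auto intro!: derivative_eq_intros simp: field_simps)
  then show ?thesis unfolding ln_minus .
qed

lemma filterlim_ln_at_bot: "filterlim (\<lambda>h. ln (h - a)) at_bot (at (a::real))"
proof -
  have R: "filterlim (\<lambda>h. ln (h - a)) at_bot (at_right a)"
    using ln_at_0 by (simp add: filterlim_at_right_to_0[of _ _ a])
  have "filterlim (\<lambda>x. ln (- (x + - a) - a)) at_bot (at_right 0)"
    using ln_at_0 by (simp add: ln_minus)
  then have "filterlim (\<lambda>h. ln (h - a)) at_bot (at_left a)"
    unfolding filterlim_at_left_to_right[of _ _ a] filterlim_at_right_to_0[of _ _ "- a"] .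
  with R show ?thesis by (simp add: filterlim_split_at)
qed

context endstates
begin

text \<open>
  The residue of \<open>(h\<^sup>3 - Hs\<^sup>3) / ((h - x) (h - y) (h - z))\<close> at \<open>x\<close>.
\<close>

definition residue_at :: "real \<Rightarrow> real \<Rightarrow> real \<Rightarrow> real" where
  "residue_at x y z = (x ^ 3 - HS ^ 3) / ((x - y) * (x - z))"

text \<open>
  An antiderivative of the reciprocal of the slope, obtained by partial fractions.
\<close>

definition travel_time :: "real \<Rightarrow> real" where
  "travel_time h = (h + residue_at HL HR H0 * ln (h - HL) + residue_at HR HL H0 * ln (h - HR)
                      + residue_at H0 HL HR * ln (h - H0)) / F\<^sup>2"

lemma DERIV_travel_time:
  assumes "H0 < h" "h \<noteq> HL" "h \<noteq> HR"
  shows "(travel_time has_real_derivative 1 / slope F HL HR h) (at h)"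
proof -
  have ln: "((\<lambda>h. k * ln (h - a)) has_real_derivative k / (h - a)) (at h)" if "h \<noteq> a" for a k
  proof -
    have "((\<lambda>h. h - a) has_real_derivative 1) (at h)" by (auto intro!: derivative_eq_intros)
    from DERIV_cmult[OF DERIV_chain2[OF DERIV_ln_nonzero this], of k] that show ?thesis by simp
  qed
  have "(travel_time has_real_derivative
          (1 + residue_at HL HR H0 / (h - HL) + residue_at HR HL H0 / (h - HR) + residue_at H0 HL HR / (h - H0)) / F\<^sup>2) (at h)"
    unfolding travel_time_def[abs_def]
    by (rule DERIV_cdivide DERIV_add DERIV_ident ln assms assms(1)[THEN less_imp_neq, symmetric])+
  also have "1 + residue_at HL HR H0 / (h - HL) + residue_at HR HL H0 / (h - HR) + residue_at H0 HL HR / (h - H0)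
     = (h ^ 3 - HS ^ 3) / ((h - HL) * (h - HR) * (h - H0))"
    unfolding residue_at_def
    by (rule partial_fractions) (use assms HL_ne_HR H0_bounds in auto)
  finally show ?thesis by (simp add: slope_def mult.commute)
qed

text \<open>
  The hypothesis says that \<open>HL\<close> is a repelling equilibrium: it makes the coefficient of the logarithm
  positive.
\<close>

lemma travel_time_at_HL:
  assumes "0 < (HL - HS) * (HL - HR)"
  shows "filterlim travel_time at_bot (at HL)"
proof -
  have "0 < residue_at HL HR H0"
  proof (cases "HR < HL")
    case True
    then have "HS < HL" using assms by (simp add: zero_less_mult_iff)
    then show ?thesis
      unfolding residue_at_def using True H0_bounds cube_HS_iff(2)[OF HL_pos]
      by (intro divide_pos_pos mult_pos_pos) auto
  next
    case False
    then have "HL < HR" "HL < HS" using assms by (auto simp: zero_less_mult_iff)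
    then show ?thesis
      unfolding residue_at_def using H0_bounds cube_HS_iff(1)[OF HL_pos]
      by (intro divide_neg_neg mult_neg_pos) auto
  qed
  from filterlim_tendsto_pos_mult_at_bot[OF tendsto_const this filterlim_ln_at_bot]
  have 1: "filterlim (\<lambda>h. residue_at HL HR H0 * ln (h - HL)) at_bot (at HL)" .
  have "((\<lambda>h. h + residue_at HR HL H0 * ln (h - HR) + residue_at H0 HL HR * ln (h - H0))
     \<longlongrightarrow> HL + residue_at HR HL H0 * ln (HL - HR) + residue_at H0 HL HR * ln (HL - H0)) (at HL)"
    using HL_ne_HR H0_bounds by (intro tendsto_intros) auto
  from filterlim_tendsto_add_at_bot_iff[OF this, THEN iffD2, OF 1]
  have "filterlim (\<lambda>h. 1 / F\<^sup>2 * (h + residue_at HR HL H0 * ln (h - HR) + residue_at H0 HL HR * ln (h - H0)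
            + residue_at HL HR H0 * ln (h - HL))) at_bot (at HL)"
    using F_pos by (intro filterlim_tendsto_pos_mult_at_bot[OF tendsto_const]) auto
  moreover have "travel_time = (\<lambda>h. 1 / F\<^sup>2 * (h + residue_at HR HL H0 * ln (h - HR) + residue_at H0 HL HR * ln (h - H0)
            + residue_at HL HR H0 * ln (h - HL)))"
    by (simp add: fun_eq_iff travel_time_def add.assoc add.commute add.left_commute)
  ultimately show ?thesis by simp
qed

text \<open>
  The hypothesis says that \<open>HR\<close> is an attracting equilibrium.
\<close>

lemma travel_time_at_HR:
  assumes "0 < (HR - HS) * (HL - HR)"
  shows "filterlim travel_time at_top (at HR)"
proof -
  have "residue_at HR HL H0 < 0"
  proof (cases "HR < HL")
    case True
    then have "HS < HR" using assms by (simp add: zero_less_mult_iff)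
    then show ?thesis
      unfolding residue_at_def using True H0_bounds cube_HS_iff(2)[OF HR_pos]
      by (intro divide_pos_neg mult_neg_pos) auto
  next
    case False
    then have "HL < HR" "HR < HS" using assms by (auto simp: zero_less_mult_iff)
    then show ?thesis
      unfolding residue_at_def using H0_bounds cube_HS_iff(1)[OF HR_pos]
      by (intro divide_neg_pos mult_pos_pos) auto
  qed
  from filterlim_tendsto_neg_mult_at_top_iff[OF tendsto_const this, THEN iffD2, OF filterlim_ln_at_bot]
  have 1: "filterlim (\<lambda>h. residue_at HR HL H0 * ln (h - HR)) at_top (at HR)" .
  have "((\<lambda>h. h + residue_at HL HR H0 * ln (h - HL) + residue_at H0 HL HR * ln (h - H0))
     \<longlongrightarrow> HR + residue_at HL HR H0 * ln (HR - HL) + residue_at H0 HL HR * ln (HR - H0)) (at HR)"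
    using HL_ne_HR H0_bounds by (intro tendsto_intros) auto
  from filterlim_tendsto_add_at_top[OF this 1]
  have "filterlim (\<lambda>h. 1 / F\<^sup>2 * (h + residue_at HL HR H0 * ln (h - HL) + residue_at H0 HL HR * ln (h - H0)
            + residue_at HR HL H0 * ln (h - HR))) at_top (at HR)"
    using F_pos by (intro filterlim_tendsto_pos_mult_at_top[OF tendsto_const]) auto
  moreover have "travel_time = (\<lambda>h. 1 / F\<^sup>2 * (h + residue_at HL HR H0 * ln (h - HL) + residue_at H0 HL HR * ln (h - H0)
            + residue_at HR HL H0 * ln (h - HR)))"
    by (simp add: fun_eq_iff travel_time_def add.assoc add.commute add.left_commute)
  ultimately show ?thesis by simp
qed

end

section \<open>Profiles built from orbits\<close>

context endstates
begin

text \<open>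
  Both equations split into a transport part, in which \<open>\<phi>\<close> is differentiated along the wave, and a
  balance part with the flux in the moving frame.  The latter is constant for the mass equation and
  continuous, by hypothesis, for the momentum equation.
\<close>

lemma weak_solution_of_orbit:
  assumes bounds: "\<And>z. min HL HR \<le> H z \<and> H z \<le> M"
    and J: "finite J"
    and ode: "\<And>z. z \<notin> J \<Longrightarrow> H z \<noteq> HS \<and> (H has_real_derivative slope F HL HR (H z)) (at z)"
    and flux: "continuous_on UNIV (\<lambda>z. q\<^sup>2 / H z + (H z)\<^sup>2 / (2 * F\<^sup>2) - q * c)"
  shows "weak_solution F (\<lambda>t x. H (x - c * t)) (\<lambda>t x. c * H (x - c * t) - q)"
proof -
  define m where "m = min HL HR"
  have m: "m > 0" using HL_pos HR_pos by (simp add: m_def)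
  have Hpos: "0 < H z" and Hm: "H z \<in> {m..M}" for z
    using bounds[of z] m by (auto simp: m_def)
  have Qnn: "0 \<le> c * H z - q" for z
    using bounds[of z] by (intro nonneg_flow) simp
  define G where "G z = q\<^sup>2 / H z + (H z)\<^sup>2 / (2 * F\<^sup>2) - q * c" for z
  define g where "g z = H z - (c * H z - q)\<^sup>2 / (H z)\<^sup>2" for z
  have "continuous_on (- J) H"
    using ode by (auto intro!: continuous_at_imp_continuous_on DERIV_isCont)
  then have Hmeas: "H \<in> borel_measurable borel"
    by (rule borel_measurable_continuous_countable_exceptions[OF countable_finite[OF J]])
  have gmeas: "g \<in> borel_measurable borel"
    unfolding g_def using Hmeas by measurable
  have bounded: "\<exists>B. \<forall>z. \<bar>f (H z)\<bar> \<le> B" if "continuous_on {m..M} f" for f :: "real \<Rightarrow> real"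
  proof -
    have "bounded (f ` {m..M})"
      using that by (intro compact_imp_bounded compact_continuous_image) auto
    then show ?thesis using Hm unfolding bounded_iff by (metis image_eqI real_norm_def)
  qed
  have cont: "continuous_on {m..M} (\<lambda>h. q\<^sup>2 / h + h\<^sup>2 / (2 * F\<^sup>2) - q * c)"
    "continuous_on {m..M} (\<lambda>h. h - (c * h - q)\<^sup>2 / h\<^sup>2)"
    "continuous_on {m..M} (\<lambda>h. h)" "continuous_on {m..M} (\<lambda>h. c * h - q)"
    using m F_pos by (auto intro!: continuous_intros)
  obtain B1 where B1: "\<And>z. \<bar>G z\<bar> \<le> B1"
    using bounded[OF cont(1)] unfolding G_def by blast
  obtain B2 where B2: "\<And>z. \<bar>g z\<bar> \<le> B2"
    using bounded[OF cont(2)] unfolding g_def by blast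
  obtain B3 where B3: "\<And>z. \<bar>H z\<bar> \<le> B3"
    using bounded[OF cont(3)] by blast
  obtain B4 where B4: "\<And>z. \<bar>c * H z - q\<bar> \<le> B4"
    using bounded[OF cont(4)] by blast
  have Gg: "(G has_real_derivative g z) (at z)" if "z \<notin> J" for z
  proof -
    have "(G has_real_derivative (H z / F\<^sup>2 - q\<^sup>2 / (H z)\<^sup>2) * slope F HL HR (H z)) (at z)"
      unfolding G_def[abs_def]
      by (rule DERIV_chain2[where g = H and x = z, OF DERIV_momentum_flux[OF Hpos[of z]]])
        (use ode[OF that] in blast)
    moreover have "(H z / F\<^sup>2 - q\<^sup>2 / (H z)\<^sup>2) * slope F HL HR (H z) = g z"
      unfolding g_def using slope_iff[OF Hpos, of z] ode[OF that] by blast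
    ultimately show ?thesis by simp
  qed
  have mf: "momentum_flux F (H z) (c * H z - q) = G z + c * (c * H z - q)" for z
    using momentum_flux_relative[OF Hpos, of z] by (simp add: G_def)
  have src: "H z - \<bar>c * H z - q\<bar> * (c * H z - q) / (H z)\<^sup>2 = g z" for z
    using Qnn[of z] by (simp add: g_def power2_eq_square)
  show ?thesis
    unfolding weak_solution_def mf src
  proof (intro allI impI conjI)
    fix \<phi> \<phi>t \<phi>x assume \<phi>: "test_function \<phi> \<phi>t \<phi>x"
    have "has_bochner_integral lborel
        (\<lambda>(t, x). H (x - c * t) * (\<phi>t (t, x) + c * \<phi>x (t, x))) 0"
      by (rule weak_transport[OF \<phi> Hmeas B3])
    moreover have "has_bochner_integral lborel
        (\<lambda>(t, x). (- q) * \<phi>x (t, x) + 0 * \<phi> (t, x)) 0"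
      by (rule weak_balance[where G = "\<lambda>_. - q" and g = "\<lambda>_. 0" and S = "{}" and B = "\<bar>q\<bar>" and c = c, OF \<phi>]) auto
    ultimately have "has_bochner_integral lborel
        (\<lambda>p. (case p of (t, x) \<Rightarrow> H (x - c * t) * (\<phi>t (t, x) + c * \<phi>x (t, x)))
            + (case p of (t, x) \<Rightarrow> (- q) * \<phi>x (t, x) + 0 * \<phi> (t, x))) (0 + 0)"
      by (rule has_bochner_integral_add)
    also have "(\<lambda>p. (case p of (t, x) \<Rightarrow> H (x - c * t) * (\<phi>t (t, x) + c * \<phi>x (t, x)))
            + (case p of (t, x) \<Rightarrow> (- q) * \<phi>x (t, x) + 0 * \<phi> (t, x)))
        = (\<lambda>(t, x). H (x - c * t) * \<phi>t (t, x) + (c * H (x - c * t) - q) * \<phi>x (t, x))"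
      by (auto simp: fun_eq_iff algebra_simps)
    finally show "has_bochner_integral lborel
        (\<lambda>(t, x). H (x - c * t) * \<phi>t (t, x) + (c * H (x - c * t) - q) * \<phi>x (t, x)) 0"
      by simp
    have "has_bochner_integral lborel
        (\<lambda>(t, x). (c * H (x - c * t) - q) * (\<phi>t (t, x) + c * \<phi>x (t, x))) 0"
      by (rule weak_transport[where u = "\<lambda>z. c * H z - q", OF \<phi> _ B4]) (use Hmeas in measurable)
    moreover have "has_bochner_integral lborel
        (\<lambda>(t, x). G (x - c * t) * \<phi>x (t, x) + g (x - c * t) * \<phi> (t, x)) 0"
    proof (rule weak_balance[OF \<phi> _ _ gmeas _ J Gg])
      show "continuous_on UNIV G" using flux by (simp add: G_def)
      show "\<bar>G z\<bar> \<le> max B1 B2" "\<bar>g z\<bar> \<le> max B1 B2" for z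
        using B1[of z] B2[of z] by auto
    qed
    ultimately have "has_bochner_integral lborel
        (\<lambda>p. (case p of (t, x) \<Rightarrow> (c * H (x - c * t) - q) * (\<phi>t (t, x) + c * \<phi>x (t, x)))
            + (case p of (t, x) \<Rightarrow> G (x - c * t) * \<phi>x (t, x) + g (x - c * t) * \<phi> (t, x))) (0 + 0)"
      by (rule has_bochner_integral_add)
    also have "(\<lambda>p. (case p of (t, x) \<Rightarrow> (c * H (x - c * t) - q) * (\<phi>t (t, x) + c * \<phi>x (t, x)))
            + (case p of (t, x) \<Rightarrow> G (x - c * t) * \<phi>x (t, x) + g (x - c * t) * \<phi> (t, x)))
        = (\<lambda>(t, x). (c * H (x - c * t) - q) * \<phi>t (t, x)
              + (G (x - c * t) + c * (c * H (x - c * t) - q)) * \<phi>x (t, x) + g (x - c * t) * \<phi> (t, x))"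
      by (auto simp: fun_eq_iff algebra_simps)
    finally show "has_bochner_integral lborel
        (\<lambda>(t, x). (c * H (x - c * t) - q) * \<phi>t (t, x)
              + (G (x - c * t) + c * (c * H (x - c * t) - q)) * \<phi>x (t, x) + g (x - c * t) * \<phi> (t, x)) 0"
      by simp
  qed
qed

text \<open>
  Continuity of the flux across the jump is the second Rankine-Hugoniot condition between \<open>H*\<close> and
  \<open>HR\<close>.
\<close>

lemma nc_profile_of_orbit:
  assumes bounds: "\<And>z. min HL HR \<le> H z \<and> H z \<le> M"
    and J: "J = {} \<or> J = {0}"
    and ode: "\<And>z. z \<notin> J \<Longrightarrow> H z \<noteq> HS \<and> (H has_real_derivative slope F HL HR (H z)) (at z)"
    and jump: "0 \<in> J \<Longrightarrow> (H \<longlongrightarrow> H1) (at_left 0) \<and> (H \<longlongrightarrow> HR) (at_right 0) \<and> H 0 = HR \<and> HR < HS"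
    and lims: "(H \<longlongrightarrow> HL) at_bot" "(H \<longlongrightarrow> HR) at_top" and ne: "HL \<noteq> HS" "HR \<noteq> HS"
    and smooth: "piecewise_smooth H" "piecewise_smooth (\<lambda>z. c * H z - q)"
  shows "nc_profile F HL HR c H (\<lambda>z. c * H z - q)"
    and "0 \<in> J \<Longrightarrow> lax_shock_at F c H (\<lambda>z. c * H z - q) 0"
proof -
  let ?Q = "\<lambda>z. c * H z - q"
  have Hpos: "0 < H z" for z
    using bounds[of z] HL_pos HR_pos by (auto simp: min_def split: if_splits)
  have Qnn: "0 \<le> ?Q z" for z
    using bounds[of z] by (intro nonneg_flow) simp
  have cont: "isCont H z" if "z \<notin> J" for z
    using ode[OF that] by (auto intro: DERIV_isCont)
  have HR1: "HR < H1" "HS < H1" if "0 \<in> J"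
    using jump[OF that] Hs_less_Hstar_iff by auto
  have one_sided: "0 < h \<and> h \<noteq> HS \<and> h' = c * h - q" if "one_sided_state H ?Q z h h'" for z h h'
  proof -
    have key: "0 < h \<and> h \<noteq> HS \<and> h' = c * h - q"
      if A: "A = at_left z \<or> A = at_right z" and h: "(H \<longlongrightarrow> h) A" "(?Q \<longlongrightarrow> h') A" for A
    proof -
      have nt: "A \<noteq> bot"
        using A by (elim disjE; simp only: trivial_limit_at_left_real trivial_limit_at_right_real simp_thms)
      have "(?Q \<longlongrightarrow> c * h - q) A" by (intro tendsto_intros h)
      then have "h' = c * h - q" using tendsto_unique[OF nt h(2)] by blast
      moreover have "0 < h \<and> h \<noteq> HS"
      proof (cases "z \<in> J")
        case False
        then have "(H \<longlongrightarrow> H z) A"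
          using cont[OF False] A unfolding isCont_def filterlim_at_split by blast
        then have "h = H z" using tendsto_unique[OF nt h(1)] by blast
        then show ?thesis using ode[OF False] Hpos by simp
      next
        case True
        then have z: "z = 0" "0 \<in> J" using J by auto
        have "(H \<longlongrightarrow> H1) A \<or> (H \<longlongrightarrow> HR) A" using jump[OF z(2)] A z(1) by blast
        then have "h = H1 \<or> h = HR" using tendsto_unique[OF nt h(1)] by blast
        then show ?thesis using HR1[OF z(2)] ne HR_pos by auto
      qed
      ultimately show ?thesis by blast
    qed
    show ?thesis using that key unfolding one_sided_state_def by blast
  qed
  show shock: "lax_shock_at F c H ?Q 0" if "0 \<in> J"
  proof -
    note j = jump[OF that] and g = HR1[OF that]
    have pos: "0 < H1" "0 < HR" "H1 \<noteq> HR" using Hstar_pos HR_pos g by auto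
    have "(?Q \<longlongrightarrow> c * H1 - q) (at_left 0)" "(?Q \<longlongrightarrow> c * HR - q) (at_right 0)"
      using j by (auto intro!: tendsto_intros)
    moreover have "rankine_hugoniot F c H1 (c * H1 - q) HR (c * HR - q)"
      using rankine_hugoniot_iff[OF pos] Hstar_eq by simp
    moreover have "lax_condition F c H1 (c * H1 - q) HR (c * HR - q)"
      using lax_condition_iff[OF pos(1,2)] j g by blast
    ultimately show ?thesis unfolding lax_shock_at_def using j by blast
  qed
  let ?G = "\<lambda>h. q\<^sup>2 / h + h\<^sup>2 / (2 * F\<^sup>2) - q * c"
  have Gcont: "isCont ?G h" if "h > 0" for h
    using DERIV_momentum_flux[OF that] by (rule DERIV_isCont)
  have flux: "isCont (\<lambda>z. ?G (H z)) z" for z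
  proof (cases "z \<in> J")
    case False
    then show ?thesis using isCont_o2[OF cont[OF False] Gcont[OF Hpos]] by simp
  next
    case True
    then have z: "z = 0" "0 \<in> J" using J by auto
    note j = jump[OF z(2)] and g = HR1[OF z(2)]
    have pos: "0 < H1" "0 < HR" "H1 \<noteq> HR" using Hstar_pos HR_pos g by auto
    have "rankine_hugoniot F c H1 (c * H1 - q) HR (c * HR - q)"
      using rankine_hugoniot_iff[OF pos] Hstar_eq by simp
    then have "?G H1 = ?G HR"
      using momentum_flux_relative[OF pos(1)] momentum_flux_relative[OF pos(2)]
      by (simp add: rankine_hugoniot_def algebra_simps)
    moreover have "((\<lambda>z. ?G (H z)) \<longlongrightarrow> ?G H1) (at_left 0)" "((\<lambda>z. ?G (H z)) \<longlongrightarrow> ?G HR) (at_right 0)"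
      using isCont_tendsto_compose[OF Gcont[OF pos(1)]] isCont_tendsto_compose[OF Gcont[OF pos(2)]] j
      by blast+
    ultimately show ?thesis
      unfolding z(1) isCont_def filterlim_at_split using j by simp
  qed
  have fin: "finite J" using J by auto
  have weak: "weak_solution F (\<lambda>t x. H (x - c * t)) (\<lambda>t x. ?Q (x - c * t))"
    by (rule weak_solution_of_orbit[OF bounds fin ode])
      (auto intro!: continuous_at_imp_continuous_on flux)
  have jumps: "lax_shock_at F c H ?Q d" if "\<not> (isCont H d \<and> isCont ?Q d)" for d
  proof -
    have "d \<in> J"
    proof (rule ccontr)
      assume "d \<notin> J"
      then have "isCont H d" by (rule cont)
      moreover from this have "isCont ?Q d" by (intro continuous_intros)
      ultimately show False using that by blast
    qed
    then have "d = 0" "0 \<in> J" using J by auto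
    then show ?thesis using shock by simp
  qed
  have "(?Q \<longlongrightarrow> c * HL - q) at_bot" "(?Q \<longlongrightarrow> c * HR - q) at_top"
    by (intro tendsto_intros lims)+
  then have "traveling_wave_profile F HL HR c H ?Q"
    unfolding traveling_wave_profile_def equilibrium_endstates
    using Hpos Qnn one_sided smooth weak jumps lims by blast
  moreover have "noncharacteristic F HL HR c H ?Q"
    unfolding noncharacteristic_def equilibrium_endstates[symmetric]
    using noncharacteristic_iff one_sided ne HL_pos HR_pos by metis
  ultimately show "nc_profile F HL HR c H ?Q"
    by (simp add: nc_profile_def)
qed

text \<open>
  The hypotheses say that \<open>HL\<close> repels and \<open>HR\<close> attracts; they put both endstates on the same side
  of \<open>Hs\<close>.
\<close>

lemma smooth_profile_exists:
  assumes "0 < (HL - HS) * (HL - HR)" "0 < (HR - HS) * (HL - HR)"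
  obtains H where "nc_profile F HL HR c H (\<lambda>z. c * H z - q)" "\<And>z. isCont H z"
proof -
  let ?P = "\<lambda>f. (f \<longlongrightarrow> HL) at_bot \<and> (f \<longlongrightarrow> HR) at_top \<and>
      (\<forall>z. min HL HR < f z \<and> f z < max HL HR \<and> (f has_real_derivative slope F HL HR (f z)) (at z))"
  have sonic: "h \<noteq> HS" if "min HL HR < h" "h < max HL HR" for h
    using assms that by (auto simp: zero_less_mult_iff min_def max_def split: if_splits)
  have "\<exists>f. ?P f"
  proof (cases "HL < HR")
    case True
    then have HS: "HR < HS" using assms by (auto simp: zero_less_mult_iff)
    have D: "0 < slope F HL HR h \<and> (travel_time has_real_derivative 1 / slope F HL HR h) (at h)"
      if "HL < h" "h < HR" for h
      using DERIV_travel_time[of h] slope_sign_iff(1)[of h] that H0_bounds HS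
      by (auto simp: mult_neg_neg mult_pos_neg)
    have bot: "filterlim travel_time at_bot (at_right HL)" and top: "filterlim travel_time at_top (at_left HR)"
      using travel_time_at_HL[OF assms(1)] travel_time_at_HR[OF assms(2)]
      by (auto simp: filterlim_at_split)
    have mid: "HL < (HL + HR) / 2" "(HL + HR) / 2 < HR" using True by auto
    obtain f e where f: "(f \<longlongrightarrow> HL) at_bot" "filterlim travel_time at_top (at_left HR) \<Longrightarrow> (f \<longlongrightarrow> HR) at_top \<and>
       (\<forall>z. HL < f z \<and> f z < HR \<and> (f has_real_derivative slope F HL HR (f z)) (at z))"
      by (rule increasing_orbit[OF mid D bot], assumption, assumption) (rule that, assumption+)
    then show ?thesis using True top by (intro exI[of _ f]) auto
  next
    case False
    then have less: "HR < HL" using HL_ne_HR by simp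
    then have HS: "HS < HR" using assms by (auto simp: zero_less_mult_iff)
    have D: "slope F HL HR h < 0 \<and> (travel_time has_real_derivative 1 / slope F HL HR h) (at h)"
      if "HR < h" "h < HL" for h
      using DERIV_travel_time[of h] slope_sign_iff(2)[of h] that H0_bounds HS
      by (auto simp: mult_neg_pos)
    have bot: "filterlim travel_time at_bot (at_left HL)" and top: "filterlim travel_time at_top (at_right HR)"
      using travel_time_at_HL[OF assms(1)] travel_time_at_HR[OF assms(2)]
      by (auto simp: filterlim_at_split)
    have mid: "HR < (HL + HR) / 2" "(HL + HR) / 2 < HL" using less by auto
    obtain f e where f: "(f \<longlongrightarrow> HL) at_bot" "filterlim travel_time at_top (at_right HR) \<Longrightarrow> (f \<longlongrightarrow> HR) at_top \<and>
       (\<forall>z. HR < f z \<and> f z < HL \<and> (f has_real_derivative slope F HL HR (f z)) (at z))"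
      by (rule decreasing_orbit[OF mid D bot], assumption, assumption) (rule that, assumption+)
    then show ?thesis using less top by (intro exI[of _ f]) auto
  qed
  then obtain f where f: "(f \<longlongrightarrow> HL) at_bot" "(f \<longlongrightarrow> HR) at_top"
    "\<And>z. min HL HR < f z \<and> f z < max HL HR \<and> (f has_real_derivative slope F HL HR (f z)) (at z)"
    by blast
  have ode: "0 < f z \<and> f z \<noteq> HS \<and> (f has_real_derivative slope F HL HR (f z)) (at z)" for z
    using f(3)[of z] sonic[of "f z"] HL_pos HR_pos by (auto simp: min_def split: if_splits)
  have sm: "smooth_on UNIV f" "smooth_on UNIV (\<lambda>z. c * f z - q)"
    using smooth_on_orbit[of UNIV f] ode by simp_all
  have "nc_profile F HL HR c f (\<lambda>z. c * f z - q)"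
  proof (rule nc_profile_of_orbit(1)[where J = "{}" and M = "max HL HR"])
    show "min HL HR \<le> f z \<and> f z \<le> max HL HR" for z using f(3)[of z] by (simp add: less_imp_le)
    show "HL \<noteq> HS" "HR \<noteq> HS" using assms by auto
  qed (use ode f(1,2) sm in \<open>auto intro: piecewise_smooth_if_smooth\<close>)
  then show thesis
    by (rule that) (use ode in \<open>auto intro: DERIV_isCont\<close>)
qed

text \<open>
  The orbit is followed slightly beyond the jump, so that all its derivatives have limits there.
\<close>

lemma shock_profile_of_left_orbit:
  assumes HS: "HR < HS" "HS < HL" and e: "e > 0"
    and f: "f 0 = H1" "(f \<longlongrightarrow> HL) at_bot"
    and ode: "\<And>z. z < e \<Longrightarrow> HS < f z \<and> f z \<le> M \<and> (f has_real_derivative slope F HL HR (f z)) (at z)"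
  defines "H \<equiv> \<lambda>z. if z < 0 then f z else HR"
  shows "nc_profile F HL HR c H (\<lambda>z. c * H z - q)"
    and "lax_shock_at F c H (\<lambda>z. c * H z - q) 0"
proof -
  have ode': "0 < f z \<and> f z \<noteq> HS \<and> (f has_real_derivative slope F HL HR (f z)) (at z)" if "z < e" for z
    using ode[OF that] HS_pos by auto
  have smf: "smooth_on {..<e} f" "smooth_on {..<e} (\<lambda>z. c * f z - q)"
    using smooth_on_orbit[of "{..<e}" f] ode' by simp_all
  have slope0: "slope F HL HR HR = 0" by (simp add: slope_def)
  have smR: "smooth_on UNIV (\<lambda>_::real. HR)" "smooth_on UNIV (\<lambda>_::real. c * HR - q)"
    using smooth_on_orbit[of UNIV "\<lambda>_. HR"] slope0 HR_pos HS by simp_all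
  note smR' = smooth_on_subset[OF smR(1) subset_UNIV] smooth_on_subset[OF smR(2) subset_UNIV]
  have left: "(H \<longlongrightarrow> H1) (at_left 0)"
  proof -
    have "isCont f 0" using ode'[OF e] by (auto intro: DERIV_isCont)
    then have "(f \<longlongrightarrow> H1) (at_left 0)"
      unfolding isCont_def filterlim_at_split f(1) by blast
    then show ?thesis
      by (rule Lim_transform_eventually) (auto simp: H_def eventually_at_filter)
  qed
  have right: "(H \<longlongrightarrow> HR) (at_right 0)"
    by (rule Lim_transform_eventually[OF tendsto_const]) (auto simp: H_def eventually_at_filter)
  have D: "H z \<noteq> HS \<and> (H has_real_derivative slope F HL HR (H z)) (at z)" if "z \<noteq> 0" for z
  proof (cases "z < 0")
    case True
    have "(H has_real_derivative slope F HL HR (f z)) (at z)"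
      by (rule has_field_derivative_transform_within_open[where S = "{..<0}" and f = f])
        (use ode'[of z] True e in \<open>auto simp: H_def\<close>)
    then show ?thesis using True ode'[of z] e by (simp add: H_def)
  next
    case False
    have "(H has_real_derivative 0) (at z)"
      by (rule has_field_derivative_transform_within_open[where S = "{0<..}" and f = "\<lambda>_. HR"])
        (use that False in \<open>auto simp: H_def\<close>)
    then show ?thesis using False slope0 HS by (simp add: H_def)
  qed
  have bounds: "min HL HR \<le> H z \<and> H z \<le> max M HR" for z
    using ode[of z] e HS by (auto simp: H_def)
  have lims: "(H \<longlongrightarrow> HL) at_bot" "(H \<longlongrightarrow> HR) at_top"
  proof -
    show "(H \<longlongrightarrow> HL) at_bot"
      by (rule Lim_transform_eventually[OF f(2)])
        (use eventually_gt_at_bot[of 0] in \<open>eventually_elim, simp add: H_def\<close>)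
    show "(H \<longlongrightarrow> HR) at_top"
      by (rule Lim_transform_eventually[OF tendsto_const])
        (use eventually_gt_at_top[of 0] in \<open>eventually_elim, simp add: H_def\<close>)
  qed
  have smooth: "piecewise_smooth H" "piecewise_smooth (\<lambda>z. c * H z - q)"
    by (rule piecewise_smooth_glue[OF smf(1) e smR'(1)] piecewise_smooth_glue[OF smf(2) e smR'(2)];
        simp add: H_def)+
  have D0: "H z \<noteq> HS \<and> (H has_real_derivative slope F HL HR (H z)) (at z)" if "z \<notin> {0}" for z
    using D[of z] that by simp
  have jump: "(H \<longlongrightarrow> H1) (at_left 0) \<and> (H \<longlongrightarrow> HR) (at_right 0) \<and> H 0 = HR \<and> HR < HS"
    using left right HS by (simp add: H_def)
  have ne: "HL \<noteq> HS" "HR \<noteq> HS" using HS by auto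
  note result = nc_profile_of_orbit[where J = "{0}", OF bounds _ D0 _ lims ne smooth]
  show "nc_profile F HL HR c H (\<lambda>z. c * H z - q)"
    by (rule result(1)) (simp_all add: jump)
  show "lax_shock_at F c H (\<lambda>z. c * H z - q) 0"
    by (rule result(2)) (simp_all add: jump)
qed

end

section \<open>Translation of profiles\<close>

lemma isCont_translate:
  fixes f :: "real \<Rightarrow> real"
  shows "isCont (\<lambda>z. f (z + a)) d \<longleftrightarrow> isCont f (d + a)"
  unfolding isCont_def filterlim_at_split filterlim_one_sided_translate ..

lemma test_function_translate:
  assumes "test_function \<phi> \<phi>t \<phi>x"
  shows "test_function (\<lambda>p. \<phi> ((0, a) + p)) (\<lambda>p. \<phi>t ((0, a) + p)) (\<lambda>p. \<phi>x ((0, a) + p))"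
proof -
  have D: "\<And>p. (\<phi> has_derivative (\<lambda>(s, y). \<phi>t p * s + \<phi>x p * y)) (at p)"
    and cont: "continuous_on UNIV \<phi>t" "continuous_on UNIV \<phi>x"
    and K: "compact (closure {p. \<phi> p \<noteq> 0})"
    using assms by (auto simp: test_function_def)
  have "((\<lambda>p. \<phi> ((0, a) + p)) has_derivative
      (\<lambda>(s, y). \<phi>t ((0, a) + p) * s + \<phi>x ((0, a) + p) * y)) (at p)" for p
  proof -
    have "((\<lambda>p. (0, a) + p) has_derivative (\<lambda>h. h)) (at p)"
      by (auto intro!: derivative_eq_intros)
    from has_derivative_compose[OF this D] show ?thesis by simp
  qed
  moreover have "continuous_on UNIV (\<lambda>p. \<phi>t ((0, a) + p))" "continuous_on UNIV (\<lambda>p. \<phi>x ((0, a) + p))"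
    by (auto intro!: continuous_intros continuous_on_compose2[OF cont(1)] continuous_on_compose2[OF cont(2)])
  moreover have "compact (closure {p. \<phi> ((0, a) + p) \<noteq> 0})"
  proof -
    have "{p. \<phi> ((0, a) + p) \<noteq> 0} = (+) (- (0, a)) ` {p. \<phi> p \<noteq> 0}"
      by (force simp: image_iff intro!: exI[of _ "(0, a) + _"])
    also have "closure \<dots> = (+) (- (0, a)) ` closure {p. \<phi> p \<noteq> 0}"
      by (rule closure_translation)
    finally show ?thesis using compact_translation[OF K] by simp
  qed
  ultimately show ?thesis by (simp add: test_function_def)
qed

lemma has_bochner_integral_lborel_translate:
  fixes f :: "real \<times> real \<Rightarrow> real"
  assumes "has_bochner_integral lborel f I"
  shows "has_bochner_integral lborel (\<lambda>p. f (p0 + p)) I"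
proof -
  have f: "f \<in> borel_measurable borel"
    using assms by (auto simp: has_bochner_integral_iff dest: borel_measurable_integrable)
  have g: "(+) p0 \<in> measurable lborel borel" by simp
  have "has_bochner_integral (distr lborel borel ((+) p0)) f I"
    using assms by (simp add: lborel_distr_plus)
  then show ?thesis
    unfolding has_bochner_integral_iff integrable_distr_eq[OF g f] integral_distr[OF g f] .
qed

lemma weak_solution_translate:
  assumes "weak_solution F h q"
  shows "weak_solution F (\<lambda>t x. h t (x + a)) (\<lambda>t x. q t (x + a))"
  unfolding weak_solution_def
proof (intro allI impI conjI)
  fix \<phi> \<phi>t \<phi>x assume "test_function \<phi> \<phi>t \<phi>x"
  from test_function_translate[OF this, of "- a"]
  have
    "has_bochner_integral lborel
          (\<lambda>(t, x). h t x * \<phi>t ((0, - a) + (t, x)) + q t x * \<phi>x ((0, - a) + (t, x))) 0"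
    "has_bochner_integral lborel
          (\<lambda>(t, x). q t x * \<phi>t ((0, - a) + (t, x)) + momentum_flux F (h t x) (q t x) * \<phi>x ((0, - a) + (t, x))
                   + (h t x - \<bar>q t x\<bar> * q t x / (h t x)\<^sup>2) * \<phi> ((0, - a) + (t, x))) 0"
    using assms unfolding weak_solution_def by blast+
  from this[THEN has_bochner_integral_lborel_translate, of "(0, a)"]
  show "has_bochner_integral lborel
          (\<lambda>(t, x). h t (x + a) * \<phi>t (t, x) + q t (x + a) * \<phi>x (t, x)) 0"
    "has_bochner_integral lborel
          (\<lambda>(t, x). q t (x + a) * \<phi>t (t, x) + momentum_flux F (h t (x + a)) (q t (x + a)) * \<phi>x (t, x)
                   + (h t (x + a) - \<bar>q t (x + a)\<bar> * q t (x + a) / (h t (x + a))\<^sup>2) * \<phi> (t, x)) 0"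
    by (simp_all add: case_prod_unfold add.commute)
qed

lemma filterlim_translate_at_bot: "filterlim f G at_bot \<Longrightarrow> filterlim (\<lambda>z::real. f (z + a)) G at_bot"
proof (rule filterlim_compose[of f])
  have "\<forall>z\<le>Z - a. z + a \<le> Z" for Z by auto
  then show "filterlim (\<lambda>z. z + a) at_bot at_bot"
    unfolding filterlim_at_bot eventually_at_bot_linorder by blast
qed

lemma filterlim_translate_at_top: "filterlim f G at_top \<Longrightarrow> filterlim (\<lambda>z::real. f (z + a)) G at_top"
proof (rule filterlim_compose[of f])
  have "\<forall>z\<ge>Z - a. Z \<le> z + a" for Z by auto
  then show "filterlim (\<lambda>z. z + a) at_top at_top"
    unfolding filterlim_at_top eventually_at_top_linorder by blast
qed

lemma nc_profile_translate:
  assumes "nc_profile F HL HR s H Q"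
  shows "nc_profile F HL HR s (\<lambda>z. H (z + a)) (\<lambda>z. Q (z + a))"
proof -
  have P: "traveling_wave_profile F HL HR s H Q" and N: "noncharacteristic F HL HR s H Q"
    using assms by (auto simp: nc_profile_def)
  have os: "one_sided_state (\<lambda>z. H (z + a)) (\<lambda>z. Q (z + a)) z h q \<longleftrightarrow> one_sided_state H Q (z + a) h q" for z h q
    unfolding one_sided_state_def filterlim_one_sided_translate ..
  have ls: "lax_shock_at F s (\<lambda>z. H (z + a)) (\<lambda>z. Q (z + a)) z \<longleftrightarrow> lax_shock_at F s H Q (z + a)" for z
    unfolding lax_shock_at_def filterlim_one_sided_translate ..
  have "weak_solution F (\<lambda>t x. H (x - s * t + a)) (\<lambda>t x. Q (x - s * t + a))"
    using weak_solution_translate[of F "\<lambda>t x. H (x - s * t)" "\<lambda>t x. Q (x - s * t)" a] P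
    by (simp add: traveling_wave_profile_def algebra_simps)
  then have "traveling_wave_profile F HL HR s (\<lambda>z. H (z + a)) (\<lambda>z. Q (z + a))"
    using P unfolding traveling_wave_profile_def os ls isCont_translate
    by (auto intro: piecewise_smooth_translate filterlim_translate_at_bot filterlim_translate_at_top)
  moreover have "noncharacteristic F HL HR s (\<lambda>z. H (z + a)) (\<lambda>z. Q (z + a))"
    using N unfolding noncharacteristic_def os by blast
  ultimately show ?thesis by (simp add: nc_profile_def)
qed

section \<open>Classification\<close>

lemma not_isCont_if_one_sided_limits_differ:
  fixes f :: "real \<Rightarrow> real"
  assumes "(f \<longlongrightarrow> a) (at_left d)" "(f \<longlongrightarrow> b) (at_right d)" "a \<noteq> b"
  shows "\<not> isCont f d"
proof
  assume "isCont f d"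
  then have "(f \<longlongrightarrow> f d) (at_left d)" "(f \<longlongrightarrow> f d) (at_right d)"
    unfolding isCont_def filterlim_at_split by blast+
  then have "a = f d" "b = f d"
    using assms tendsto_unique[of "at_left d" f] tendsto_unique[of "at_right d" f] by auto
  then show False using assms(3) by simp
qed

text \<open>
  Equal states on both sides violate the strict inequalities of the Lax condition.
\<close>

lemma not_isCont_if_lax_shock:
  assumes "lax_shock_at F s H Q d"
  shows "\<not> (isCont H d \<and> isCont Q d)"
proof
  assume cont: "isCont H d \<and> isCont Q d"
  obtain h1 q1 h2 q2 where
    "(H \<longlongrightarrow> h1) (at_left d)" "(Q \<longlongrightarrow> q1) (at_left d)"
    "(H \<longlongrightarrow> h2) (at_right d)" "(Q \<longlongrightarrow> q2) (at_right d)" and lax: "lax_condition F s h1 q1 h2 q2"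
    using assms unfolding lax_shock_at_def by blast
  then have "h1 = h2" "q1 = q2"
    using not_isCont_if_one_sided_limits_differ cont by blast+
  then show False using lax by (auto simp: lax_condition_def)
qed

context endstates
begin

text \<open>
  Piecewise smoothness allows break points without a jump; the profile equation shows that the profile
  is smooth there too.
\<close>

lemma profile_smooth_on:
  assumes N: "nc_profile F HL HR s H Q" and T: "open T" "T \<inter> jumps H Q = {}"
  shows "smooth_on T H" "smooth_on T Q"
proof -
  have P: "traveling_wave_profile F HL HR s H Q" using N by (simp add: nc_profile_def)
  have cont: "isCont H z" "isCont Q z" if "z \<in> T" for z
    using T(2) that by (auto simp: jumps_def)
  have ode: "0 < H z \<and> H z \<noteq> HS \<and> (H has_real_derivative slope F HL HR (H z)) (at z)" if "z \<in> T" for z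
  proof -
    have "z \<notin> jumps H Q" using T(2) that by blast
    then show ?thesis
      using profile_piecewise_orbit[OF N] P
      unfolding piecewise_orbit_def traveling_wave_profile_def by blast
  qed
  show "smooth_on T H" by (rule smooth_on_orbit(1)[OF T(1) ode])
  show "smooth_on T Q"
    by (rule smooth_on_cong_open[OF T(1) _ smooth_on_orbit(2)[OF T(1) ode]])
      (use profile_flow(2)[OF P] cont in auto)
qed

lemma classify_continuous:
  assumes N: "nc_profile F HL HR s H Q" and cont: "\<And>z. isCont H z \<and> isCont Q z"
  shows "HL < HR \<Longrightarrow> HR < HS \<and> increasing_smooth_profile F HL HR s H Q"
    and "HR < HL \<Longrightarrow> HS < HR \<and> decreasing_smooth_profile F HL HR s H Q"
proof -
  have J: "jumps H Q = {}" using cont by (simp add: jumps_def)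
  note sm = profile_smooth_on[OF N open_UNIV, unfolded J, simplified]
  note shape = smooth_orbit[OF profile_piecewise_orbit[OF N, unfolded J]]
  show "HR < HS \<and> increasing_smooth_profile F HL HR s H Q" if "HL < HR"
    using shape(1)[OF that] sm N by (simp add: increasing_smooth_profile_def)
  show "HS < HR \<and> decreasing_smooth_profile F HL HR s H Q" if "HR < HL"
    using shape(2)[OF that] sm N by (simp add: decreasing_smooth_profile_def)
qed

text \<open>
  The last three conclusions, about two sample points left of the jump, let a given shape be
  recognised without referring back to the orbit.
\<close>

lemma classify_discontinuous:
  assumes N: "nc_profile F HL HR s H Q" and disc: "\<not> (isCont H 0 \<and> isCont Q 0)"
  shows "HR < HS" "HS < HL" "HS < H1"
    and "H1 = HL \<Longrightarrow> riemann_profile F HL HR s H Q"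
    and "HL < H1 \<Longrightarrow> nonmonotone_discontinuous_profile F HL HR s H Q"
    and "H1 < HL \<Longrightarrow> decreasing_discontinuous_profile F HL HR s H Q"
    and "H1 = HL \<Longrightarrow> H (-2) = H (-1)" and "HL < H1 \<Longrightarrow> H (-2) < H (-1)" and "H1 < HL \<Longrightarrow> H (-1) < H (-2)"
proof -
  have P: "traveling_wave_profile F HL HR s H Q" using N by (simp add: nc_profile_def)
  note O = profile_piecewise_orbit[OF N]
  have J: "jumps H Q = {0}"
    using at_most_one_jump[OF O, of 0] disc by (auto simp: jumps_def)
  note S = jump_orbit[OF O[unfolded J]]
  show "HR < HS" "HS < HL" "HS < H1" by (rule S)+
  have shock: "lax_shock_at F s H Q 0"
    using P disc unfolding traveling_wave_profile_def by blast
  have sm: "smooth_on {..<0} H" "smooth_on {..<0} Q"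
    using profile_smooth_on[OF N, of "{..<0}"] by (simp_all add: J)
  have R: "H z = HR" if "0 < z" for z using S(4) that by simp
  have drop: "HR < H z" if "z < 0" for z using S(1) S(6)[OF that] by simp
  show "riemann_profile F HL HR s H Q" "H (-2) = H (-1)" if eq: "H1 = HL"
  proof -
    have "\<forall>z<0. H z = HL" using S(7) eq by auto
    then show "riemann_profile F HL HR s H Q" "H (-2) = H (-1)"
      using N shock R by (simp_all add: riemann_profile_def)
  qed
  show "nonmonotone_discontinuous_profile F HL HR s H Q" "H (-2) < H (-1)" if less: "HL < H1"
  proof -
    have inc: "strict_mono_on {..<0} H" using S(7) less by auto
    then show lt: "H (-2) < H (-1)" by (rule strict_mono_onD) auto
    have "\<not> mono_on (- {0}) H"
    proof
      assume "mono_on (- {0}) H"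
      then have "H (-1) \<le> H 1" by (rule mono_onD) auto
      then show False using drop[of "-1"] R[of 1] by simp
    qed
    moreover have "\<not> antimono_on (- {0}) H"
    proof
      assume "antimono_on (- {0}) H"
      then have "H (-1) \<le> H (-2)" by (rule monotone_onD) auto
      then show False using lt by simp
    qed
    ultimately show "nonmonotone_discontinuous_profile F HL HR s H Q"
      unfolding nonmonotone_discontinuous_profile_def using N sm inc S(5) shock R by blast
  qed
  show "decreasing_discontinuous_profile F HL HR s H Q" "H (-1) < H (-2)" if less: "H1 < HL"
  proof -
    have dec: "strict_antimono_on {..<0} H" using S(7) less by auto
    then show "H (-1) < H (-2)" by (rule monotone_onD) auto
    have "antimono_on (- {0}) H"
    proof (rule monotone_onI)
      fix x y :: real assume xy: "x \<in> - {0}" "y \<in> - {0}" "x \<le> y"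
      consider "x = y" | "x < y" "y < 0" | "x < 0" "0 < y" | "0 < x" "0 < y"
        using xy by fastforce
      then show "H y \<le> H x"
      proof cases
        case 2
        then show ?thesis using monotone_onD[OF dec, of x y] by simp
      next
        case 3
        then show ?thesis using drop[of x] R[of y] by simp
      next
        case 4
        then show ?thesis using R[of x] R[of y] by simp
      qed simp
    qed
    then show "decreasing_discontinuous_profile F HL HR s H Q"
      unfolding decreasing_discontinuous_profile_def using N sm dec S(5) shock R by blast
  qed
qed

lemma profile_kinds:
  assumes N: "nc_profile F HL HR s H Q"
  shows "HL < HR \<Longrightarrow> up_to_translation (increasing_smooth_profile F HL HR s) H Q"
    and "HR < HL \<Longrightarrow> up_to_translation (nonmonotone_discontinuous_profile F HL HR s) H Q \<or>
           up_to_translation (riemann_profile F HL HR s) H Q \<or>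
           up_to_translation (decreasing_discontinuous_profile F HL HR s) H Q \<or>
           up_to_translation (decreasing_smooth_profile F HL HR s) H Q"
proof -
  have "(HL < HR \<longrightarrow> up_to_translation (increasing_smooth_profile F HL HR s) H Q) \<and>
    (HR < HL \<longrightarrow> up_to_translation (nonmonotone_discontinuous_profile F HL HR s) H Q \<or>
           up_to_translation (riemann_profile F HL HR s) H Q \<or>
           up_to_translation (decreasing_discontinuous_profile F HL HR s) H Q \<or>
           up_to_translation (decreasing_smooth_profile F HL HR s) H Q)"
  proof (cases "\<forall>z. isCont H z \<and> isCont Q z")
    case True
    then have "HL < HR \<Longrightarrow> increasing_smooth_profile F HL HR s H Q"
      "HR < HL \<Longrightarrow> decreasing_smooth_profile F HL HR s H Q"
      using classify_continuous[OF N] by blast+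
    then have "HL < HR \<Longrightarrow> up_to_translation (increasing_smooth_profile F HL HR s) H Q"
      "HR < HL \<Longrightarrow> up_to_translation (decreasing_smooth_profile F HL HR s) H Q"
      unfolding up_to_translation_def by (auto intro!: exI[of _ 0])
    then show ?thesis by blast
  next
    case False
    then obtain d where d: "\<not> (isCont H d \<and> isCont Q d)" by blast
    let ?H = "\<lambda>z. H (z + d)" and ?Q = "\<lambda>z. Q (z + d)"
    have "\<not> (isCont ?H 0 \<and> isCont ?Q 0)" using d by (simp add: isCont_translate)
    note C = classify_discontinuous[OF nc_profile_translate[OF N, of d] this]
    have "riemann_profile F HL HR s ?H ?Q \<or> nonmonotone_discontinuous_profile F HL HR s ?H ?Q
       \<or> decreasing_discontinuous_profile F HL HR s ?H ?Q"
      using C(4-6) by (cases H1 HL rule: linorder_cases) auto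
    moreover have "\<not> HL < HR" using C(1,2) by simp
    ultimately show ?thesis unfolding up_to_translation_def by blast
  qed
  then show "HL < HR \<Longrightarrow> up_to_translation (increasing_smooth_profile F HL HR s) H Q"
    "HR < HL \<Longrightarrow> up_to_translation (nonmonotone_discontinuous_profile F HL HR s) H Q \<or>
           up_to_translation (riemann_profile F HL HR s) H Q \<or>
           up_to_translation (decreasing_discontinuous_profile F HL HR s) H Q \<or>
           up_to_translation (decreasing_smooth_profile F HL HR s) H Q"
    by blast+
qed

section \<open>Existence\<close>

lemma smooth_exists_iff:
  shows "HL < HR \<Longrightarrow> (\<exists>s H Q. increasing_smooth_profile F HL HR s H Q) \<longleftrightarrow> HR < HS"
    and "HR < HL \<Longrightarrow> (\<exists>s H Q. decreasing_smooth_profile F HL HR s H Q) \<longleftrightarrow> HS < HR"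
proof -
  have ex: "\<exists>H. nc_profile F HL HR c H (\<lambda>z. c * H z - q) \<and>
      (\<forall>z. isCont H z \<and> isCont (\<lambda>z. c * H z - q) z)"
    if prem: "0 < (HL - HS) * (HL - HR)" "0 < (HR - HS) * (HL - HR)"
  proof -
    obtain H where "nc_profile F HL HR c H (\<lambda>z. c * H z - q)" "\<And>z. isCont H z"
      using smooth_profile_exists[OF prem] by blast
    then show ?thesis by (intro exI[of _ H]) (auto intro!: continuous_intros)
  qed
  show "(\<exists>s H Q. increasing_smooth_profile F HL HR s H Q) \<longleftrightarrow> HR < HS" if less: "HL < HR"
  proof
    assume "\<exists>s H Q. increasing_smooth_profile F HL HR s H Q"
    then obtain s H Q where "nc_profile F HL HR s H Q" "smooth_on UNIV H" "smooth_on UNIV Q"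
      by (auto simp: increasing_smooth_profile_def)
    then show "HR < HS"
      using classify_continuous(1)[of s H Q] less smooth_on_derivatives(3)[of UNIV] by blast
  next
    assume "HR < HS"
    then have "0 < (HL - HS) * (HL - HR)" "0 < (HR - HS) * (HL - HR)"
      using less by (auto intro: mult_neg_neg)
    then show "\<exists>s H Q. increasing_smooth_profile F HL HR s H Q"
      using ex classify_continuous(1)[OF _ _ less] by blast
  qed
  show "(\<exists>s H Q. decreasing_smooth_profile F HL HR s H Q) \<longleftrightarrow> HS < HR" if less: "HR < HL"
  proof
    assume "\<exists>s H Q. decreasing_smooth_profile F HL HR s H Q"
    then obtain s H Q where "nc_profile F HL HR s H Q" "smooth_on UNIV H" "smooth_on UNIV Q"
      by (auto simp: decreasing_smooth_profile_def)
    then show "HS < HR"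
      using classify_continuous(2)[of s H Q] less smooth_on_derivatives(3)[of UNIV] by blast
  next
    assume "HS < HR"
    then have "0 < (HL - HS) * (HL - HR)" "0 < (HR - HS) * (HL - HR)"
      using less by auto
    then show "\<exists>s H Q. decreasing_smooth_profile F HL HR s H Q"
      using ex classify_continuous(2)[OF _ _ less] by blast
  qed
qed

text \<open>
  Only the portion left of the jump has to be constructed: the constant \<open>HL\<close> if \<open>H* = HL\<close>, and otherwise
  an orbit that leaves \<open>HL\<close> and passes \<open>H*\<close> at zero.  Strictly between \<open>HL\<close> and \<open>H*\<close> there is
  neither \<open>Hs\<close> nor an equilibrium.
\<close>

lemma shock_profile_exists:
  assumes HS: "HR < HS" "HS < HL"
  obtains s H Q where "nc_profile F HL HR s H Q" "\<not> (isCont H 0 \<and> isCont Q 0)"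
proof -
  have HS1: "HS < H1" using HS Hs_less_Hstar_iff by simp
  have prod: "0 < (HL - HS) * (HL - HR)" using HS by simp
  have "\<exists>f e M. 0 < e \<and> f 0 = H1 \<and> (f \<longlongrightarrow> HL) at_bot \<and>
     (\<forall>z<e. HS < f z \<and> f z \<le> M \<and> (f has_real_derivative slope F HL HR (f z)) (at z))"
  proof (cases H1 HL rule: linorder_cases)
    case equal
    have "slope F HL HR HL = 0" by (simp add: slope_def)
    then show ?thesis
      using equal HS by (intro exI[of _ "\<lambda>_. HL"] exI[of _ 1] exI[of _ HL]) auto
  next
    case less
    have D: "slope F HL HR h < 0 \<and> (travel_time has_real_derivative 1 / slope F HL HR h) (at h)"
      if "HS < h" "h < HL" for h
      using DERIV_travel_time[of h] slope_sign_iff(2)[of h] that H0_bounds HS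
      by (auto simp: mult_neg_pos)
    have bot: "filterlim travel_time at_bot (at_left HL)"
      using travel_time_at_HL[OF prod] by (auto simp: filterlim_at_split)
    obtain f e where "0 < e" "f 0 = H1" "(f \<longlongrightarrow> HL) at_bot"
      "\<And>z. z < e \<Longrightarrow> HS < f z \<and> f z < HL \<and> (f has_real_derivative slope F HL HR (f z)) (at z)"
      by (rule decreasing_orbit[OF HS1 less D bot], assumption, assumption) (rule that, assumption+)
    then show ?thesis by (intro exI[of _ f] exI[of _ e] exI[of _ HL]) (auto simp: less_imp_le)
  next
    case greater
    have D: "0 < slope F HL HR h \<and> (travel_time has_real_derivative 1 / slope F HL HR h) (at h)"
      if "HL < h" "h < H1 + 1" for h
      using DERIV_travel_time[of h] slope_sign_iff(1)[of h] that H0_bounds HS by auto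
    have bot: "filterlim travel_time at_bot (at_right HL)"
      using travel_time_at_HL[OF prod] by (auto simp: filterlim_at_split)
    \<comment> \<open>Any upper end beyond \<open>H*\<close> would do: it only has to leave room after time zero.\<close>
    have mid: "H1 < H1 + 1" by simp
    obtain f e where f: "0 < e" "f 0 = H1" "(f \<longlongrightarrow> HL) at_bot"
      "\<And>z. z < e \<Longrightarrow> HL < f z \<and> f z < H1 + 1 \<and> (f has_real_derivative slope F HL HR (f z)) (at z)"
      by (rule increasing_orbit[OF greater mid D bot], assumption, assumption) (rule that, assumption+)
    have "HS < f z \<and> f z \<le> H1 + 1 \<and> (f has_real_derivative slope F HL HR (f z)) (at z)" if "z < e" for z
      using f(4)[OF that] HS by simp
    then show ?thesis using f by (intro exI[of _ f] exI[of _ e] exI[of _ "H1 + 1"]) simp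
  qed
  then obtain f e M where f: "0 < e" "f 0 = H1" "(f \<longlongrightarrow> HL) at_bot"
     "\<And>z. z < e \<Longrightarrow> HS < f z \<and> f z \<le> M \<and> (f has_real_derivative slope F HL HR (f z)) (at z)"
    by blast
  note X = shock_profile_of_left_orbit[OF HS f]
  show thesis by (rule that[OF X(1) not_isCont_if_lax_shock[OF X(2)]])
qed

text \<open>
  The three kinds share one construction; the position of \<open>H*\<close> relative to \<open>HL\<close> decides which of
  them it yields.
\<close>

lemma discontinuous_exists_iff:
  shows "(\<exists>s H Q. nonmonotone_discontinuous_profile F HL HR s H Q) \<longleftrightarrow> HR < HS \<and> HS < HL \<and> HL < H1"
    and "(\<exists>s H Q. riemann_profile F HL HR s H Q) \<longleftrightarrow> HR < HS \<and> HS < H1 \<and> H1 = HL"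
    and "(\<exists>s H Q. decreasing_discontinuous_profile F HL HR s H Q) \<longleftrightarrow> HR < HS \<and> HS < H1 \<and> H1 < HL"
proof -
  show "(\<exists>s H Q. nonmonotone_discontinuous_profile F HL HR s H Q) \<longleftrightarrow> HR < HS \<and> HS < HL \<and> HL < H1"
  proof
    assume "\<exists>s H Q. nonmonotone_discontinuous_profile F HL HR s H Q"
    then obtain s H Q where N: "nc_profile F HL HR s H Q" and "lax_shock_at F s H Q 0"
      and mono: "strict_mono_on {..<0} H"
      by (auto simp: nonmonotone_discontinuous_profile_def)
    note C = classify_discontinuous[OF N not_isCont_if_lax_shock[OF this(2)]]
    have "H (-2) < H (-1)" by (rule strict_mono_onD[OF mono]) auto
    then have "HL < H1" using C(7,9) by (cases H1 HL rule: linorder_cases) auto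
    then show "HR < HS \<and> HS < HL \<and> HL < H1" using C by blast
  next
    assume "HR < HS \<and> HS < HL \<and> HL < H1"
    then show "\<exists>s H Q. nonmonotone_discontinuous_profile F HL HR s H Q"
      using shock_profile_exists classify_discontinuous(5) by metis
  qed
  show "(\<exists>s H Q. riemann_profile F HL HR s H Q) \<longleftrightarrow> HR < HS \<and> HS < H1 \<and> H1 = HL"
  proof
    assume "\<exists>s H Q. riemann_profile F HL HR s H Q"
    then obtain s H Q where N: "nc_profile F HL HR s H Q" and "lax_shock_at F s H Q 0"
      and const: "\<forall>z<0. H z = HL"
      by (auto simp: riemann_profile_def)
    note C = classify_discontinuous[OF N not_isCont_if_lax_shock[OF this(2)]]
    have "H (-2) = H (-1)" using const by simp
    then have "H1 = HL" using C(8,9) by (cases H1 HL rule: linorder_cases) auto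
    then show "HR < HS \<and> HS < H1 \<and> H1 = HL" using C by blast
  next
    assume "HR < HS \<and> HS < H1 \<and> H1 = HL"
    then show "\<exists>s H Q. riemann_profile F HL HR s H Q"
      using shock_profile_exists classify_discontinuous(4) by metis
  qed
  show "(\<exists>s H Q. decreasing_discontinuous_profile F HL HR s H Q) \<longleftrightarrow> HR < HS \<and> HS < H1 \<and> H1 < HL"
  proof
    assume "\<exists>s H Q. decreasing_discontinuous_profile F HL HR s H Q"
    then obtain s H Q where N: "nc_profile F HL HR s H Q" and "lax_shock_at F s H Q 0"
      and anti: "strict_antimono_on {..<0} H"
      by (auto simp: decreasing_discontinuous_profile_def)
    note C = classify_discontinuous[OF N not_isCont_if_lax_shock[OF this(2)]]
    have "H (-1) < H (-2)" by (rule monotone_onD[OF anti]) auto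
    then have "H1 < HL" using C(7,8) by (cases H1 HL rule: linorder_cases) auto
    then show "HR < HS \<and> HS < H1 \<and> H1 < HL" using C by blast
  next
    assume "HR < HS \<and> HS < H1 \<and> H1 < HL"
    then show "\<exists>s H Q. decreasing_discontinuous_profile F HL HR s H Q"
      using shock_profile_exists classify_discontinuous(6) by (metis order_less_trans)
  qed
qed

end

section \<open>Thresholds\<close>

lemma threshold_order:
  fixes \<nu> :: real
  assumes "\<nu> > 1"
  shows "(\<nu> + 1) / \<nu>\<^sup>2 < (\<nu> + 1) * sqrt (2 * (\<nu>\<^sup>2 + 1)) / (2 * \<nu>)"
proof -
  have "1 < \<nu>\<^sup>2" using assms by simp
  then have "2 < sqrt (2 * (\<nu>\<^sup>2 + 1))" by (intro real_less_rsqrt) simp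
  then have "2 * 1 < sqrt (2 * (\<nu>\<^sup>2 + 1)) * \<nu>"
    by (rule mult_strict_mono) (use assms in \<open>auto intro!: add_nonneg_pos\<close>)
  then have "(\<nu> + 1) * (2 / (2 * \<nu>\<^sup>2)) < (\<nu> + 1) * (sqrt (2 * (\<nu>\<^sup>2 + 1)) * \<nu> / (2 * \<nu>\<^sup>2))"
    using assms by (intro mult_strict_left_mono divide_strict_right_mono) auto
  then show ?thesis using assms by (simp add: power2_eq_square)
qed

context endstates
begin

text \<open>
  In units of \<open>b = \<surd>HR\<close>, one has \<open>q F = b\<^sup>3 X\<close> with \<open>X = F \<nu>\<^sup>2 / (\<nu> + 1)\<close>, so comparing \<open>Hs\<close> with \<open>HR\<close>
  or \<open>HL\<close> compares \<open>X\<close> with \<open>1\<close> or \<open>\<nu>\<^sup>3\<close>, and comparing \<open>H*\<close> with \<open>HL\<close> compares \<open>X\<^sup>2\<close> with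
  \<open>\<nu>\<^sup>2 (\<nu>\<^sup>2 + 1) / 2\<close>.
\<close>

lemma thresholds:
  defines "\<nu> \<equiv> sqrt (HL / HR)"
  shows "HR < HS \<longleftrightarrow> (\<nu> + 1) / \<nu>\<^sup>2 < F" and "HS < HR \<longleftrightarrow> F < (\<nu> + 1) / \<nu>\<^sup>2"
    and "HS < HL \<longleftrightarrow> F < \<nu> * (\<nu> + 1)"
    and "HL < H1 \<longleftrightarrow> (\<nu> + 1) * sqrt (2 * (\<nu>\<^sup>2 + 1)) / (2 * \<nu>) < F"
    and "H1 < HL \<longleftrightarrow> F < (\<nu> + 1) * sqrt (2 * (\<nu>\<^sup>2 + 1)) / (2 * \<nu>)"
    and "H1 = HL \<longleftrightarrow> F = (\<nu> + 1) * sqrt (2 * (\<nu>\<^sup>2 + 1)) / (2 * \<nu>)"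
proof -
  define b where "b = sqrt HR"
  define X where "X = F * \<nu>\<^sup>2 / (\<nu> + 1)"
  have b: "b > 0" "HR = b\<^sup>2" using HR_pos by (auto simp: b_def)
  have \<nu>: "\<nu> > 0" using HL_pos HR_pos by (simp add: \<nu>_def)
  have a: "sqrt HL = \<nu> * b" "HL = \<nu>\<^sup>2 * b\<^sup>2"
    using HL_pos HR_pos by (auto simp: \<nu>_def b_def real_sqrt_divide power_divide)
  have X: "X > 0" "F = X * (\<nu> + 1) / \<nu>\<^sup>2"
    using \<nu> F_pos by (auto simp: X_def)
  have "q = (b ^ 3 * \<nu>\<^sup>2) * b / ((\<nu> + 1) * b)"
    unfolding q0_def b_def[symmetric] a(1) unfolding a(2) b(2)
    by (simp add: power2_eq_square power3_eq_cube algebra_simps)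
  then have "q = b ^ 3 * \<nu>\<^sup>2 / (\<nu> + 1)"
    using b(1) by simp
  then have qF: "q * F = b ^ 3 * X" by (simp add: X_def)
  have HS3: "HS ^ 3 = (b ^ 3)\<^sup>2 * X\<^sup>2" unfolding HS_cubed qF by (simp add: power_mult_distrib)
  have b6: "(b ^ 3)\<^sup>2 > 0" using b by simp
  have HR3: "HR ^ 3 = (b ^ 3)\<^sup>2 * 1" unfolding b(2) by (simp flip: power_mult)
  have HL3: "HL ^ 3 = (b ^ 3)\<^sup>2 * (\<nu> ^ 3)\<^sup>2"
    unfolding a(2) by (simp add: power_mult_distrib flip: power_mult)
  have star: "HL * HR * (HL + HR) = (b ^ 3)\<^sup>2 * (\<nu>\<^sup>2 * (\<nu>\<^sup>2 + 1))"
    unfolding a(2) b(2) by (simp add: power2_eq_square power3_eq_cube algebra_simps)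
  define m where "m = \<nu> * sqrt (2 * (\<nu>\<^sup>2 + 1)) / 2"
  have m: "m > 0" "m\<^sup>2 = \<nu>\<^sup>2 * (\<nu>\<^sup>2 + 1) / 2"
    using \<nu> by (auto simp: m_def power_mult_distrib power_divide add_pos_pos)
  have cmp: "y * (\<nu> + 1) / \<nu>\<^sup>2 < F \<longleftrightarrow> y < X" "F < y * (\<nu> + 1) / \<nu>\<^sup>2 \<longleftrightarrow> X < y"
    "F = y * (\<nu> + 1) / \<nu>\<^sup>2 \<longleftrightarrow> X = y" for y
    using \<nu> unfolding X(2) by (auto simp: divide_less_cancel)
  have sq: "y\<^sup>2 < z\<^sup>2 \<longleftrightarrow> y < z" "y\<^sup>2 = z\<^sup>2 \<longleftrightarrow> y = z" if "0 < y" "0 < z" for y z :: real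
    using that by (auto simp: power_strict_mono less_imp_le power2_eq_iff intro: power2_less_imp_less)
  have mid: "(\<nu> + 1) * sqrt (2 * (\<nu>\<^sup>2 + 1)) / (2 * \<nu>) = m * (\<nu> + 1) / \<nu>\<^sup>2"
    using \<nu> by (simp add: m_def power2_eq_square)
  have top: "\<nu> * (\<nu> + 1) = \<nu> ^ 3 * (\<nu> + 1) / \<nu>\<^sup>2"
    using \<nu> by (simp add: power2_eq_square power3_eq_cube)
  have star': "HL * HR * (HL + HR) = (b ^ 3)\<^sup>2 * (2 * m\<^sup>2)"
    unfolding star m(2) by simp
  have HS3': "2 * HS ^ 3 = (b ^ 3)\<^sup>2 * (2 * X\<^sup>2)" unfolding HS3 by simp
  show "HR < HS \<longleftrightarrow> (\<nu> + 1) / \<nu>\<^sup>2 < F"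
    unfolding cube_HS_iff(1)[OF HR_pos, symmetric] HR3 HS3 using b6 cmp(1)[of 1] sq(1)[of 1 X] X(1)
    by simp
  show "HS < HR \<longleftrightarrow> F < (\<nu> + 1) / \<nu>\<^sup>2"
    unfolding cube_HS_iff(2)[OF HR_pos, symmetric] HR3 HS3 using b6 cmp(2)[of 1] sq(1)[of X 1] X(1)
    by simp
  show "HS < HL \<longleftrightarrow> F < \<nu> * (\<nu> + 1)"
    unfolding cube_HS_iff(2)[OF HL_pos, symmetric] HL3 HS3 top cmp mult_less_cancel_left_pos[OF b6]
    using sq(1)[of X "\<nu> ^ 3"] X(1) \<nu> by simp
  show "HL < H1 \<longleftrightarrow> (\<nu> + 1) * sqrt (2 * (\<nu>\<^sup>2 + 1)) / (2 * \<nu>) < F"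
    unfolding Hstar_less_iff(1)[OF HL_pos] mid cmp star' HS3' mult_less_cancel_left_pos[OF b6]
    using sq(1)[OF m(1) X(1)] by simp
  show "H1 < HL \<longleftrightarrow> F < (\<nu> + 1) * sqrt (2 * (\<nu>\<^sup>2 + 1)) / (2 * \<nu>)"
    unfolding Hstar_less_iff(2)[OF HL_pos] mid cmp star' HS3' mult_less_cancel_left_pos[OF b6]
    using sq(1)[OF X(1) m(1)] by simp
  show "H1 = HL \<longleftrightarrow> F = (\<nu> + 1) * sqrt (2 * (\<nu>\<^sup>2 + 1)) / (2 * \<nu>)"
    unfolding Hstar_less_iff(3)[OF HL_pos] mid cmp star' HS3'
    using sq(2)[OF X(1) m(1)] b6 by auto
qed

end

theorem proposition2p1:
  fixes F HL HR \<nu> :: real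
  assumes "F > 0" and "HL > 0" and "HR > 0" and "\<nu> = sqrt (HL / HR)"
  shows
    "(HL < HR \<longleftrightarrow> \<nu> < 1) \<and> (HR < HL \<longleftrightarrow> \<nu> > 1) \<and>
     (HL < HR \<longrightarrow>
        (\<forall>c H Q. nc_profile F HL HR c H Q \<longrightarrow>
           up_to_translation (increasing_smooth_profile F HL HR c) H Q) \<and>
        ((\<exists>c H Q. increasing_smooth_profile F HL HR c H Q) \<longleftrightarrow>
           HL < HR \<and> HR < Hs F HL HR)) \<and>
     (HL < HR \<and> HR < Hs F HL HR \<longleftrightarrow> \<nu> < 1 \<and> (\<nu> + 1) / \<nu>\<^sup>2 < F) \<and>
     (HR < HL \<longrightarrow>
        (\<forall>c H Q. nc_profile F HL HR c H Q \<longrightarrow>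
           up_to_translation (nonmonotone_discontinuous_profile F HL HR c) H Q \<or>
           up_to_translation (riemann_profile F HL HR c) H Q \<or>
           up_to_translation (decreasing_discontinuous_profile F HL HR c) H Q \<or>
           up_to_translation (decreasing_smooth_profile F HL HR c) H Q) \<and>
        ((\<exists>c H Q. nonmonotone_discontinuous_profile F HL HR c H Q) \<longleftrightarrow>
           HR < Hs F HL HR \<and> Hs F HL HR < HL \<and> HL < Hstar F HL HR) \<and>
        ((\<exists>c H Q. riemann_profile F HL HR c H Q) \<longleftrightarrow>
           HR < Hs F HL HR \<and> Hs F HL HR < Hstar F HL HR \<and> Hstar F HL HR = HL) \<and>
        ((\<exists>c H Q. decreasing_discontinuous_profile F HL HR c H Q) \<longleftrightarrow>
           HR < Hs F HL HR \<and> Hs F HL HR < Hstar F HL HR \<and> Hstar F HL HR < HL) \<and>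
        ((\<exists>c H Q. decreasing_smooth_profile F HL HR c H Q) \<longleftrightarrow>
           Hs F HL HR < HR \<and> HR < HL)) \<and>
     (HR < Hs F HL HR \<and> Hs F HL HR < HL \<and> HL < Hstar F HL HR \<longleftrightarrow>
        \<nu> > 1 \<and> (\<nu> + 1) * sqrt (2 * (\<nu>\<^sup>2 + 1)) / (2 * \<nu>) < F \<and> F < \<nu> * (\<nu> + 1)) \<and>
     (HR < Hs F HL HR \<and> Hs F HL HR < Hstar F HL HR \<and> Hstar F HL HR = HL \<longleftrightarrow>
        \<nu> > 1 \<and> F = (\<nu> + 1) * sqrt (2 * (\<nu>\<^sup>2 + 1)) / (2 * \<nu>)) \<and>
     (HR < Hs F HL HR \<and> Hs F HL HR < Hstar F HL HR \<and> Hstar F HL HR < HL \<longleftrightarrow>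
        \<nu> > 1 \<and> (\<nu> + 1) / \<nu>\<^sup>2 < F \<and>
        F < (\<nu> + 1) * sqrt (2 * (\<nu>\<^sup>2 + 1)) / (2 * \<nu>)) \<and>
     (Hs F HL HR < HR \<and> HR < HL \<longleftrightarrow> \<nu> > 1 \<and> F < (\<nu> + 1) / \<nu>\<^sup>2)"
proof -
  have \<nu>_less: "HL < HR \<longleftrightarrow> \<nu> < 1" and \<nu>_greater: "HR < HL \<longleftrightarrow> \<nu> > 1"
    using assms(2-4) by simp_all
  show ?thesis
  proof (cases "HL = HR")
    case True
    then have "\<not> HL < HR" "\<not> HR < HL" "\<not> \<nu> < 1" "\<not> \<nu> > 1"
      using \<nu>_less \<nu>_greater by simp_all
    moreover have "\<not> (HR < Hs F HL HR \<and> Hs F HL HR < HL)"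
      "\<not> (HR < Hs F HL HR \<and> Hs F HL HR < Hstar F HL HR \<and> Hstar F HL HR = HL)"
      "\<not> (HR < Hs F HL HR \<and> Hs F HL HR < Hstar F HL HR \<and> Hstar F HL HR < HL)"
      using True by linarith+
    ultimately show ?thesis by blast
  next
    case False
    interpret endstates F HL HR
      using assms(1-3) False by unfold_locales
    note T = thresholds[folded assms(4)]
    have order: "(\<nu> + 1) / \<nu>\<^sup>2 < (\<nu> + 1) * sqrt (2 * (\<nu>\<^sup>2 + 1)) / (2 * \<nu>)" if "\<nu> > 1"
      by (rule threshold_order[OF that])
    have ii: "HR < HS \<and> HS < HL \<and> HL < H1 \<longleftrightarrow>
        \<nu> > 1 \<and> (\<nu> + 1) * sqrt (2 * (\<nu>\<^sup>2 + 1)) / (2 * \<nu>) < F \<and> F < \<nu> * (\<nu> + 1)"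
      using T order \<nu>_greater by (smt (verit))
    have iii: "HR < HS \<and> HS < H1 \<and> H1 = HL \<longleftrightarrow>
        \<nu> > 1 \<and> F = (\<nu> + 1) * sqrt (2 * (\<nu>\<^sup>2 + 1)) / (2 * \<nu>)"
      using T order \<nu>_greater Hs_less_Hstar_iff by (smt (verit))
    have iv: "HR < HS \<and> HS < H1 \<and> H1 < HL \<longleftrightarrow>
        \<nu> > 1 \<and> (\<nu> + 1) / \<nu>\<^sup>2 < F \<and> F < (\<nu> + 1) * sqrt (2 * (\<nu>\<^sup>2 + 1)) / (2 * \<nu>)"
      using T \<nu>_greater Hs_less_Hstar_iff by (smt (verit))
    have v: "HS < HR \<and> HR < HL \<longleftrightarrow> \<nu> > 1 \<and> F < (\<nu> + 1) / \<nu>\<^sup>2"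
      using T \<nu>_greater by blast
    have i: "HL < HR \<and> HR < HS \<longleftrightarrow> \<nu> < 1 \<and> (\<nu> + 1) / \<nu>\<^sup>2 < F"
      using T \<nu>_less by blast
    have increasing: "(\<exists>c H Q. increasing_smooth_profile F HL HR c H Q) \<longleftrightarrow> HL < HR \<and> HR < HS"
      if "HL < HR"
      unfolding smooth_exists_iff(1)[OF that] using that by simp
    have decreasing: "(\<exists>c H Q. decreasing_smooth_profile F HL HR c H Q) \<longleftrightarrow> HS < HR \<and> HR < HL"
      if "HR < HL"
      unfolding smooth_exists_iff(2)[OF that] using that by simp
    show ?thesis
      by (intro conjI impI allI \<nu>_less \<nu>_greater i ii iii iv v increasing decreasing
          discontinuous_exists_iff profile_kinds)
  qed
qed

end
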